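(* Let $f:\mathbb{R}^n\to\mathbb{R}$ be a Morse polynomial function, $f\in\mathbb{R}[X]=\mathbb{R}[x_1,\dots,x_n]$. Assume that $f$ achieves a minimum value $f^*$ on $\mathbb{R}^n$. Then $$f-f^*\in\sum\mathbb{R}[X]^2+I_{grad}(f),$$ where $I_{grad}(f)=\left\langle\frac{\partial f}{\partial x_1},\dots,\frac{\partial f}{\partial x_n}\right\rangle$ is the gradient ideal of $f$ in $\mathbb{R}[X]$.
   Context: $\sum\mathbb{R}[X]^2$ is the set of finite sums of squares of polynomials in $\mathbb{R}[X]$. A polynomial function $f:\mathbb{R}^n\to\mathbb{R}$ is Morse if at every critical point $p\in\mathbb{R}^n$ of $f$ the Hessian matrix $D^2f(p)$ is invertible. *)

theory Defs
  imports
    "HOL-Analysis.Analysis"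
    "HOL-Library.Poly_Mapping"
    "HOL-Library.Set_Algebras"
begin

text \<open>
  The ring of real polynomials in the variables indexed by the finite type \<open>'n\<close>, so \<open>n = CARD('n)\<close>.
  A key \<open>m :: 'n \<Rightarrow>\<^sub>0 nat\<close> is the exponent vector of a monomial; the ring structure is the
  convolution product of \<^theory>\<open>HOL-Library.Poly_Mapping\<close>.
\<close>

type_synonym 'n rpoly = "('n \<Rightarrow>\<^sub>0 nat) \<Rightarrow>\<^sub>0 real"

definition const_poly :: "real \<Rightarrow> 'n rpoly" where
  "const_poly c = Poly_Mapping.single 0 c"

definition eval :: "('n::finite) rpoly \<Rightarrow> real ^ 'n \<Rightarrow> real" where
  "eval f x = (\<Sum>m \<in> Poly_Mapping.keys f.
     Poly_Mapping.lookup f m * (\<Prod>i\<in>UNIV. (x $ i) ^ Poly_Mapping.lookup m i))"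

text \<open>
  The formal partial derivative. When the exponent of variable \<open>i\<close> in \<open>m\<close> is zero, the truncated
  subtraction is harmless because the coefficient vanishes.
\<close>

definition partial :: "'n \<Rightarrow> 'n rpoly \<Rightarrow> 'n rpoly" where
  "partial i f = (\<Sum>m \<in> Poly_Mapping.keys f.
     Poly_Mapping.single (m - Poly_Mapping.single i 1)
       (Poly_Mapping.lookup f m * of_nat (Poly_Mapping.lookup m i)))"

definition critical_point :: "('n::finite) rpoly \<Rightarrow> real ^ 'n \<Rightarrow> bool" where
  "critical_point f p \<longleftrightarrow> (\<forall>i. eval (partial i f) p = 0)"

definition hessian :: "('n::finite) rpoly \<Rightarrow> real ^ 'n \<Rightarrow> real ^ 'n ^ 'n" where
  "hessian f p = (\<chi> i j. eval (partial i (partial j f)) p)"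

definition morse :: "('n::finite) rpoly \<Rightarrow> bool" where
  "morse f \<longleftrightarrow> (\<forall>p. critical_point f p \<longrightarrow> invertible (hessian f p))"

definition sums_of_squares :: "'n rpoly set" where
  "sums_of_squares = {\<Sum>k<m. (g k)\<^sup>2 | (m :: nat) g. True}"

text \<open>
  The ideal generated by the partial derivatives, as the span of a subset of the ring regarded as
  a module over itself.
\<close>

definition gradient_ideal :: "'n rpoly \<Rightarrow> 'n rpoly set" where
  "gradient_ideal f = module.span (*) (range (\<lambda>i. partial i f))"

definition has_minimum_value :: "('a \<Rightarrow> real) \<Rightarrow> real \<Rightarrow> bool" where
  "has_minimum_value F c \<longleftrightarrow> (\<exists>p. F p = c) \<and> (\<forall>x. c \<le> F x)"

lemma module_mult: "module ((*) :: 'a::comm_ring_1 \<Rightarrow> 'a \<Rightarrow> 'a)"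
  by unfold_locales (simp_all add: algebra_simps)

lemma gradient_ideal_explicit:
  "gradient_ideal (f :: ('n::finite) rpoly) = {\<Sum>i\<in>UNIV. h i * partial i f | h. True}" (is "_ = ?J")
proof -
  interpret M: module "(*) :: 'n rpoly \<Rightarrow> 'n rpoly \<Rightarrow> 'n rpoly" by (rule module_mult)
  have in_J: "(\<Sum>i\<in>UNIV. h i * partial i f) \<in> ?J" for h by blast
  have sub: "M.subspace ?J"
  proof (rule M.subspaceI)
    show "0 \<in> ?J" using in_J[of "\<lambda>_. 0"] by simp
  next
    fix a b assume "a \<in> ?J" "b \<in> ?J"
    then obtain h k where "a = (\<Sum>i\<in>UNIV. h i * partial i f)" "b = (\<Sum>i\<in>UNIV. k i * partial i f)"
      by blast
    then have "a + b = (\<Sum>i\<in>UNIV. (h i + k i) * partial i f)"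
      by (simp add: distrib_right sum.distrib)
    then show "a + b \<in> ?J" using in_J[of "\<lambda>i. h i + k i"] by simp
  next
    fix c a assume "a \<in> ?J"
    then obtain h where "a = (\<Sum>i\<in>UNIV. h i * partial i f)" by blast
    then have "c * a = (\<Sum>i\<in>UNIV. (c * h i) * partial i f)"
      by (simp only: sum_distrib_left mult.assoc)
    then show "c * a \<in> ?J" using in_J[of "\<lambda>i. c * h i"] by (simp only:)
  qed
  have gen: "partial j f \<in> ?J" for j
  proof -
    have "(\<Sum>i\<in>UNIV. (if i = j then 1 else 0) * partial i f) = partial j f"
      by (simp add: if_distrib[where f = "\<lambda>x. x * _"] cong: if_cong)
    then show ?thesis using in_J[of "\<lambda>i. if i = j then 1 else 0"] by simp
  qed
  have "M.span (range (\<lambda>i. partial i f)) \<subseteq> ?J"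
    by (rule M.span_minimal[OF _ sub]) (use gen in blast)
  moreover have "?J \<subseteq> M.span (range (\<lambda>i. partial i f))"
    by clarify (intro M.span_sum M.span_scale M.span_base rangeI)
  ultimately show ?thesis unfolding gradient_ideal_def by blast
qed

text \<open>The formal partial derivatives agree with the analytic ones.\<close>

lemma eval_superset:
  assumes "finite A" "Poly_Mapping.keys f \<subseteq> A"
  shows "eval f x = (\<Sum>m\<in>A. Poly_Mapping.lookup f m * (\<Prod>i\<in>UNIV. (x $ i) ^ Poly_Mapping.lookup m i))"
  unfolding eval_def
  by (rule sum.mono_neutral_left) (use assms in \<open>auto simp: in_keys_iff\<close>)

lemma eval_0: "eval 0 x = 0"
  by (simp add: eval_def)

lemma eval_add: "eval (f + g) x = eval f x + eval g x"
proof -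
  let ?A = "Poly_Mapping.keys f \<union> Poly_Mapping.keys g"
  have "finite ?A" by simp
  moreover have "Poly_Mapping.keys (f + g) \<subseteq> ?A" by (rule keys_add)
  ultimately show ?thesis
    by (simp add: eval_superset[of ?A] lookup_add distrib_right sum.distrib)
qed

lemma eval_sum: "eval (\<Sum>a\<in>A. F a) x = (\<Sum>a\<in>A. eval (F a) x)"
  by (induction A rule: infinite_finite_induct) (simp_all add: eval_0 eval_add)

lemma eval_single:
  "eval (Poly_Mapping.single m c) x = c * (\<Prod>i\<in>UNIV. (x $ i) ^ Poly_Mapping.lookup m i)"
  by (simp add: eval_def)

lemma eval_const_poly: "eval (const_poly c) x = c"
  by (simp add: const_poly_def eval_single)

lemma eval_partial:
  "eval (partial i f) x = (\<Sum>m \<in> Poly_Mapping.keys f. Poly_Mapping.lookup f m *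
     (of_nat (Poly_Mapping.lookup m i) * (x $ i) ^ (Poly_Mapping.lookup m i - 1) *
      (\<Prod>j\<in>UNIV - {i}. (x $ j) ^ Poly_Mapping.lookup m j)))"
proof -
  have "(\<Prod>j\<in>UNIV. (x $ j) ^ Poly_Mapping.lookup (m - Poly_Mapping.single i 1) j) =
    (x $ i) ^ (Poly_Mapping.lookup m i - 1) * (\<Prod>j\<in>UNIV - {i}. (x $ j) ^ Poly_Mapping.lookup m j)" for m
    by (subst prod.remove[of _ i]) (auto simp: minus_poly_mapping.rep_eq lookup_single when_def intro!: prod.cong)
  then show ?thesis
    by (simp add: partial_def eval_sum eval_single mult.assoc)
qed

lemma has_derivative_eval:
  "(eval f has_derivative (\<lambda>h. \<Sum>i\<in>UNIV. h $ i * eval (partial i f) x)) (at x)"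
proof -
  have "((\<lambda>x. x $ i ^ k) has_derivative (\<lambda>h. of_nat k * (h $ i) * (x $ i) ^ (k - 1))) (at x)" for i k
    by (rule derivative_eq_intros bounded_linear.has_derivative[OF bounded_linear_vec_nth] refl)+
  note pow = this
  have "((\<lambda>x. \<Sum>m \<in> Poly_Mapping.keys f. Poly_Mapping.lookup f m *
           (\<Prod>i\<in>UNIV. x $ i ^ Poly_Mapping.lookup m i)) has_derivative
         (\<lambda>h. \<Sum>m \<in> Poly_Mapping.keys f. Poly_Mapping.lookup f m *
           (\<Sum>i\<in>UNIV. of_nat (Poly_Mapping.lookup m i) * (h $ i) * (x $ i) ^ (Poly_Mapping.lookup m i - 1) *
              (\<Prod>j\<in>UNIV - {i}. x $ j ^ Poly_Mapping.lookup m j)))) (at x)"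
    by (intro has_derivative_sum has_derivative_mult_right has_derivative_prod pow)
  also have "(\<lambda>h. \<Sum>m \<in> Poly_Mapping.keys f. Poly_Mapping.lookup f m *
           (\<Sum>i\<in>UNIV. of_nat (Poly_Mapping.lookup m i) * (h $ i) * (x $ i) ^ (Poly_Mapping.lookup m i - 1) *
              (\<Prod>j\<in>UNIV - {i}. x $ j ^ Poly_Mapping.lookup m j))) =
         (\<lambda>h. \<Sum>i\<in>UNIV. h $ i * eval (partial i f) x)"
    by (rule ext, simp add: eval_partial sum_distrib_left, subst sum.swap)
       (auto intro!: sum.cong simp: mult_ac)
  finally show ?thesis
    by (simp add: eval_def[abs_def])
qed

end

theory Submission
  imports Defs "HOL-Computational_Algebra.Fraction_Field"
begin

text \<open>
  Let \<open>I\<close> be the gradient ideal. At a critical point \<open>p\<close> the Hessian is invertible, so the determinant of a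
  matrix of divided differences of the gradient at \<open>p\<close> is, after scaling, an idempotent \<open>c\<^sub>p\<close> modulo \<open>I\<close> with
  \<open>c\<^sub>p h \<equiv> h(p) c\<^sub>p\<close> for all \<open>h\<close>. The \<open>c\<^sub>p\<close> are orthogonal and lie in a finite-dimensional space,
  hence there are finitely many critical points. The polynomial
  \<open>\<Sum> (\<partial>\<^sub>i f)\<^sup>2 + \<Sum> c\<^sub>p\<^sup>2\<close> has no real zero, so by the real Nullstellensatz the
  complementary idempotent \<open>e = 1 - \<Sum> c\<^sub>p\<close> satisfies \<open>- e \<equiv> s e\<close> for a sum of squares \<open>s\<close>.
  With \<open>g = f - f\<^sup>*\<close>, the part \<open>c\<^sub>p g \<equiv> g(p) c\<^sub>p\<^sup>2\<close> is a square because \<open>g(p) \<ge> 0\<close>, and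
  \<open>e g \<equiv> (e (g + 1) / 2)\<^sup>2 + s (e (g - 1) / 2)\<^sup>2\<close>.

  For the real Nullstellensatz, a polynomial \<open>q\<close> without a certificate \<open>- 1 = s + q k\<close> vanishes at a point of
  some ordered field. Adjoining roots, the intermediate value property holds there for any prescribed finite
  family of polynomials, and Hoermander's elimination method then transfers the zero to the reals.
\<close>

section \<open>Ring homomorphisms and substitution\<close>

text \<open>The Morse condition speaks about real critical points only, so the gradient ideal may be
  neither radical nor zero-dimensional. The idempotents \<open>c\<^sub>p\<close> therefore come from
  explicit determinants, not from a decomposition of the variety; whatever lies over nonreal zeros
  is left in \<open>e\<close>, where a certificate for \<open>- 1\<close> is all that is needed. In
  the Nullstellensatz the obstacle is to manage without a real closure. The polynomials whose
  intermediate value property elimination uses are computed in the polynomial ring, by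
  pseudo-division, before any field is chosen; so they are finitely many and depend only on
  \<open>q\<close> and its number of variables. The ring has variables indexed by
  \<open>nat\<close>, of which \<open>q\<close> involves finitely many, and a fresh one can always
  take the value of a missing root. Since the roots of the family are bounded in number by the sum
  of the degrees, some ordering with \<open>q\<close> in its support has the most roots, and for it
  no root is missing where a sign changes.\<close>

definition rhom :: "('a::comm_ring_1 \<Rightarrow> 'b::comm_ring_1) \<Rightarrow> bool" where
  "rhom h \<longleftrightarrow> h 1 = 1 \<and> (\<forall>a b. h (a + b) = h a + h b) \<and> (\<forall>a b. h (a * b) = h a * h b)"

lemma rhomI: "h 1 = 1 \<Longrightarrow> (\<And>a b. h (a + b) = h a + h b) \<Longrightarrow> (\<And>a b. h (a * b) = h a * h b) \<Longrightarrow> rhom h"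
  by (simp add: rhom_def)

lemma
  assumes "rhom h"
  shows rhom_1: "h 1 = 1" and rhom_add: "h (a + b) = h a + h b" and rhom_mult: "h (a * b) = h a * h b"
    and rhom_0: "h 0 = 0" and rhom_uminus: "h (- a) = - h a" and rhom_diff: "h (a - b) = h a - h b"
proof -
  show *: "h 1 = 1" "h (a + b) = h a + h b" "h (a * b) = h a * h b" for a b
    using assms by (auto simp: rhom_def)
  show 0: "h 0 = 0" using *(2)[of 0 0] by simp
  show u: "h (- a) = - h a" for a using *(2)[of a "- a"] 0 by (simp add: eq_neg_iff_add_eq_0 add.commute)
  show "h (a - b) = h a - h b" using *(2)[of a "- b"] u by simp
qed

lemmas rhom_simps = rhom_1 rhom_add rhom_mult rhom_0 rhom_uminus rhom_diff

lemma rhom_power: "rhom h \<Longrightarrow> h (a ^ n) = h a ^ n"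
  by (induction n) (simp_all add: rhom_simps)

lemma rhom_sum: "rhom h \<Longrightarrow> h (sum f A) = (\<Sum>a\<in>A. h (f a))"
  by (induction A rule: infinite_finite_induct) (simp_all add: rhom_simps)

lemma rhom_of_nat: "rhom h \<Longrightarrow> h (of_nat n) = of_nat n"
  by (induction n) (simp_all add: rhom_simps)

lemma rhom_comp: "rhom g \<Longrightarrow> rhom h \<Longrightarrow> rhom (\<lambda>a. g (h a))"
  by (simp add: rhom_def)

lemma rhom_const: "rhom h \<Longrightarrow> rhom (\<lambda>a. [:h a:])"
  by (simp add: rhom_def one_pCons)

lemma poly_map_poly: "rhom h \<Longrightarrow> poly (map_poly h p) (h a) = h (poly p a)"
  by (induction p) (simp_all add: rhom_simps map_poly_pCons)

lemma map_poly_add: "rhom h \<Longrightarrow> map_poly h (p + q) = map_poly h p + map_poly h q"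
  by (intro poly_eqI) (simp add: coeff_map_poly rhom_simps)

lemma map_poly_mult: "rhom h \<Longrightarrow> map_poly h (p * q) = map_poly h p * map_poly h q"
  by (intro poly_eqI) (simp add: coeff_map_poly rhom_simps coeff_mult rhom_sum)

lemma map_poly_hom_smult: "rhom h \<Longrightarrow> map_poly h (smult c p) = smult (h c) (map_poly h p)"
  by (intro poly_eqI) (simp add: coeff_map_poly rhom_simps)

lemma map_poly_pderiv:
  fixes h :: "'a::{comm_ring_1,semiring_no_zero_divisors} \<Rightarrow> 'b::{comm_ring_1,semiring_no_zero_divisors}"
  shows "rhom h \<Longrightarrow> map_poly h (pderiv p) = pderiv (map_poly h p)"
  by (intro poly_eqI) (simp add: coeff_map_poly rhom_simps coeff_pderiv rhom_of_nat del: of_nat_Suc)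

lemma rhom_poly_eval: "rhom h \<Longrightarrow> rhom (\<lambda>p. poly (map_poly h p) a)"
  by (intro rhomI) (simp_all add: map_poly_add map_poly_mult rhom_simps map_poly_1)

definition var :: "'v \<Rightarrow> 'v rpoly" where
  "var v = Poly_Mapping.single (Poly_Mapping.single v 1) 1"

text \<open>The product runs over \<open>keys\<close>, so the variable type may be infinite;
  \<open>nat\<close> later supplies fresh variables.\<close>

definition monom_value :: "('v \<Rightarrow> 'a::comm_ring_1) \<Rightarrow> ('v \<Rightarrow>\<^sub>0 nat) \<Rightarrow> 'a" where
  "monom_value x m = (\<Prod>v\<in>Poly_Mapping.keys m. x v ^ Poly_Mapping.lookup m v)"

definition subst :: "(real \<Rightarrow> 'a::comm_ring_1) \<Rightarrow> ('v \<Rightarrow> 'a) \<Rightarrow> 'v rpoly \<Rightarrow> 'a" where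
  "subst \<iota> x p = (\<Sum>m\<in>Poly_Mapping.keys p. \<iota> (Poly_Mapping.lookup p m) * monom_value x m)"

lemma poly_mapping_induct [case_names single sum]:
  assumes "\<And>k c. P (Poly_Mapping.single k c)" "\<And>f g. P f \<Longrightarrow> P g \<Longrightarrow> P (f + g)"
  shows "P (f :: 'k \<Rightarrow>\<^sub>0 'c::comm_monoid_add)"
proof -
  have "P (\<Sum>k\<in>A. Poly_Mapping.single k (Poly_Mapping.lookup f k))" for A
    by (induction A rule: infinite_finite_induct) (use assms assms(1)[of undefined 0] in auto)
  moreover have "(\<Sum>k\<in>Poly_Mapping.keys f. Poly_Mapping.single k (Poly_Mapping.lookup f k)) = f"
    by (intro poly_mapping_eqI) (auto simp: lookup_sum lookup_single when_def in_keys_iff)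
  ultimately show ?thesis by metis
qed

lemma rpoly_induct [case_names const var add mult]:
  assumes "\<And>c. P (const_poly c)" "\<And>v. P (var v)"
    "\<And>p q. P p \<Longrightarrow> P q \<Longrightarrow> P (p + q)" "\<And>p q. P p \<Longrightarrow> P q \<Longrightarrow> P (p * q)"
  shows "P (p :: 'v rpoly)"
proof -
  have pow: "P (Poly_Mapping.single (Poly_Mapping.single v k) 1)" for v k
  proof (induction k)
    case 0
    then show ?case using assms(1)[of 1] by (simp add: const_poly_def)
  next
    case (Suc k)
    have "Poly_Mapping.single (Poly_Mapping.single v (Suc k)) 1 =
        var v * Poly_Mapping.single (Poly_Mapping.single v k) 1"
      by (simp add: var_def mult_single single_add[symmetric])
    then show ?case using assms(2,4) Suc by metis
  qed
  have mon: "P (Poly_Mapping.single m 1)" for m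
  proof (induction m rule: poly_mapping_induct)
    case (single v k)
    then show ?case by (rule pow)
  next
    case (sum f g)
    have "Poly_Mapping.single (f + g) 1 = Poly_Mapping.single f 1 * (Poly_Mapping.single g 1 :: 'v rpoly)"
      by (simp add: mult_single)
    then show ?case using assms(4) sum by metis
  qed
  show ?thesis
  proof (induction p rule: poly_mapping_induct)
    case (single m c)
    have "Poly_Mapping.single m c = const_poly c * Poly_Mapping.single m 1"
      by (simp add: const_poly_def mult_single)
    then show ?case using assms(1,4) mon by metis
  next
    case (sum f g)
    then show ?case by (intro assms(3))
  qed
qed

lemma monom_value_superset:
  assumes "finite A" "Poly_Mapping.keys m \<subseteq> A"
  shows "monom_value x m = (\<Prod>v\<in>A. x v ^ Poly_Mapping.lookup m v)"
  unfolding monom_value_def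
  by (rule prod.mono_neutral_left) (use assms in \<open>auto simp: in_keys_iff\<close>)

lemma monom_value_add: "monom_value x (m + m') = monom_value x m * monom_value x m'"
proof -
  let ?A = "Poly_Mapping.keys m \<union> Poly_Mapping.keys m'"
  have "finite ?A" "Poly_Mapping.keys (m + m') \<subseteq> ?A" by (simp_all add: keys_add)
  then show ?thesis
    by (simp add: monom_value_superset[of ?A] lookup_add power_add prod.distrib)
qed

lemma subst_superset:
  assumes "finite A" "Poly_Mapping.keys p \<subseteq> A" "rhom \<iota>"
  shows "subst \<iota> x p = (\<Sum>m\<in>A. \<iota> (Poly_Mapping.lookup p m) * monom_value x m)"
  unfolding subst_def
  by (rule sum.mono_neutral_left) (use assms in \<open>auto simp: in_keys_iff rhom_simps\<close>)

lemma subst_single: "rhom \<iota> \<Longrightarrow> subst \<iota> x (Poly_Mapping.single m c) = \<iota> c * monom_value x m"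
  by (subst subst_superset[of "{m}"]) simp_all

lemma subst_cong:
  "(\<And>m v. m \<in> Poly_Mapping.keys p \<Longrightarrow> v \<in> Poly_Mapping.keys m \<Longrightarrow> x v = y v) \<Longrightarrow> subst \<iota> x p = subst \<iota> y p"
  unfolding subst_def monom_value_def by (intro sum.cong arg_cong2[of _ _ _ _ "(*)"] prod.cong) auto

lemma
  assumes "rhom \<iota>"
  shows rhom_subst: "rhom (subst \<iota> x)" and subst_const: "subst \<iota> x (const_poly c) = \<iota> c"
    and subst_var: "subst \<iota> x (var v) = x v"
proof -
  show "subst \<iota> x (const_poly c) = \<iota> c" "subst \<iota> x (var v) = x v" for c
    using assms by (simp_all add: const_poly_def var_def subst_single monom_value_def rhom_simps)
  then have one: "subst \<iota> x 1 = 1"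
    by (metis assms const_poly_def rhom_1 single_one)
  have add: "subst \<iota> x (p + q) = subst \<iota> x p + subst \<iota> x q" for p q
  proof -
    let ?A = "Poly_Mapping.keys p \<union> Poly_Mapping.keys q"
    have "finite ?A" "Poly_Mapping.keys (p + q) \<subseteq> ?A" by (simp_all add: keys_add)
    then show ?thesis using assms
      by (simp add: subst_superset[of ?A] lookup_add rhom_simps sum.distrib distrib_right)
  qed
  have "subst \<iota> x (p * q) = subst \<iota> x p * subst \<iota> x q" for p q
  proof (induction p rule: poly_mapping_induct)
    case (single m c)
    show ?case
      by (induction q rule: poly_mapping_induct)
        (simp_all add: mult_single subst_single assms monom_value_add rhom_simps add distrib_left distrib_right mult_ac)
  next
    case (sum f g)
    then show ?case by (simp add: distrib_right add)
  qed
  then show "rhom (subst \<iota> x)" using one add by (intro rhomI)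
qed

text \<open>The uniqueness half of the universal property of the polynomial ring,
  \<open>rhom_subst\<close> being the existence half. Identities between substitutions reduce by it
  to constants and variables.\<close>

lemma rhom_rpoly_eq:
  assumes "rhom h" "rhom h'" "\<And>c. h (const_poly c) = h' (const_poly c)" "\<And>v. h (var v) = h' (var v)"
  shows "h p = h' p"
  by (induction p rule: rpoly_induct) (simp_all add: assms rhom_simps)

lemma rhom_const_poly: "rhom const_poly"
  by (intro rhomI) (simp_all add: const_poly_def single_add mult_single)

section \<open>Orderings of rings\<close>

definition is_preorder :: "'a::comm_ring_1 set \<Rightarrow> bool" where
  "is_preorder P \<longleftrightarrow> (\<forall>a\<in>P. \<forall>b\<in>P. a + b \<in> P \<and> a * b \<in> P) \<and> (\<forall>a. a * a \<in> P) \<and> - 1 \<notin> P"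

definition supp :: "'a::comm_ring_1 set \<Rightarrow> 'a set" where
  "supp P = {a. a \<in> P \<and> - a \<in> P}"

text \<open>A point of the real spectrum: \<open>supp P\<close> is a prime ideal, and modulo it
  \<open>P\<close> becomes the nonnegative cone of an ordered domain.\<close>

definition is_ordering :: "'a::comm_ring_1 set \<Rightarrow> bool" where
  "is_ordering P \<longleftrightarrow> is_preorder P \<and> (\<forall>a. a \<in> P \<or> - a \<in> P) \<and>
    (\<forall>a b. a * b \<in> supp P \<longrightarrow> a \<in> supp P \<or> b \<in> supp P)"

text \<open>In a product the term quadratic in \<open>a\<close> carries the square
  \<open>a * a\<close> and falls back into \<open>P\<close>, so expressions linear in
  \<open>a\<close> are already closed under multiplication.\<close>

lemma is_preorder_adjoin:
  assumes P: "is_preorder P" and "- 1 \<notin> {s + a * t | s t. s \<in> P \<and> t \<in> P}"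
  shows "is_preorder {s + a * t | s t. s \<in> P \<and> t \<in> P}" (is ?pre)
    and "insert a P \<subseteq> {s + a * t | s t. s \<in> P \<and> t \<in> P}" (is "_ \<subseteq> ?Q")
proof -
  have add: "x + y \<in> P" and mult: "x * y \<in> P" if "x \<in> P" "y \<in> P" for x y
    using P that by (auto simp: is_preorder_def)
  have sq: "x * x \<in> P" for x using P by (auto simp: is_preorder_def)
  have 0: "0 \<in> P" and 1: "1 \<in> P" using sq[of 0] sq[of 1] by auto
  have "x + y \<in> ?Q \<and> x * y \<in> ?Q" if Q: "x \<in> ?Q" "y \<in> ?Q" for x y
  proof -
    obtain s t where x: "x = s + a * t" "s \<in> P" "t \<in> P" using Q(1) by blast
    obtain s' t' where y: "y = s' + a * t'" "s' \<in> P" "t' \<in> P" using Q(2) by blast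
    note xy = x(1) y(1) and in_P = x(2,3) y(2,3)
    have "x + y = (s + s') + a * (t + t')" "x * y = (s * s' + (a * a) * (t * t')) + a * (s * t' + t * s')"
      by (simp_all add: xy algebra_simps)
    moreover have "s + s' \<in> P" "t + t' \<in> P" "s * s' + (a * a) * (t * t') \<in> P" "s * t' + t * s' \<in> P"
      using in_P add mult sq by auto
    ultimately show ?thesis by blast
  qed
  moreover have "x \<in> ?Q" if "x \<in> P" for x
  proof -
    have "x = x + a * 0" by simp
    then show ?thesis using that 0 by blast
  qed
  moreover have "a \<in> ?Q"
  proof -
    have "a = 0 + a * 1" by simp
    then show ?thesis using 0 1 by blast
  qed
  ultimately show ?pre "insert a P \<subseteq> ?Q" using assms(2) sq unfolding is_preorder_def by blast+
qed

text \<open>A maximal preordering, given by Zorn's lemma, is an ordering: every \<open>a\<close>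
  outside \<open>P\<close> yields \<open>- 1 = s + a * t\<close>, and both totality and primality
  come from multiplying two such equations.\<close>

lemma ex_ordering:
  assumes "is_preorder T"
  shows "\<exists>P. is_ordering P \<and> T \<subseteq> P"
proof -
  define F where "F = {P. is_preorder P \<and> T \<subseteq> P}"
  have "\<exists>P\<in>F. \<forall>X\<in>F. P \<subseteq> X \<longrightarrow> X = P"
  proof (rule subset_Zorn_nonempty)
    show "F \<noteq> {}" using assms by (auto simp: F_def)
    fix C assume C: "C \<noteq> {}" "subset.chain F C"
    have "a + b \<in> \<Union>C \<and> a * b \<in> \<Union>C" if ab: "a \<in> \<Union>C" "b \<in> \<Union>C" for a b
    proof -
      obtain X Y where XY: "X \<in> C" "a \<in> X" "Y \<in> C" "b \<in> Y" using ab by blast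
      then have "X \<subseteq> Y \<or> Y \<subseteq> X" using C(2) unfolding subset.chain_def by blast
      then obtain Z where Z: "Z \<in> C" "a \<in> Z" "b \<in> Z" using XY by blast
      then have "is_preorder Z" using C(2) by (auto simp: subset.chain_def F_def)
      then have "a + b \<in> Z \<and> a * b \<in> Z" using Z unfolding is_preorder_def by blast
      then show ?thesis using Z by blast
    qed
    moreover obtain X where X: "X \<in> C" using C(1) by blast
    have mem: "is_preorder Y" "T \<subseteq> Y" if "Y \<in> C" for Y
      using C(2) that by (auto simp: subset.chain_def F_def)
    have "a * a \<in> \<Union>C" for a using X mem(1)[OF X] unfolding is_preorder_def by blast
    moreover have "- 1 \<notin> \<Union>C" using mem(1) unfolding is_preorder_def by blast
    moreover have "T \<subseteq> \<Union>C" using X mem(2)[OF X] by blast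
    ultimately show "\<Union>C \<in> F" unfolding F_def is_preorder_def by blast
  qed
  then obtain P where PF: "P \<in> F" and maxF: "\<And>X. X \<in> F \<Longrightarrow> P \<subseteq> X \<Longrightarrow> X = P" by blast
  have P: "is_preorder P" "T \<subseteq> P" using PF by (simp_all add: F_def)
  have max: "X = P" if "is_preorder X" "P \<subseteq> X" for X
    using maxF[of X] that P(2) by (auto simp: F_def)
  have add: "x + y \<in> P" and mult: "x * y \<in> P" if "x \<in> P" "y \<in> P" for x y
    using P that by (auto simp: is_preorder_def)
  have sq: "x * x \<in> P" for x using P by (auto simp: is_preorder_def)
  have m1: "- 1 \<notin> P" using P by (auto simp: is_preorder_def)
  have proper: "\<exists>s\<in>P. \<exists>t\<in>P. - 1 = s + a * t" if "a \<notin> P" for a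
    using is_preorder_adjoin[OF P(1), of a] max that by blast
  have total: "a \<in> P \<or> - a \<in> P" for a
  proof (rule ccontr)
    assume "\<not> (a \<in> P \<or> - a \<in> P)"
    then obtain s t s' t' where st: "s \<in> P" "t \<in> P" "s' \<in> P" "t' \<in> P"
      "- 1 = s + a * t" "- 1 = s' + (- a) * t'"
      using proper by meson
    have "a * t = - 1 - s" using arg_cong[OF st(5), of "\<lambda>x. x - s"] by simp
    moreover have "a * t' = 1 + s'"
      using arg_cong[OF st(6), of "\<lambda>x. x + a * t' + 1"] by (simp add: algebra_simps)
    \<comment> \<open>The product contains \<open>a\<close> only through the square
      \<open>a * a\<close>; expanding it expresses \<open>- 1\<close> by elements of
      \<open>P\<close>.\<close>
    ultimately have "(a * a) * (t * t') = (- 1 - s) * (1 + s')" by (metis mult.assoc mult.left_commute)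
    then have "- 1 = s + s' + s * s' + (a * a) * (t * t')" by (simp add: algebra_simps)
    moreover have "s + s' + s * s' + (a * a) * (t * t') \<in> P" using st add mult sq by simp
    ultimately show False using m1 by simp
  qed
  have supp_mult: "c * d \<in> supp P" if "c \<in> supp P" for c d
    using total[of d] that mult[of c d] mult[of "- c" d] mult[of c "- d"] mult[of "- c" "- d"]
    by (auto simp: supp_def)
  have pos_prime: False if ab: "a * b \<in> supp P" and a: "a \<notin> P" and b: "b \<notin> P" for a b
  proof -
    obtain s t s' t' where st: "s \<in> P" "t \<in> P" "s' \<in> P" "t' \<in> P"
      "- 1 = s + a * t" "- 1 = s' + b * t'"
      using proper a b by meson
    have "a * t = - 1 - s" "b * t' = - 1 - s'"
      using arg_cong[OF st(5), of "\<lambda>x. x - s"] arg_cong[OF st(6), of "\<lambda>x. x - s'"] by simp_all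
    then have "(a * b) * (t * t') = (- 1 - s) * (- 1 - s')" by (metis mult.assoc mult.left_commute)
    then have "- 1 = s + s' + s * s' + - ((a * b) * (t * t'))" by (simp add: algebra_simps)
    moreover have "- ((a * b) * (t * t')) \<in> P" using supp_mult[OF ab, of "t * t'"] by (simp add: supp_def)
    then have "s + s' + s * s' + - ((a * b) * (t * t')) \<in> P" by (intro add mult st)
    ultimately show False using m1 by simp
  qed
  have "a \<in> supp P \<or> b \<in> supp P" if "a * b \<in> supp P" for a b
  proof (rule ccontr)
    assume "\<not> (a \<in> supp P \<or> b \<in> supp P)"
    \<comment> \<open>An element outside the support is missing from \<open>P\<close> with at least
      one of its two signs, and a change of sign keeps the product in the support.\<close>
    then obtain a' b' where ab: "a' \<notin> P" "b' \<notin> P" "a' = a \<or> a' = - a" "b' = b \<or> b' = - b"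
      by (auto simp: supp_def)
    then have "a' * b' = a * b \<or> a' * b' = - (a * b)" by auto
    then have "a' * b' \<in> supp P" using that by (auto simp: supp_def)
    then show False using pos_prime ab by blast
  qed
  then have "is_ordering P" using P total by (simp add: is_ordering_def)
  then show ?thesis using P by blast
qed

lemma is_ordering_vimage:
  assumes "is_ordering P" "rhom h"
  shows "is_ordering (h -` P)"
proof -
  have "supp (h -` P) = h -` supp P" using assms(2) by (auto simp: supp_def rhom_simps)
  then show ?thesis using assms
    by (auto simp: is_ordering_def is_preorder_def rhom_simps)
qed

section \<open>Extending the order of a field to an adjoined root\<close>

text \<open>Weights are present because a nonnegative element of an ordered field need not be a
  square. With them all nonnegative constants belong to the cone, so an ordering above it extends
  the given order.\<close>

inductive_set weighted_squares :: "'a::linordered_field poly set" where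
  zero: "0 \<in> weighted_squares"
| step: "s \<in> weighted_squares \<Longrightarrow> 0 \<le> c \<Longrightarrow> s + smult c (p * p) \<in> weighted_squares"

lemma weighted_squares_term: "0 \<le> c \<Longrightarrow> smult c (p * p) \<in> weighted_squares"
  using weighted_squares.step[OF weighted_squares.zero] by simp

lemma weighted_squares_add:
  "t \<in> weighted_squares \<Longrightarrow> s \<in> weighted_squares \<Longrightarrow> s + t \<in> weighted_squares"
  by (induction t rule: weighted_squares.induct) (auto simp: add.assoc[symmetric] intro: weighted_squares.intros)

lemma weighted_squares_mult:
  assumes "s \<in> weighted_squares" "t \<in> weighted_squares"
  shows "s * t \<in> weighted_squares"
proof -
  have *: "smult c (p * p) * t \<in> weighted_squares" if "0 \<le> c" for c p
    using assms(2)
  proof (induction t rule: weighted_squares.induct)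
    case zero
    then show ?case by (simp add: weighted_squares.zero)
  next
    case (step t d q)
    have "smult c (p * p) * (t + smult d (q * q)) = smult c (p * p) * t + smult (c * d) ((p * q) * (p * q))"
      by (simp add: algebra_simps)
    then show ?case using step that by (simp add: weighted_squares.step)
  qed
  show ?thesis using assms(1)
    by (induction s rule: weighted_squares.induct)
      (auto simp: distrib_right weighted_squares.zero simp del: mult_smult_left intro!: weighted_squares_add *)
qed

lemma weighted_squares_nonneg: "s \<in> weighted_squares \<Longrightarrow> 0 \<le> poly s a"
  by (induction s rule: weighted_squares.induct) auto

text \<open>The squares of \<open>p\<close> and of \<open>p mod g\<close> differ by a multiple of
  \<open>p - p mod g\<close>, hence of \<open>g\<close>.\<close>

lemma weighted_squares_reduce:
  assumes "s \<in> weighted_squares" "0 < degree g"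
  shows "\<exists>t\<in>weighted_squares. g dvd s - t \<and> degree t \<le> 2 * (degree g - 1)"
  using assms(1)
proof (induction s rule: weighted_squares.induct)
  case zero
  then show ?case by (intro bexI[of _ 0]) (auto intro: weighted_squares.zero)
next
  case (step s c p)
  then obtain t where t: "t \<in> weighted_squares" "g dvd s - t" "degree t \<le> 2 * (degree g - 1)" by blast
  let ?q = "p mod g"
  have q: "degree ?q \<le> degree g - 1"
    using degree_mod_less[of g p] assms(2) by (cases "g = 0"; cases "?q = 0") auto
  have "(s + smult c (p * p)) - (t + smult c (?q * ?q)) = (s - t) + smult c ((p - ?q) * (p + ?q))"
    by (simp add: algebra_simps smult_diff_right)
  moreover have "g dvd (s - t) + smult c ((p - ?q) * (p + ?q))"
    using t(2) by (intro dvd_add dvd_smult dvd_mult2) (auto simp: dvd_minus_mod)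
  ultimately have "g dvd (s + smult c (p * p)) - (t + smult c (?q * ?q))" by metis
  moreover have "degree (smult c (?q * ?q)) \<le> 2 * (degree g - 1)"
    using degree_smult_le[of c "?q * ?q"] degree_mult_le[of ?q ?q] q by linarith
  ultimately show ?case using t step
    by (intro bexI[of _ "t + smult c (?q * ?q)"]) (auto intro: weighted_squares.step degree_add_le)
qed

text \<open>The classical descent: a certificate \<open>-1 = s + g * k\<close> can be reduced modulo \<open>g\<close>, and then
  \<open>k\<close> has smaller degree but still changes sign.\<close>

lemma sign_change_no_certificate:
  fixes g :: "'a::linordered_field poly"
  assumes "poly g a * poly g b < 0" "s \<in> weighted_squares"
  shows "- 1 \<noteq> s + g * k"
  using assms
proof (induction "degree g" arbitrary: g s k rule: less_induct)
  case less
  show ?case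
  proof
    assume cert: "- 1 = s + g * k"
    have deg: "0 < degree g"
    proof (rule ccontr)
      assume "\<not> 0 < degree g"
      then obtain c where "g = [:c:]" by (metis degree_eq_zeroE neq0_conv)
      then show False using less.prems(1) by simp
    qed
    obtain t where t: "t \<in> weighted_squares" "g dvd s - t" "degree t \<le> 2 * (degree g - 1)"
      using weighted_squares_reduce[OF less.prems(2) deg] by blast
    then obtain q where "s - t = g * q" by (auto elim: dvdE)
    then have cert': "- 1 = t + g * (q + k)" using cert by (simp add: algebra_simps)
    define l where "l = q + k"
    have l: "g * l = - (1 + t)" using cert' by (simp add: l_def algebra_simps)
    \<comment> \<open>\<open>1 + t\<close> is positive everywhere, so \<open>l\<close> has the
      opposite sign of \<open>g\<close> at every point and inherits the sign change between
      \<open>a\<close> and \<open>b\<close>.\<close>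
    have neg: "poly g x * poly l x < 0" for x
      using arg_cong[OF l, of "\<lambda>p. poly p x"] weighted_squares_nonneg[OF t(1), of x] by simp
    have "poly l a * poly l b < 0"
      using less.prems(1) neg[of a] neg[of b] by (auto simp: mult_less_0_iff)
    moreover have "degree l < degree g"
    proof -
      have "l \<noteq> 0" "g \<noteq> 0" using neg[of a] by auto
      then have "degree g + degree l = degree (1 + t)" by (metis degree_minus degree_mult_eq l)
      also have "\<dots> \<le> 2 * (degree g - 1)" using t(3) by (intro degree_add_le) auto
      finally show ?thesis using deg by linarith
    qed
    \<comment> \<open>The same equation with the roles of \<open>g\<close> and \<open>l\<close>
      exchanged is a certificate for the polynomial of smaller degree.\<close>
    moreover have "- 1 = t + l * g" using cert' by (simp add: l_def mult.commute)
    ultimately show False using less.hyps t(1) by blast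
  qed
qed

text \<open>A step of Artin-Schreier theory. No irreducible factor of \<open>g\<close> has to be
  chosen: the prime ideal \<open>supp P\<close> selects one.\<close>

lemma ex_ordering_root:
  fixes g :: "'a::linordered_field poly"
  assumes "poly g a * poly g b < 0"
  shows "\<exists>P. is_ordering P \<and> g \<in> supp P \<and> (\<forall>c\<ge>0. [:c:] \<in> P)"
proof -
  define T where "T = {s + g * k | s k. s \<in> weighted_squares}"
  have sub: "s \<in> T" if "s \<in> weighted_squares" for s
  proof -
    have "s = s + g * 0" by simp
    then show ?thesis using that unfolding T_def by blast
  qed
  have "is_preorder T"
    unfolding is_preorder_def
  proof (intro conjI ballI allI)
    fix x y assume "x \<in> T" "y \<in> T"
    then obtain s k t l where xy: "x = s + g * k" "y = t + g * l" "s \<in> weighted_squares" "t \<in> weighted_squares"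
      unfolding T_def by blast
    have "x + y = (s + t) + g * (k + l)" "x * y = s * t + g * (s * l + k * t + g * k * l)"
      by (simp_all add: xy algebra_simps)
    then show "x + y \<in> T" "x * y \<in> T"
      unfolding T_def using weighted_squares_add weighted_squares_mult xy by blast+
  next
    show "x * x \<in> T" for x using sub[OF weighted_squares_term[of 1 x]] by simp
    show "- 1 \<notin> T" using sign_change_no_certificate[OF assms] unfolding T_def by blast
  qed
  then obtain P where P: "is_ordering P" "T \<subseteq> P" using ex_ordering by blast
  have "g = 0 + g * 1" "- g = 0 + g * (- 1)" by simp_all
  then have "g \<in> T" "- g \<in> T" unfolding T_def using weighted_squares.zero by blast+
  moreover have "[:c:] \<in> T" if "0 \<le> c" for c
    using sub[OF weighted_squares_term[of c 1]] that by simp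
  ultimately show ?thesis using P by (auto simp: supp_def)
qed

section \<open>Counting roots modulo the support of an ordering\<close>

lemma supp_ideal:
  assumes P: "is_ordering P"
  shows supp_0: "0 \<in> supp P" and supp_add: "a \<in> supp P \<Longrightarrow> b \<in> supp P \<Longrightarrow> a + b \<in> supp P"
    and supp_mult: "a \<in> supp P \<Longrightarrow> a * c \<in> supp P" and supp_uminus: "a \<in> supp P \<Longrightarrow> - a \<in> supp P"
    and supp_diff: "a \<in> supp P \<Longrightarrow> b \<in> supp P \<Longrightarrow> a - b \<in> supp P"
    and supp_1: "1 \<notin> supp P"
proof -
  have add: "x + y \<in> P" and mult: "x * y \<in> P" if "x \<in> P" "y \<in> P" for x y
    using P that by (auto simp: is_preorder_def is_ordering_def)
  have "0 * 0 \<in> P" "- 1 \<notin> P" using P unfolding is_preorder_def is_ordering_def by blast+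
  then show "0 \<in> supp P" "1 \<notin> supp P" by (auto simp: supp_def)
  show a: "a + b \<in> supp P" if "a \<in> supp P" "b \<in> supp P" for a b
    using that add[of a b] add[of "- a" "- b"] by (auto simp: supp_def)
  show u: "- a \<in> supp P" if "a \<in> supp P" for a using that by (auto simp: supp_def)
  show "a - b \<in> supp P" if "a \<in> supp P" "b \<in> supp P" for a b
    using a[OF that(1) u[OF that(2)]] by simp
  show "a * c \<in> supp P" if "a \<in> supp P" for a c
    using P that mult[of a c] mult[of "- a" c] mult[of a "- c"] mult[of "- a" "- c"]
    by (auto simp: supp_def is_ordering_def)
qed

text \<open>The root bound over the domain modulo \<open>supp P\<close>, phrased with
  representatives. After one linear factor is split off, primality of the support makes the other
  roots into roots of the quotient.\<close>

lemma root_bound_mod_supp: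
  assumes P: "is_ordering P"
  shows "finite R \<Longrightarrow> (\<And>r. r \<in> R \<Longrightarrow> poly g r \<in> supp P) \<Longrightarrow>
    (\<And>r r'. r \<in> R \<Longrightarrow> r' \<in> R \<Longrightarrow> r \<noteq> r' \<Longrightarrow> r - r' \<notin> supp P) \<Longrightarrow> degree g < card R \<Longrightarrow> coeff g i \<in> supp P"
proof (induction "degree g" arbitrary: g R i rule: less_induct)
  case less
  obtain r where r: "r \<in> R" using less.prems(4) by fastforce
  define h where "h = synthetic_div g r"
  have g: "g = [:- r, 1:] * h + [:poly g r:]"
    using synthetic_div_correct'[of r g] by (simp add: h_def)
  have "coeff h j \<in> supp P" for j
  proof (cases "degree g = 0")
    case True
    then have "h = 0" unfolding h_def by (simp only: synthetic_div_eq_0_iff)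
    then show ?thesis using supp_0[OF P] by simp
  next
    case False
    have "poly h r' \<in> supp P" if r': "r' \<in> R - {r}" for r'
    proof -
      have "poly g r' = (r' - r) * poly h r' + poly g r"
        using arg_cong[OF g, of "\<lambda>p. poly p r'"] by (simp add: algebra_simps)
      then have "(r' - r) * poly h r' = poly g r' - poly g r" by simp
      also have "\<dots> \<in> supp P" using less.prems(2) r r' by (intro supp_diff[OF P]) auto
      finally show ?thesis using P less.prems(3)[of r' r] r r' unfolding is_ordering_def by blast
    qed
    then show ?thesis
      using False less.prems r by (intro less.hyps[of h "R - {r}"]) (auto simp: h_def degree_synthetic_div)
  qed
  note h = this
  show ?case
  proof (cases i)
    case 0
    have "coeff g 0 = - (coeff h 0 * r) + poly g r" by (subst g) simp
    then show ?thesis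
      using 0 h[of 0] less.prems(2)[OF r] supp_add[OF P] supp_mult[OF P] supp_uminus[OF P] by metis
  next
    case (Suc j)
    have "coeff g (Suc j) = coeff h j - coeff h (Suc j) * r" by (subst g) simp
    then show ?thesis
      using Suc h[of j] h[of "Suc j"] supp_diff[OF P] supp_mult[OF P] by metis
  qed
qed

text \<open>Roots are distinct modulo the support. Polynomials that vanish modulo the support are
  excluded, since every element would be a root of them. Pairs are counted, as one element may serve
  several polynomials.\<close>

definition root_set :: "'a::comm_ring_1 set \<Rightarrow> 'a poly set \<Rightarrow> ('a poly \<times> 'a) set \<Rightarrow> bool" where
  "root_set P G E \<longleftrightarrow> finite E \<and> (\<forall>(g, r) \<in> E. g \<in> G \<and> poly g r \<in> supp P \<and> (\<exists>i. coeff g i \<notin> supp P)) \<and>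
    (\<forall>g r r'. (g, r) \<in> E \<longrightarrow> (g, r') \<in> E \<longrightarrow> r \<noteq> r' \<longrightarrow> r - r' \<notin> supp P)"

text \<open>The bound depends on \<open>G\<close> and not on \<open>P\<close>, so the number of
  roots has a maximum over all orderings.\<close>

lemma card_root_set:
  assumes "is_ordering P" "root_set P G E" "finite G"
  shows "card E \<le> (\<Sum>g\<in>G. degree g)"
proof -
  define R where "R g = {r. (g, r) \<in> E}" for g
  have fin: "finite (R g)" for g
  proof -
    have "R g \<subseteq> snd ` E" by (force simp: R_def)
    moreover have "finite (snd ` E)" using assms(2) by (simp add: root_set_def)
    ultimately show ?thesis by (rule finite_subset)
  qed
  have "E \<subseteq> Sigma G R" using assms(2) by (auto simp: R_def root_set_def)
  then have "card E \<le> card (Sigma G R)" using assms(3) fin by (intro card_mono) auto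
  also have "\<dots> = (\<Sum>g\<in>G. card (R g))" using assms(3) fin by simp
  also have "\<dots> \<le> (\<Sum>g\<in>G. degree g)"
  proof (intro sum_mono)
    fix g assume "g \<in> G"
    show "card (R g) \<le> degree g"
    proof (rule ccontr)
      assume *: "\<not> card (R g) \<le> degree g"
      then have "R g \<noteq> {}" by auto
      then obtain r where "(g, r) \<in> E" by (auto simp: R_def)
      then obtain i where "coeff g i \<notin> supp P" using assms(2) unfolding root_set_def by blast
      moreover have "coeff g i \<in> supp P"
        by (rule root_bound_mod_supp[OF assms(1) fin[of g]])
          (use * assms(2) in \<open>auto simp: R_def root_set_def\<close>)
      ultimately show False by blast
    qed
  qed
  finally show ?thesis .
qed

section \<open>Comparing roots over two ordered fields\<close>

text \<open>Signs are integers rather than field elements, so that they can be compared between two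
  fields.\<close>

definition sg :: "'a::linordered_idom \<Rightarrow> int" where
  "sg x = (if 0 < x then 1 else if x = 0 then 0 else - 1)"

lemma sg_0_iff [simp]: "sg x = 0 \<longleftrightarrow> x = 0"
  and sg_zero [simp]: "sg 0 = 0"
  and sg_one [simp]: "sg 1 = 1"
  by (simp_all add: sg_def)

lemma sg_eq_iff: "sg x = sg y \<longleftrightarrow> (0 < x \<longleftrightarrow> 0 < y) \<and> (x = 0 \<longleftrightarrow> y = 0)"
  by (auto simp: sg_def)

lemma sg_uminus [simp]: "sg (- x) = - sg x"
  by (auto simp: sg_def)

lemma sg_mult: "sg (x * y) = sg x * sg y"
  by (auto simp: sg_def zero_less_mult_iff)

lemma sg_add_dominated: "\<bar>y\<bar> < \<bar>x\<bar> \<Longrightarrow> sg (x + y) = sg x"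
  by (auto simp: sg_def abs_if split: if_splits)

text \<open>A condition on a single polynomial, because the ordered field constructed below is not
  known to be real closed.\<close>

definition ivt :: "'a::linordered_idom poly \<Rightarrow> bool" where
  "ivt f \<longleftrightarrow> (\<forall>a b. a < b \<longrightarrow> poly f a * poly f b < 0 \<longrightarrow> (\<exists>c. a < c \<and> c < b \<and> poly f c = 0))"

lemma ivt_real: "ivt (f :: real poly)"
  unfolding ivt_def by (metis mult_less_0_iff poly_IVT_neg poly_IVT_pos)

lemma ivt_sg_eq:
  assumes "ivt f" "a \<le> b" "\<And>c. a \<le> c \<Longrightarrow> c \<le> b \<Longrightarrow> poly f c \<noteq> 0"
  shows "sg (poly f a) = sg (poly f b)"
proof (cases "a = b")
  case False
  then have "\<not> poly f a * poly f b < 0"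
    using assms unfolding ivt_def by (metis less_imp_le order_le_less)
  moreover have "poly f a \<noteq> 0" "poly f b \<noteq> 0" using assms by auto
  ultimately show ?thesis by (auto simp: sg_def mult_less_0_iff)
qed simp

lemma poly_bounded_near:
  fixes f :: "'a::linordered_field poly"
  shows "\<exists>M. \<forall>z. \<bar>z - u\<bar> \<le> 1 \<longrightarrow> \<bar>poly f z\<bar> \<le> M"
proof (induction f)
  case (pCons c f)
  then obtain M where M: "\<And>z. \<bar>z - u\<bar> \<le> 1 \<Longrightarrow> \<bar>poly f z\<bar> \<le> M" by blast
  have "\<bar>poly (pCons c f) z\<bar> \<le> \<bar>c\<bar> + (\<bar>u\<bar> + 1) * M" if "\<bar>z - u\<bar> \<le> 1" for z
  proof -
    have "\<bar>z\<bar> \<le> \<bar>u\<bar> + 1" using that by (auto simp: abs_if split: if_splits)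
    then have "\<bar>z\<bar> * \<bar>poly f z\<bar> \<le> (\<bar>u\<bar> + 1) * M"
      using M[OF that] by (intro mult_mono) auto
    then show ?thesis
      using abs_triangle_ineq[of c "z * poly f z"] by (simp add: abs_mult)
  qed
  then show ?case by blast
qed auto

text \<open>Continuity in an arbitrary ordered field, obtained by splitting off the value at
  \<open>u\<close> and estimating the increment.\<close>

lemma poly_sg_near:
  fixes f :: "'a::linordered_field poly"
  assumes "poly f u \<noteq> 0"
  shows "\<exists>\<epsilon>>0. \<forall>z. \<bar>z - u\<bar> < \<epsilon> \<longrightarrow> sg (poly f z) = sg (poly f u)"
proof -
  define h where "h = synthetic_div f u"
  have f: "poly f z = poly f u + (z - u) * poly h z" for z
    using arg_cong[OF synthetic_div_correct'[of u f], of "\<lambda>p. poly p z"]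
    by (simp add: h_def algebra_simps)
  obtain M where M: "\<And>z. \<bar>z - u\<bar> \<le> 1 \<Longrightarrow> \<bar>poly h z\<bar> \<le> M"
    using poly_bounded_near by blast
  have M0: "0 \<le> M" using M[of u] by simp
  \<comment> \<open>The bound \<open>1\<close> keeps \<open>z\<close> where \<open>M\<close> bounds
    the cofactor \<open>h\<close>; \<open>M + 1\<close> is positive even if \<open>M\<close> is
    zero.\<close>
  define \<epsilon> where "\<epsilon> = min 1 (\<bar>poly f u\<bar> / (M + 1))"
  have "\<epsilon> > 0" using assms M0 by (simp add: \<epsilon>_def)
  moreover have "sg (poly f z) = sg (poly f u)" if z: "\<bar>z - u\<bar> < \<epsilon>" for z
  proof -
    have "\<bar>(z - u) * poly h z\<bar> \<le> \<bar>z - u\<bar> * M"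
      using M[of z] z by (simp add: abs_mult mult_left_mono \<epsilon>_def)
    also have "\<dots> \<le> \<bar>z - u\<bar> * (M + 1)" by (simp add: algebra_simps)
    also have "\<dots> < \<bar>poly f u\<bar>" using z M0 by (simp add: \<epsilon>_def field_simps)
    finally show ?thesis unfolding f[of z] by (rule sg_add_dominated)
  qed
  ultimately show ?thesis by blast
qed

text \<open>At a root of order \<open>m\<close> the polynomial and its derivative carry the factor
  \<open>z - u\<close> to the powers \<open>m\<close> and \<open>m - 1\<close>, and the cofactors at
  \<open>u\<close> differ by the positive factor \<open>m\<close>. This takes the place of the mean
  value theorem.\<close>

lemma poly_sg_pderiv_near_root:
  fixes f :: "'a::linordered_field poly"
  assumes "f \<noteq> 0" "poly f u = 0"
  shows "\<exists>\<epsilon>>0. \<forall>z. \<bar>z - u\<bar> < \<epsilon> \<longrightarrow> z \<noteq> u \<longrightarrow> sg (poly f z) = sg (z - u) * sg (poly (pderiv f) z)"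
proof -
  obtain k where f: "f = [:- u, 1:] ^ order u f * k" and "\<not> [:- u, 1:] dvd k"
    using order_decomp[OF assms(1)] by blast
  then have k: "poly k u \<noteq> 0" by (simp add: poly_eq_0_iff_dvd)
  obtain m where m: "order u f = Suc m"
    using assms order_root[of f u] by (cases "order u f") auto
  define h where "h = smult (of_nat (Suc m)) k + [:- u, 1:] * pderiv k"
  have pd: "pderiv f = [:- u, 1:] ^ m * h"
    by (subst f, unfold m lemma_order_pderiv1) (simp add: h_def algebra_simps)
  have hu: "poly h u = of_nat (Suc m) * poly k u" by (simp add: h_def algebra_simps)
  have "poly h u \<noteq> 0" using k unfolding hu by (simp del: of_nat_Suc)
  then obtain \<epsilon>1 \<epsilon>2 where \<epsilon>: "\<epsilon>1 > 0" "\<And>z. \<bar>z - u\<bar> < \<epsilon>1 \<Longrightarrow> sg (poly h z) = sg (poly h u)"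
    "\<epsilon>2 > 0" "\<And>z. \<bar>z - u\<bar> < \<epsilon>2 \<Longrightarrow> sg (poly k z) = sg (poly k u)"
    using poly_sg_near k by meson
  have s: "sg (poly h u) = sg (poly k u)"
    unfolding hu by (simp add: sg_mult sg_def[of "of_nat _"] del: of_nat_Suc)
  have "sg (poly f z) = sg (z - u) * sg (poly (pderiv f) z)" if "\<bar>z - u\<bar> < min \<epsilon>1 \<epsilon>2" for z
  proof -
    have "poly f z = (z - u) * (z - u) ^ m * poly k z"
      by (subst f) (simp add: m algebra_simps)
    moreover have "poly (pderiv f) z = (z - u) ^ m * poly h z"
      by (simp add: pd algebra_simps)
    ultimately show ?thesis using \<epsilon>(2,4)[of z] that by (simp add: sg_mult s)
  qed
  then show ?thesis using \<epsilon>(1,3) by (intro exI[of _ "min \<epsilon>1 \<epsilon>2"]) auto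
qed

text \<open>The sign that \<open>f\<close> approaches to the right of \<open>u\<close> (for \<open>d = 1\<close>) or to the left of \<open>u\<close>
  (for \<open>d = - 1\<close>), given that \<open>f'\<close> has sign \<open>s\<close> there.\<close>

definition side_sg :: "'a::linordered_idom poly \<Rightarrow> int \<Rightarrow> int \<Rightarrow> 'a \<Rightarrow> int" where
  "side_sg f s d u = (if poly f u = 0 then d * s else sg (poly f u))"

text \<open>If \<open>f\<close> vanishes at \<open>u\<close>, its sign just to the right is that of
  the derivative; the intermediate value property carries this sign to \<open>z\<close>, since no
  root intervenes.\<close>

lemma sg_right_of:
  fixes f :: "'a::linordered_field poly"
  assumes "f \<noteq> 0" "ivt f" "u < z" and nz: "\<And>c. u < c \<Longrightarrow> c \<le> z \<Longrightarrow> poly f c \<noteq> 0"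
    and s: "\<And>c. u < c \<Longrightarrow> c \<le> z \<Longrightarrow> sg (poly (pderiv f) c) = s"
  shows "sg (poly f z) = side_sg f s 1 u"
proof (cases "poly f u = 0")
  case True
  obtain \<epsilon> where \<epsilon>: "\<epsilon> > 0" "\<And>c. \<bar>c - u\<bar> < \<epsilon> \<Longrightarrow> c \<noteq> u \<Longrightarrow> sg (poly f c) = sg (c - u) * sg (poly (pderiv f) c)"
    using poly_sg_pderiv_near_root[OF assms(1) True] by blast
  obtain c where c: "u < c" "c < min z (u + \<epsilon>)"
    using dense[of u "min z (u + \<epsilon>)"] assms(3) \<epsilon>(1) by auto
  have "sg (poly f c) = s" using \<epsilon>(2)[of c] c s[of c] by (auto simp: sg_def)
  moreover have "sg (poly f c) = sg (poly f z)"
    using c by (intro ivt_sg_eq[OF assms(2)] nz) auto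
  ultimately show ?thesis using True by (simp add: side_sg_def)
next
  case False
  have "sg (poly f u) = sg (poly f z)"
  proof (intro ivt_sg_eq[OF assms(2)])
    show "poly f c \<noteq> 0" if "u \<le> c" "c \<le> z" for c
      using that nz[of c] False by (cases "u = c") auto
  qed (use assms(3) in auto)
  then show ?thesis using False by (simp add: side_sg_def)
qed

lemma sg_left_of:
  fixes f :: "'a::linordered_field poly"
  assumes "f \<noteq> 0" "ivt f" "z < v" and nz: "\<And>c. z \<le> c \<Longrightarrow> c < v \<Longrightarrow> poly f c \<noteq> 0"
    and s: "\<And>c. z \<le> c \<Longrightarrow> c < v \<Longrightarrow> sg (poly (pderiv f) c) = s"
  shows "sg (poly f z) = side_sg f s (- 1) v"
proof (cases "poly f v = 0")
  case True
  obtain \<epsilon> where \<epsilon>: "\<epsilon> > 0" "\<And>c. \<bar>c - v\<bar> < \<epsilon> \<Longrightarrow> c \<noteq> v \<Longrightarrow> sg (poly f c) = sg (c - v) * sg (poly (pderiv f) c)"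
    using poly_sg_pderiv_near_root[OF assms(1) True] by blast
  obtain c where c: "c < v" "max z (v - \<epsilon>) < c"
    using dense[of "max z (v - \<epsilon>)" v] assms(3) \<epsilon>(1) by auto
  have "sg (poly f c) = - s" using \<epsilon>(2)[of c] c s[of c] by (auto simp: sg_def)
  moreover have "sg (poly f z) = sg (poly f c)"
    using c by (intro ivt_sg_eq[OF assms(2)] nz) auto
  ultimately show ?thesis using True by (simp add: side_sg_def)
next
  case False
  have "sg (poly f z) = sg (poly f v)"
  proof (intro ivt_sg_eq[OF assms(2)])
    show "poly f c \<noteq> 0" if "z \<le> c" "c \<le> v" for c
      using that nz[of c] False by (cases "c = v") auto
  qed (use assms(3) in auto)
  then show ?thesis using False by (simp add: side_sg_def)
qed

lemma finite_next_root:
  assumes "finite (A :: 'a::linorder set)" "x \<in> A" "y \<in> A" "x < y"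
  obtains y' where "y' \<in> A" "x < y'" "y' \<le> y" "\<And>a. a \<in> A \<Longrightarrow> x < a \<Longrightarrow> y' \<le> a"
proof (rule that[of "Min {a \<in> A. x < a}"])
  have *: "finite {a \<in> A. x < a}" "y \<in> {a \<in> A. x < a}" using assms by auto
  then have "Min {a \<in> A. x < a} \<in> {a \<in> A. x < a}" by (intro Min_in) blast+
  then show "Min {a \<in> A. x < a} \<in> A" "x < Min {a \<in> A. x < a}" by auto
  show "Min {a \<in> A. x < a} \<le> y" using * by (rule Min_le)
  show "Min {a \<in> A. x < a} \<le> a" if "a \<in> A" "x < a" for a using that * by (intro Min_le) auto
qed

text \<open>Just to the right of a root \<open>f\<close> has the sign \<open>s\<close>, just to the
  left of the next root the sign \<open>- s\<close>; but between consecutive roots the sign is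
  constant.\<close>

lemma at_most_one_root:
  fixes f :: "'a::linordered_field poly"
  assumes "f \<noteq> 0" "ivt f" "u < v" and s: "\<And>c. u < c \<Longrightarrow> c < v \<Longrightarrow> sg (poly (pderiv f) c) = s" "s \<noteq> 0"
    and xy: "u \<le> x" "x < y" "y \<le> v" "poly f x = 0" "poly f y = 0"
  shows False
proof -
  have "finite {z. poly f z = 0}" using assms(1) by (rule poly_roots_finite)
  then obtain y' where y': "poly f y' = 0" "x < y'" "y' \<le> y" "\<And>a. poly f a = 0 \<Longrightarrow> x < a \<Longrightarrow> y' \<le> a"
    using finite_next_root[of "{z. poly f z = 0}" x y] xy by auto
  obtain z where z: "x < z" "z < y'" using dense[OF y'(2)] by blast
  have "sg (poly f z) = side_sg f s 1 x"
    using assms(1,2) z(1)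
  proof (rule sg_right_of)
    show "poly f c \<noteq> 0" if "x < c" "c \<le> z" for c using y'(4)[of c] that z by auto
    show "sg (poly (pderiv f) c) = s" if "x < c" "c \<le> z" for c using s that xy z y' by auto
  qed
  moreover have "sg (poly f z) = side_sg f s (- 1) y'"
    using assms(1,2) z(2)
  proof (rule sg_left_of)
    show "poly f c \<noteq> 0" if "z \<le> c" "c < y'" for c using y'(4)[of c] that z by auto
    show "sg (poly (pderiv f) c) = s" if "z \<le> c" "c < y'" for c using s that xy z y' by auto
  qed
  ultimately show False using xy y' s(2) by (simp add: side_sg_def)
qed

text \<open>The end values and the sign of the derivative decide the whole pattern: a root is
  present exactly if the limiting signs \<open>l\<close> and \<open>r\<close> differ. These are data
  that can be matched in a second field.\<close>

lemma sg_pattern_on_cell: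
  fixes f :: "'a::linordered_field poly"
  assumes "f \<noteq> 0" "ivt f" "u < v" and s: "\<And>c. u < c \<Longrightarrow> c < v \<Longrightarrow> sg (poly (pderiv f) c) = s" "s \<noteq> 0"
  defines "l \<equiv> side_sg f s 1 u" and "r \<equiv> side_sg f s (- 1) v"
  shows "l = r \<and> (\<forall>z. u < z \<longrightarrow> z < v \<longrightarrow> sg (poly f z) = l) \<or>
    l \<noteq> r \<and> (\<exists>\<rho>. u < \<rho> \<and> \<rho> < v \<and> (\<forall>z. u < z \<longrightarrow> z < v \<longrightarrow>
      sg (poly f z) = (if z < \<rho> then l else if z = \<rho> then 0 else r)))"
proof (cases "\<exists>\<rho>. u < \<rho> \<and> \<rho> < v \<and> poly f \<rho> = 0")
  case False
  have "sg (poly f z) = l \<and> sg (poly f z) = r" if z: "u < z" "z < v" for z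
    using sg_right_of[OF assms(1,2), of u z s] sg_left_of[OF assms(1,2), of z v s] z False s
    unfolding l_def r_def by (meson le_less_trans less_le_trans)
  moreover obtain z where "u < z" "z < v" using dense assms(3) by blast
  ultimately show ?thesis by blast
next
  case True
  then obtain \<rho> where \<rho>: "u < \<rho>" "\<rho> < v" "poly f \<rho> = 0" by blast
  have only: "z = \<rho>" if "poly f z = 0" "u \<le> z" "z \<le> v" for z
    using at_most_one_root[OF assms(1-5), of z \<rho>] at_most_one_root[OF assms(1-5), of \<rho> z] \<rho> that
    by (cases z \<rho> rule: linorder_cases) auto
  have "poly f u \<noteq> 0" "poly f v \<noteq> 0" using only[of u] only[of v] \<rho> assms(3) by auto
  have nz: "poly f c \<noteq> 0" if "u < c" "c < v" "c \<noteq> \<rho>" for c using only[of c] that by auto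
  have L: "sg (poly f z) = l \<and> l = - s" if z: "u < z" "z < \<rho>" for z
  proof -
    have "sg (poly f z) = l" unfolding l_def
      by (rule sg_right_of[OF assms(1,2) z(1)]; rule nz s(1)) (use z \<rho> in auto)
    moreover have "sg (poly f z) = side_sg f s (- 1) \<rho>"
      by (rule sg_left_of[OF assms(1,2) z(2)]; rule nz s(1)) (use z \<rho> in auto)
    ultimately show ?thesis using \<rho> by (simp add: side_sg_def)
  qed
  have R: "sg (poly f z) = r \<and> r = s" if z: "\<rho> < z" "z < v" for z
  proof -
    have "sg (poly f z) = r" unfolding r_def
      by (rule sg_left_of[OF assms(1,2) z(2)]; rule nz s(1)) (use z \<rho> in auto)
    moreover have "sg (poly f z) = side_sg f s 1 \<rho>"
      by (rule sg_right_of[OF assms(1,2) z(1)]; rule nz s(1)) (use z \<rho> in auto)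
    ultimately show ?thesis using \<rho> by (simp add: side_sg_def)
  qed
  have Z: "sg (poly f z) = (if z < \<rho> then l else if z = \<rho> then 0 else r)" if "u < z" "z < v" for z
    using L[of z] R[of z] \<rho>(3) that by (cases z \<rho> rule: linorder_cases) auto
  obtain z1 where z1: "u < z1" "z1 < \<rho>" using dense[OF \<rho>(1)] by blast
  obtain z2 where z2: "\<rho> < z2" "z2 < v" using dense[OF \<rho>(2)] by blast
  have "l \<noteq> r" using L[OF z1] R[OF z2] s(2) by auto
  then show ?thesis using Z \<rho>(1,2) by blast
qed

section \<open>Matching the roots of two parallel families\<close>

text \<open>A pair stands for the specialisations of one polynomial in two fields. Derivatives and
  remainders are what Hoermander's method needs to find the signs of a polynomial from those of
  lower degree; the multipliers \<open>c\<close> and \<open>c'\<close> allow for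
  pseudo-division.\<close>

definition par_family :: "('a::linordered_field poly \<times> 'b::linordered_field poly) set \<Rightarrow> bool" where
  "par_family S \<longleftrightarrow>
    (\<forall>f g. (f, g) \<in> S \<longrightarrow> ivt f \<and> ivt g \<and> degree f = degree g \<and> sg (lead_coeff f) = sg (lead_coeff g)) \<and>
    (\<forall>f g. (f, g) \<in> S \<longrightarrow> 0 < degree f \<longrightarrow> (pderiv f, pderiv g) \<in> S) \<and>
    (\<forall>f g h k. (f, g) \<in> S \<longrightarrow> (h, k) \<in> S \<longrightarrow> 0 < degree h \<longrightarrow> degree h \<le> degree f \<longrightarrow>
      (\<exists>r r' c c' q q'. (r, r') \<in> S \<and> degree r < degree h \<and> c \<noteq> 0 \<and> sg c = sg c' \<and>
        smult c f = h * q + r \<and> smult c' g = k * q' + r'))"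

lemma par_familyI:
  assumes "\<And>f g. (f, g) \<in> S \<Longrightarrow> ivt f \<and> ivt g \<and> degree f = degree g \<and> sg (lead_coeff f) = sg (lead_coeff g)"
    and "\<And>f g. (f, g) \<in> S \<Longrightarrow> 0 < degree f \<Longrightarrow> (pderiv f, pderiv g) \<in> S"
    and "\<And>f g h k. (f, g) \<in> S \<Longrightarrow> (h, k) \<in> S \<Longrightarrow> 0 < degree h \<Longrightarrow> degree h \<le> degree f \<Longrightarrow>
      \<exists>r r' c c' q q'. (r, r') \<in> S \<and> degree r < degree h \<and> c \<noteq> 0 \<and> sg c = sg c' \<and>
        smult c f = h * q + r \<and> smult c' g = k * q' + r'"
  shows "par_family S"
  unfolding par_family_def
  by (intro conjI allI impI; ((rule assms(2,3); assumption) | blast dest: assms(1)))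

lemma par_familyD:
  assumes "par_family S" "(f, g) \<in> S"
  shows "ivt f" "ivt g" "degree f = degree g" "sg (lead_coeff f) = sg (lead_coeff g)"
    and "0 < degree f \<Longrightarrow> (pderiv f, pderiv g) \<in> S"
    and "(h, k) \<in> S \<Longrightarrow> 0 < degree h \<Longrightarrow> degree h \<le> degree f \<Longrightarrow>
      \<exists>r r' c c' q q'. (r, r') \<in> S \<and> degree r < degree h \<and> c \<noteq> 0 \<and> sg c = sg c' \<and>
        smult c f = h * q + r \<and> smult c' g = k * q' + r'"
proof -
  note * = assms(1)[unfolded par_family_def]
  show "ivt f" "ivt g" "degree f = degree g" "sg (lead_coeff f) = sg (lead_coeff g)"
    using conjunct1[OF *] assms(2) by blast+
  show "0 < degree f \<Longrightarrow> (pderiv f, pderiv g) \<in> S"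
    by (rule *[THEN conjunct2, THEN conjunct1, rule_format, OF assms(2)])
  show "(h, k) \<in> S \<Longrightarrow> 0 < degree h \<Longrightarrow> degree h \<le> degree f \<Longrightarrow>
      \<exists>r r' c c' q q'. (r, r') \<in> S \<and> degree r < degree h \<and> c \<noteq> 0 \<and> sg c = sg c' \<and>
        smult c f = h * q + r \<and> smult c' g = k * q' + r'"
    by (rule *[THEN conjunct2, THEN conjunct2, rule_format, OF assms(2)])
qed

definition same_place :: "'a::linordered_field set \<Rightarrow> ('a \<Rightarrow> 'b::linordered_field) \<Rightarrow> 'a \<Rightarrow> 'b \<Rightarrow> bool" where
  "same_place A \<psi> z w \<longleftrightarrow> (\<forall>a\<in>A. sg (z - a) = sg (w - \<psi> a))"

lemma same_place_iff: "same_place A \<psi> z w \<longleftrightarrow> (\<forall>a\<in>A. (a < z \<longleftrightarrow> \<psi> a < w) \<and> (z = a \<longleftrightarrow> w = \<psi> a))"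
  by (auto simp: same_place_def sg_eq_iff)

text \<open>\<open>\<psi>\<close> is an order isomorphism between the roots of the first and of the second components. The points
  \<open>a0, a1\<close> and \<open>b0, b1\<close> are sentinels, to be placed outside of all roots so that every cell has end points.\<close>

locale root_match =
  fixes S :: "('a::linordered_field poly \<times> 'b::linordered_field poly) set"
    and a0 a1 :: 'a and b0 b1 :: 'b and A \<psi>
  assumes fin: "finite A" and ends: "a0 \<in> A" "a1 \<in> A" "\<psi> a0 = b0" "\<psi> a1 = b1"
    and A_sub: "A \<subseteq> {a0..a1}" and mono: "strict_mono_on A \<psi>"
    and a01: "a0 < a1"
    and roots: "\<And>f g z. (f, g) \<in> S \<Longrightarrow> f \<noteq> 0 \<Longrightarrow> a0 \<le> z \<Longrightarrow> z \<le> a1 \<Longrightarrow> poly f z = 0 \<Longrightarrow> z \<in> A"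
    and roots': "\<And>f g w. (f, g) \<in> S \<Longrightarrow> g \<noteq> 0 \<Longrightarrow> b0 \<le> w \<Longrightarrow> w \<le> b1 \<Longrightarrow> poly g w = 0 \<Longrightarrow> w \<in> \<psi> ` A"
    and is_root: "\<And>a. a \<in> A \<Longrightarrow> a \<noteq> a0 \<Longrightarrow> a \<noteq> a1 \<Longrightarrow> \<exists>(h, k) \<in> S. 0 < degree h \<and> poly h a = 0"
    and same_sg: "\<And>f g z w. (f, g) \<in> S \<Longrightarrow> a0 \<le> z \<Longrightarrow> z \<le> a1 \<Longrightarrow> b0 \<le> w \<Longrightarrow> w \<le> b1 \<Longrightarrow>
      same_place A \<psi> z w \<Longrightarrow> sg (poly f z) = sg (poly g w)"
begin

lemma mono_iff: "a \<in> A \<Longrightarrow> a' \<in> A \<Longrightarrow> \<psi> a < \<psi> a' \<longleftrightarrow> a < a'"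
  using mono by (metis linorder_neqE not_less_iff_gr_or_eq strict_mono_onD)

lemma inj_iff: "a \<in> A \<Longrightarrow> a' \<in> A \<Longrightarrow> \<psi> a = \<psi> a' \<longleftrightarrow> a = a'"
  by (metis less_irrefl linorder_neqE mono_iff)

lemma img_bounds: "a \<in> A \<Longrightarrow> b0 \<le> \<psi> a \<and> \<psi> a \<le> b1"
  using mono_iff[of a a0] mono_iff[of a1 a] ends A_sub by (auto simp: not_less[symmetric])

lemma same_place_img: "a \<in> A \<Longrightarrow> same_place A \<psi> a (\<psi> a)"
  by (auto simp: same_place_iff mono_iff inj_iff)

lemma same_place_mem: "same_place A \<psi> z w \<Longrightarrow> z \<in> A \<Longrightarrow> w = \<psi> z"
  by (auto simp: same_place_iff)

lemma same_place_bounds: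
  assumes "same_place A \<psi> z w"
  shows "a0 \<le> z \<longleftrightarrow> b0 \<le> w" "z \<le> a1 \<longleftrightarrow> w \<le> b1"
proof -
  have "a < z \<longleftrightarrow> \<psi> a < w" "z = a \<longleftrightarrow> w = \<psi> a" if "a \<in> A" for a
    using assms that by (auto simp: same_place_iff)
  then show "a0 \<le> z \<longleftrightarrow> b0 \<le> w" "z \<le> a1 \<longleftrightarrow> w \<le> b1"
    using ends by (metis le_less, metis not_less)
qed

definition cell :: "'a \<Rightarrow> 'a \<Rightarrow> bool" where
  "cell u v \<longleftrightarrow> u \<in> A \<and> v \<in> A \<and> u < v \<and> (\<forall>a\<in>A. a \<le> u \<or> v \<le> a)"

lemma cellD: "cell u v \<Longrightarrow> u \<in> A \<and> v \<in> A \<and> u < v" and cellD': "cell u v \<Longrightarrow> a \<in> A \<Longrightarrow> a \<le> u \<or> v \<le> a"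
  by (auto simp: cell_def)

lemma ex_cell:
  assumes "z \<notin> A" "a0 \<le> z" "z \<le> a1"
  obtains u v where "cell u v" "u < z" "z < v"
proof -
  have "finite {a\<in>A. a < z}" "finite {a\<in>A. z < a}" "a0 \<in> {a\<in>A. a < z}" "a1 \<in> {a\<in>A. z < a}"
    using fin ends assms by (auto simp: le_less)
  note m = Max_in[OF this(1)] Max_ge[OF this(1)] Min_in[OF this(2)] Min_le[OF this(2)] this
  show thesis
  proof (rule that[of "Max {a\<in>A. a < z}" "Min {a\<in>A. z < a}"])
    show l: "Max {a\<in>A. a < z} < z" using m by blast
    show r: "z < Min {a\<in>A. z < a}" using m by blast
    have "a \<le> Max {a\<in>A. a < z} \<or> Min {a\<in>A. z < a} \<le> a" if "a \<in> A" for a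
      using m(2)[of a] m(4)[of a] that assms(1) by (cases a z rule: linorder_cases) auto
    then show "cell (Max {a\<in>A. a < z}) (Min {a\<in>A. z < a})"
      using m l r less_trans[OF l r] by (auto simp: cell_def)
  qed
qed

lemma same_place_cell:
  assumes "cell u v" "u < z" "z < v"
  shows "same_place A \<psi> z w \<longleftrightarrow> \<psi> u < w \<and> w < \<psi> v"
proof
  assume w: "\<psi> u < w \<and> w < \<psi> v"
  have "(a < z \<longleftrightarrow> \<psi> a < w) \<and> (z = a \<longleftrightarrow> w = \<psi> a)" if "a \<in> A" for a
  proof (cases "a \<le> u")
    case True
    then have "\<psi> a \<le> \<psi> u" using that assms(1) mono_iff by (auto simp: cell_def not_less[symmetric])
    then show ?thesis using True w assms by auto
  next
    case False
    then have "v \<le> a" using assms(1) that by (auto simp: cell_def)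
    then have "\<psi> v \<le> \<psi> a" using that assms(1) mono_iff by (auto simp: cell_def not_less[symmetric])
    then show ?thesis using \<open>v \<le> a\<close> w assms by auto
  qed
  then show "same_place A \<psi> z w" by (simp add: same_place_iff)
qed (use assms in \<open>auto simp: same_place_iff cell_def neq_iff\<close>)

lemma ex_cell':
  assumes "w \<notin> \<psi> ` A" "b0 \<le> w" "w \<le> b1"
  obtains u v where "cell u v" "\<psi> u < w" "w < \<psi> v"
proof -
  let ?L = "{a\<in>A. \<psi> a < w}" and ?R = "{a\<in>A. w < \<psi> a}"
  have "finite ?L" "finite ?R" "a0 \<in> ?L" "a1 \<in> ?R"
    using fin ends assms by (auto simp: le_less)
  note m = Max_in[OF this(1)] Max_ge[OF this(1)] Min_in[OF this(2)] Min_le[OF this(2)] this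
  show thesis
  proof (rule that[of "Max ?L" "Min ?R"])
    have L: "Max ?L \<in> ?L" and R: "Min ?R \<in> ?R" using m by blast+
    then show "\<psi> (Max ?L) < w" "w < \<psi> (Min ?R)" by auto
    then have "\<psi> (Max ?L) < \<psi> (Min ?R)" by (rule less_trans)
    moreover have "a \<le> Max ?L \<or> Min ?R \<le> a" if "a \<in> A" for a
      using m(2)[of a] m(4)[of a] that assms(1) by (cases "\<psi> a" w rule: linorder_cases) auto
    ultimately show "cell (Max ?L) (Min ?R)"
      using L R mono_iff by (auto simp: cell_def)
  qed
qed

end

text \<open>Derivatives and remainders arising in \<open>S\<close> have degree below that of
  \<open>f\<close>, so they survive the removal of a pair of top degree. Hence root matchings can be
  built up by increasing degree.\<close>

lemma par_family_subset:
  assumes par: "par_family (insert (f, g) S)" and le: "\<And>h k. (h, k) \<in> S \<Longrightarrow> degree h \<le> degree f"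
  shows "par_family S"
proof -
  have D: "(h, k) \<in> insert (f, g) S" if "(h, k) \<in> S" for h k using that by simp
  have "(pderiv h, pderiv k) \<in> S" if hk: "(h, k) \<in> S" "0 < degree h" for h k
  proof -
    have "degree (pderiv h) < degree f" using le[OF hk(1)] hk(2) by (simp add: degree_pderiv)
    then have "pderiv h \<noteq> f" by auto
    then show ?thesis using par_familyD(5)[OF par D[OF hk(1)] hk(2)] by simp
  qed
  moreover have "\<exists>r r' c c' q q'. (r, r') \<in> S \<and> degree r < degree h \<and> c \<noteq> 0 \<and> sg c = sg c' \<and>
        smult c p = h * q + r \<and> smult c' p' = k * q' + r'"
    if ph: "(p, p') \<in> S" "(h, k) \<in> S" "0 < degree h" "degree h \<le> degree p" for p p' h k
  proof -
    obtain r r' c c' q q' where *: "(r, r') \<in> insert (f, g) S" "degree r < degree h"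
        "c \<noteq> 0 \<and> sg c = sg c' \<and> smult c p = h * q + r \<and> smult c' p' = k * q' + r'"
      using par_familyD(6)[OF par D[OF ph(1)] D[OF ph(2)] ph(3,4)] by metis
    then have "(r, r') \<in> S" using le[OF ph(2)] by auto
    then show ?thesis using * by blast
  qed
  ultimately show ?thesis using par_familyD(1-4)[OF par D] by (intro par_familyI) blast+
qed

text \<open>Hoermander's observation: at a root of \<open>h\<close> the sign of \<open>f\<close> is,
  up to the sign of \<open>c\<close>, that of its remainder modulo \<open>h\<close>, and the
  remainder already belongs to \<open>S\<close>.\<close>

lemma (in root_match) point_sg:
  assumes par: "par_family (insert (f, g) S)" "\<forall>(h, k) \<in> S. degree h \<le> degree f"
    and e: "sg (poly f a0) = sg (poly g b0)" "sg (poly f a1) = sg (poly g b1)"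
    and a: "a \<in> A"
  shows "sg (poly f a) = sg (poly g (\<psi> a))"
proof (cases "a = a0 \<or> a = a1")
  case False
  then obtain h k where hk: "(h, k) \<in> S" "0 < degree h" "poly h a = 0"
    using is_root[OF a] by blast
  have sg_eq: "sg (poly p a) = sg (poly p' (\<psi> a))" if "(p, p') \<in> S" for p p'
    using that A_sub a img_bounds[OF a] same_place_img[OF a] by (intro same_sg) auto
  have le: "degree h \<le> degree f" using par(2) hk(1) by blast
  have "poly k (\<psi> a) = 0" using sg_eq[OF hk(1)] hk(3) by (metis sg_0_iff)
  obtain r r' c c' q q' where r: "(r, r') \<in> insert (f, g) S" "degree r < degree h"
    and c: "c \<noteq> 0" "sg c = sg c'" and eq: "smult c f = h * q + r" "smult c' g = k * q' + r'"
    using par_familyD(6)[OF par(1) insertI1 insertI2[OF hk(1)] hk(2) le] by metis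
  have "r \<noteq> f" using r(2) le by auto
  then have "sg (poly r a) = sg (poly r' (\<psi> a))" using r(1) by (intro sg_eq) auto
  moreover have "c * poly f a = poly r a" "c' * poly g (\<psi> a) = poly r' (\<psi> a)"
    using arg_cong[OF eq(1), of "\<lambda>p. poly p a"] arg_cong[OF eq(2), of "\<lambda>p. poly p (\<psi> a)"]
      hk(3) \<open>poly k (\<psi> a) = 0\<close> by simp_all
  ultimately have "sg c * sg (poly f a) = sg c * sg (poly g (\<psi> a))"
    using c(2) by (metis sg_mult)
  then show ?thesis using c(1) by simp
qed (use e ends in auto)

text \<open>The derivative belongs to \<open>S\<close> and has no root inside a cell, so its sign
  \<open>s\<close> is constant there and the same in both fields. With the matching signs at the end
  points this gives the same \<open>l\<close> and \<open>r\<close> for \<open>f\<close> and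
  \<open>g\<close>.\<close>

lemma (in root_match) cell_pattern:
  assumes par: "par_family (insert (f, g) S)" "\<forall>(h, k) \<in> S. degree h \<le> degree f"
    and e: "sg (poly f a0) = sg (poly g b0)" "sg (poly f a1) = sg (poly g b1)"
    and deg: "0 < degree f" and cell: "cell u v"
  obtains (const) l where "l \<noteq> 0" "\<And>z. u < z \<Longrightarrow> z < v \<Longrightarrow> sg (poly f z) = l"
      "\<And>w. \<psi> u < w \<Longrightarrow> w < \<psi> v \<Longrightarrow> sg (poly g w) = l"
    | (root) l r \<rho> \<rho>' where "l \<noteq> 0" "r \<noteq> 0" "u < \<rho>" "\<rho> < v" "\<psi> u < \<rho>'" "\<rho>' < \<psi> v"
      "\<And>z. u < z \<Longrightarrow> z < v \<Longrightarrow> sg (poly f z) = (if z < \<rho> then l else if z = \<rho> then 0 else r)"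
      "\<And>w. \<psi> u < w \<Longrightarrow> w < \<psi> v \<Longrightarrow> sg (poly g w) = (if w < \<rho>' then l else if w = \<rho>' then 0 else r)"
proof -
  note uv = cellD[OF cell]
  have fg: "(f, g) \<in> insert (f, g) S" by simp
  note iv = par_familyD(1,2)[OF par(1) fg] and dg = par_familyD(3)[OF par(1) fg]
    and pd = par_familyD(5)[OF par(1) fg deg]
  have "degree (pderiv f) < degree f" using deg by (simp add: degree_pderiv)
  then have pdS: "(pderiv f, pderiv g) \<in> S" using pd by auto
  have pd0: "pderiv f \<noteq> 0" using deg by (simp add: pderiv_eq_0_iff)
  have fg0: "f \<noteq> 0" "g \<noteq> 0" using deg dg by auto
  have psi: "\<psi> u < \<psi> v" using uv mono_iff by auto
  have bnd: "a0 \<le> z" "z \<le> a1" if "u < z" "z < v" for z using uv A_sub that by auto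
  have bnd': "b0 \<le> w" "w \<le> b1" if "\<psi> u < w" "w < \<psi> v" for w
    using uv img_bounds[of u] img_bounds[of v] that by auto
  obtain z0 w0 where z0: "u < z0" "z0 < v" and w0: "\<psi> u < w0" "w0 < \<psi> v"
    using dense uv psi by meson
  define s where "s = sg (poly (pderiv f) z0)"
  have same: "sg (poly (pderiv f) z) = sg (poly (pderiv g) w)"
    if "u < z" "z < v" "\<psi> u < w" "w < \<psi> v" for z w
    using that bnd bnd' same_place_cell[OF cell] by (intro same_sg[OF pdS]) auto
  have s: "sg (poly (pderiv f) z) = s" if "u < z" "z < v" for z
    unfolding s_def using same[OF that w0] same[OF z0 w0] by simp
  have s': "sg (poly (pderiv g) w) = s" if "\<psi> u < w" "w < \<psi> v" for w
    unfolding s_def using same[OF z0 that] by simp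
  have "z0 \<notin> A" using cellD'[OF cell, of z0] z0 by auto
  then have "s \<noteq> 0" unfolding s_def using roots[OF pdS pd0 bnd[OF z0]] by auto
  define l r where "l = side_sg f s 1 u" and "r = side_sg f s (- 1) v"
  have pt: "sg (poly f a) = sg (poly g (\<psi> a))" if "a \<in> A" for a
    using point_sg[OF par e that] by simp
  have lr': "side_sg g s 1 (\<psi> u) = l" "side_sg g s (- 1) (\<psi> v) = r"
    using pt[of u] pt[of v] uv unfolding l_def r_def side_sg_def by (simp_all add: sg_eq_iff)
  have "u < v" using uv by simp
  note P = sg_pattern_on_cell[OF fg0(1) iv(1) \<open>u < v\<close> s \<open>s \<noteq> 0\<close>, folded l_def r_def]
    and Q = sg_pattern_on_cell[OF fg0(2) iv(2) psi s' \<open>s \<noteq> 0\<close>, unfolded lr']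
  have lr: "l \<noteq> 0" "r \<noteq> 0" using \<open>s \<noteq> 0\<close> by (auto simp: l_def r_def side_sg_def)
  show thesis
  proof (cases "l = r")
    case True
    then show thesis using P uv Q lr by (intro const[of l]) auto
  next
    case False
    obtain \<rho> where \<rho>: "u < \<rho>" "\<rho> < v"
      "\<And>z. u < z \<Longrightarrow> z < v \<Longrightarrow> sg (poly f z) = (if z < \<rho> then l else if z = \<rho> then 0 else r)"
      using P uv False by blast
    obtain \<rho>' where \<rho>': "\<psi> u < \<rho>'" "\<rho>' < \<psi> v"
      "\<And>w. \<psi> u < w \<Longrightarrow> w < \<psi> v \<Longrightarrow> sg (poly g w) = (if w < \<rho>' then l else if w = \<rho>' then 0 else r)"
      using Q False by blast
    show thesis by (rule root[OF lr \<rho>(1,2) \<rho>'(1,2) \<rho>(3) \<rho>'(3)])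
  qed
qed

text \<open>Each cell receives at most one root of the new polynomial, and it does so in both fields
  at once, so \<open>\<psi>\<close> extends monotonically.\<close>

lemma (in root_match) extend:
  assumes par: "par_family (insert (f, g) S)" "\<forall>(h, k) \<in> S. degree h \<le> degree f"
    and e: "sg (poly f a0) = sg (poly g b0)" "sg (poly f a1) = sg (poly g b1)"
  shows "\<exists>A' \<psi>'. root_match (insert (f, g) S) a0 a1 b0 b1 A' \<psi>'"
proof (cases "degree f = 0")
  case True
  have dg: "degree g = 0" and lc: "sg (lead_coeff f) = sg (lead_coeff g)"
    using par_familyD(3,4)[OF par(1), of f g] True by auto
  obtain c c' where c: "f = [:c:]" "g = [:c':]" using True dg by (metis degree_eq_zeroE)
  have "sg c = sg c'" using lc c by simp
  then have "root_match (insert (f, g) S) a0 a1 b0 b1 A \<psi>"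
  proof unfold_locales
    show "\<exists>(h, k) \<in> insert (f, g) S. 0 < degree h \<and> poly h a = 0"
      if "a \<in> A" "a \<noteq> a0" "a \<noteq> a1" for a
      using is_root[OF that] by blast
  qed (use fin ends A_sub mono a01 roots roots' same_sg in \<open>auto simp: c\<close>)
  then show ?thesis by blast
next
  case False
  then have deg: "0 < degree f" by simp
  have fg: "f \<noteq> 0" "g \<noteq> 0" using par_familyD(3)[OF par(1), of f g] deg by auto
  note pattern = cell_pattern[OF par e deg, consumes 1, case_names const root]
  have pt: "sg (poly f a) = sg (poly g (\<psi> a))" if "a \<in> A" for a
    using point_sg[OF par e that] by simp
  define new where "new = {z. a0 \<le> z \<and> z \<le> a1 \<and> poly f z = 0 \<and> z \<notin> A}"
  \<comment> \<open>A new root is sent to the root of \<open>g\<close> in the corresponding cell.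
    The description is meant for elements of \<open>new\<close>, for which that root is
    unique.\<close>
  define \<psi>' where "\<psi>' z = (if z \<in> A then \<psi> z else (THE w. same_place A \<psi> z w \<and> poly g w = 0))" for z
  have new: "\<psi>' \<rho> = \<rho>'" "\<rho> \<in> new" "z \<in> new \<Longrightarrow> z = \<rho>"
    if cell: "cell u v" and z: "u < z" "z < v" and uv: "u < \<rho>" "\<rho> < v" "\<psi> u < \<rho>'" "\<rho>' < \<psi> v"
      and lr: "l \<noteq> 0" "r \<noteq> 0"
      and f: "\<And>z. u < z \<Longrightarrow> z < v \<Longrightarrow> sg (poly f z) = (if z < \<rho> then l else if z = \<rho> then 0 else r)"
      and g: "\<And>w. \<psi> u < w \<Longrightarrow> w < \<psi> v \<Longrightarrow> sg (poly g w) = (if w < \<rho>' then l else if w = \<rho>' then 0 else r)"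
    for u v \<rho> \<rho>' l r z
  proof -
    have "\<rho> \<notin> A" using cellD'[OF cell, of \<rho>] uv by auto
    moreover have "(THE w. same_place A \<psi> \<rho> w \<and> poly g w = 0) = \<rho>'"
    proof (rule the_equality)
      show "same_place A \<psi> \<rho> \<rho>' \<and> poly g \<rho>' = 0"
        using same_place_cell[OF cell uv(1,2)] uv g[of \<rho>'] by simp
      show "w = \<rho>'" if "same_place A \<psi> \<rho> w \<and> poly g w = 0" for w
        using that same_place_cell[OF cell uv(1,2), of w] g[of w] lr by (auto split: if_splits)
    qed
    ultimately show "\<psi>' \<rho> = \<rho>'" by (simp add: \<psi>'_def)
    show "\<rho> \<in> new" using \<open>\<rho> \<notin> A\<close> uv f[of \<rho>] cellD[OF cell] A_sub by (auto simp: new_def)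
    show "z = \<rho>" if "z \<in> new" using that f[OF z] lr by (auto simp: new_def split: if_splits)
  qed
  have new_place: "same_place A \<psi> z (\<psi>' z) \<and> poly g (\<psi>' z) = 0" if z: "z \<in> new" for z
  proof -
    obtain u v where uv: "cell u v" "u < z" "z < v"
      using ex_cell[of z] z unfolding new_def by blast
    from uv(1) show ?thesis
    proof (cases rule: pattern)
      case (const l)
      then show ?thesis using const(2)[OF uv(2,3)] z by (simp add: new_def)
    next
      case (root l r \<rho> \<rho>')
      have "z = \<rho>" "\<psi>' \<rho> = \<rho>'"
        using new(1,3)[OF uv(1-3) root(3-6,1,2)] root(7,8) z by blast+
      moreover have "poly g \<rho>' = 0" using root(8)[OF root(5,6)] by simp
      ultimately show ?thesis using same_place_cell[OF uv(1-3), of \<rho>'] root(5,6) by simp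
    qed
  qed
  have old: "\<psi>' a = \<psi> a" if "a \<in> A" for a using that by (simp add: \<psi>'_def)
  define A' where "A' = A \<union> new"
  have fin_new: "finite new"
    using poly_roots_finite[OF fg(1)] by (rule rev_finite_subset) (auto simp: new_def)
  have place: "same_place A \<psi> z w" if "same_place A' \<psi>' z w" for z w
    using that old by (auto simp: same_place_def A'_def)
  have "root_match (insert (f, g) S) a0 a1 b0 b1 A' \<psi>'"
  proof
    show "finite A'" "a0 \<in> A'" "a1 \<in> A'" "\<psi>' a0 = b0" "\<psi>' a1 = b1" "A' \<subseteq> {a0..a1}" "a0 < a1"
      using fin fin_new ends A_sub a01 by (auto simp: A'_def old new_def)
    show "strict_mono_on A' \<psi>'"
    proof (rule strict_mono_onI)
      fix x y assume xy: "x \<in> A'" "y \<in> A'" "x < y"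
      consider "x \<in> A" "y \<in> A" | "x \<in> A" "y \<in> new" | "x \<in> new" "y \<in> A" | "x \<in> new" "y \<in> new"
        using xy by (auto simp: A'_def)
      then show "\<psi>' x < \<psi>' y"
      proof cases
        case 1 then show ?thesis using xy mono_iff by (simp add: old)
      next
        case 2 then show ?thesis using xy new_place[of y] by (auto simp: old same_place_iff)
      next
        case 3
        then have "\<not> y < x" "x \<noteq> y" using xy by auto
        then show ?thesis using 3 new_place[of x] by (auto simp: old same_place_iff)
      next
        case 4
        obtain u v where uv: "cell u v" "u < x" "x < v"
          using ex_cell[of x] 4 unfolding new_def by blast
        \<comment> \<open>Two new roots never share a cell, so the old point \<open>v\<close>
          separates them, and \<open>\<psi> v\<close> separates their images.\<close>
        have "v < y"
        proof (rule ccontr)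
          assume "\<not> v < y"
          moreover have "y \<noteq> v" using cellD[OF uv(1)] 4 by (auto simp: new_def)
          ultimately have y: "u < y" "y < v" using uv xy by simp_all
          from uv(1) show False
          proof (cases rule: pattern)
            case (const l)
            then show ?thesis using const(2)[OF uv(2,3)] 4 by (simp add: new_def)
          next
            case (root l r \<rho> \<rho>')
            have "x = \<rho>" "y = \<rho>"
              using new(3)[OF uv(1-3) root(3-6,1,2)] new(3)[OF uv(1) y root(3-6,1,2)] root(7,8) 4 by blast+
            then show ?thesis using xy by simp
          qed
        qed
        then have "\<psi>' x < \<psi> v" "\<psi> v < \<psi>' y"
          using cellD[OF uv(1)] uv new_place[OF 4(1)] new_place[OF 4(2)] by (auto simp: same_place_iff neq_iff)
        then show ?thesis by simp
      qed
    qed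
    fix h k assume hk: "(h, k) \<in> insert (f, g) S"
    show "z \<in> A'" if "h \<noteq> 0" "a0 \<le> z" "z \<le> a1" "poly h z = 0" for z
      using hk that roots by (auto simp: A'_def new_def)
    show "w \<in> \<psi>' ` A'" if w: "k \<noteq> 0" "b0 \<le> w" "w \<le> b1" "poly k w = 0" for w
    proof (cases "w \<in> \<psi> ` A")
      case True
      then show ?thesis using old by (force simp: A'_def)
    next
      case False
      then have kg: "k = g" using hk roots' w by auto
      obtain u v where uv: "cell u v" "\<psi> u < w" "w < \<psi> v"
        using ex_cell'[of w] False w by blast
      obtain z where z: "u < z" "z < v" using dense cellD[OF uv(1)] by blast
      from uv(1) show ?thesis
      proof (cases rule: pattern)
        case (const l)
        then show ?thesis using const(3)[OF uv(2,3)] w kg by simp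
      next
        case (root l r \<rho> \<rho>')
        have "w = \<rho>'" using root(8)[OF uv(2,3)] w kg root(1,2) by (auto split: if_splits)
        moreover have "\<psi>' \<rho> = \<rho>'" "\<rho> \<in> new"
          using new(1,2)[OF uv(1) z root(3-6,1,2)] root(7,8) by blast+
        ultimately show ?thesis by (auto simp: A'_def)
      qed
    qed
    show "sg (poly h z) = sg (poly k w)"
      if zw: "a0 \<le> z" "z \<le> a1" "b0 \<le> w" "w \<le> b1" "same_place A' \<psi>' z w" for z w
    proof (cases "(h, k) \<in> S")
      case True
      then show ?thesis using same_sg place zw by blast
    next
      case False
      then have hk: "h = f" "k = g" using hk by auto
      show ?thesis
      proof (cases "z \<in> A")
        case True
        then show ?thesis using pt same_place_mem place[OF zw(5)] hk by blast
      next
        case False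
        then obtain u v where uv: "cell u v" "u < z" "z < v" using ex_cell zw by blast
        then have w: "\<psi> u < w" "w < \<psi> v" using same_place_cell[OF uv] place[OF zw(5)] by auto
        from uv(1) show ?thesis
        proof (cases rule: pattern)
          case (const l)
          then show ?thesis using const(2)[OF uv(2,3)] const(3)[OF w] hk by simp
        next
          case (root l r \<rho> \<rho>')
          have "\<psi>' \<rho> = \<rho>'" "\<rho> \<in> new"
            using new(1,2)[OF uv(1-3) root(3-6,1,2)] root(7,8) by blast+
          then have "\<rho> < z \<longleftrightarrow> \<rho>' < w" "z = \<rho> \<longleftrightarrow> w = \<rho>'"
            using zw(5) by (auto simp: same_place_iff A'_def)
          then have "z < \<rho> \<longleftrightarrow> w < \<rho>'" "z = \<rho> \<longleftrightarrow> w = \<rho>'" by auto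
          then show ?thesis using root(7)[OF uv(2,3)] root(8)[OF w] hk by simp
        qed
      qed
    qed
  next
    fix a assume "a \<in> A'" "a \<noteq> a0" "a \<noteq> a1"
    then show "\<exists>(h, k) \<in> insert (f, g) S. 0 < degree h \<and> poly h a = 0"
      using is_root[of a] deg by (auto simp: A'_def new_def)
  qed
  then show ?thesis by blast
qed

lemma eventually_sg_lead_coeff:
  fixes f :: "'a::linordered_field poly"
  shows "eventually (\<lambda>z. sg (poly f z) = sg (lead_coeff f)) at_top"
proof (cases "f = 0")
  case False
  \<comment> \<open>The bound away from zero strengthens the induction: \<open>z * poly f z\<close>
    then outgrows the next coefficient.\<close>
  then have "\<exists>\<delta>>0. eventually (\<lambda>z. sg (poly f z) = sg (lead_coeff f) \<and> \<delta> \<le> \<bar>poly f z\<bar>) at_top"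
  proof (induction f)
    case (pCons a f)
    show ?case
    proof (cases "f = 0")
      case True
      then show ?thesis using pCons by (auto intro!: exI[of _ "\<bar>a\<bar>"])
    next
      case False
      then obtain \<delta> where \<delta>: "\<delta> > 0"
        "eventually (\<lambda>z. sg (poly f z) = sg (lead_coeff f) \<and> \<delta> \<le> \<bar>poly f z\<bar>) at_top"
        using pCons by blast
      have "eventually (\<lambda>z. sg (poly (pCons a f) z) = sg (lead_coeff (pCons a f)) \<and>
          \<delta> \<le> \<bar>poly (pCons a f) z\<bar>) at_top"
        using \<delta>(2) eventually_ge_at_top[of "\<bar>a\<bar> / \<delta> + 1"]
      proof eventually_elim
        case (elim z)
        have "0 \<le> \<bar>a\<bar> / \<delta>" using \<delta> by simp
        then have z: "0 < z" using elim by linarith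
        have "\<bar>a\<bar> + \<delta> \<le> z * \<delta>" using elim \<delta> by (simp add: field_simps)
        also have "\<dots> \<le> z * \<bar>poly f z\<bar>" using elim z by (intro mult_left_mono) auto
        also have "\<dots> = \<bar>z * poly f z\<bar>" using z by (simp add: abs_mult)
        finally have *: "\<bar>a\<bar> + \<delta> \<le> \<bar>z * poly f z\<bar>" .
        then have "sg (z * poly f z + a) = sg (z * poly f z)"
          using \<delta> by (intro sg_add_dominated) auto
        moreover have "\<delta> \<le> \<bar>a + z * poly f z\<bar>" using * by linarith
        ultimately show ?case using elim z False by (simp add: sg_mult sg_def[of z] add.commute)
      qed
      then show ?thesis using \<delta> by blast
    qed
  qed simp
  then show ?thesis by (auto elim: eventually_mono)
qed simp

text \<open>The pairs enter the matching in order of degree. The finished matching translates the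
  position of \<open>z\<close> among the roots into a position for \<open>w\<close>: an image point
  or any point of the corresponding cell.\<close>

lemma same_signs_realized:
  assumes "finite S" "par_family S"
  shows "\<exists>w. \<forall>(f, g) \<in> S. sg (poly f z) = sg (poly g w)"
proof -
  have far: "\<exists>M. \<forall>f\<in>F. \<forall>z\<ge>M. sg (poly f z) = sg (lead_coeff f) \<and>
      sg (poly f (- z)) = (- 1) ^ degree f * sg (lead_coeff f)" if "finite F" for F :: "'c::linordered_field poly set"
  proof -
    \<comment> \<open>Reflection of the argument reduces the behaviour at minus infinity to that at
      infinity.\<close>
    have neg: "sg (lead_coeff (pcompose f [:0, - 1:])) = (- 1) ^ degree f * sg (lead_coeff f)" for f :: "'c poly"
      by (subst lead_coeff_comp) (auto simp: sg_mult minus_one_power_iff)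
    have "eventually (\<lambda>z. sg (poly f z) = sg (lead_coeff f) \<and>
      sg (poly f (- z)) = (- 1) ^ degree f * sg (lead_coeff f)) at_top" for f :: "'c poly"
      using eventually_sg_lead_coeff[of f] eventually_sg_lead_coeff[of "pcompose f [:0, - 1:]"]
      unfolding neg by eventually_elim (simp add: poly_pcompose)
    then have "eventually (\<lambda>z. \<forall>f\<in>F. sg (poly f z) = sg (lead_coeff f) \<and>
      sg (poly f (- z)) = (- 1) ^ degree f * sg (lead_coeff f)) at_top"
      using that by (intro eventually_ball_finite) auto
    then show ?thesis unfolding eventually_at_top_linorder by blast
  qed
  obtain M where M: "\<And>f g z. (f, g) \<in> S \<Longrightarrow> M \<le> z \<Longrightarrow> sg (poly f z) = sg (lead_coeff f) \<and>
      sg (poly f (- z)) = (- 1) ^ degree f * sg (lead_coeff f)"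
    using far[of "fst ` S"] assms(1) by force
  obtain M' where M': "\<And>f g z. (f, g) \<in> S \<Longrightarrow> M' \<le> z \<Longrightarrow> sg (poly g z) = sg (lead_coeff g) \<and>
      sg (poly g (- z)) = (- 1) ^ degree g * sg (lead_coeff g)"
    using far[of "snd ` S"] assms(1) by force
  \<comment> \<open>At the sentinels every sign is the one at infinity, which is determined by
    degree and leading sign and so agrees in both fields. The term \<open>\<bar>z\<bar> + 1\<close>
    puts \<open>z\<close> strictly between them.\<close>
  define a where "a = max M (\<bar>z\<bar> + 1)"
  define b where "b = max M' 1"
  have a: "M \<le> a" "- a < z" "z < a" "- a < a" unfolding a_def by (auto simp: less_max_iff_disj)
  have b: "M' \<le> b" "- b < b" unfolding b_def by (auto simp: less_max_iff_disj)
  have ends: "sg (poly f (- a)) = sg (poly g (- b)) \<and> sg (poly f a) = sg (poly g b)" if "(f, g) \<in> S" for f g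
    using M[OF that a(1)] M'[OF that b(1)] par_familyD(3,4)[OF assms(2) that] by simp
  have "par_family T \<Longrightarrow> T \<subseteq> S \<Longrightarrow> \<exists>A \<psi>. root_match T (- a) a (- b) b A \<psi>" if "finite T" for T
    using that
  \<comment> \<open>This induction always adds a pair of maximal degree, as \<open>extend\<close>
    demands.\<close>
  proof (induction T rule: finite_ranking_induct[where f = "\<lambda>(f, g). degree f"])
    case empty
    have "root_match {} (- a) a (- b) b {- a, a} (\<lambda>x. if x = a then b else - b)"
      using a b by unfold_locales (auto intro!: strict_mono_onI)
    then show ?case by blast
  next
    case (insert x T)
    obtain f g where x: "x = (f, g)" by fastforce
    have le: "degree h \<le> degree f" if "(h, k) \<in> T" for h k using insert.hyps(2)[OF that] x by simp
    have "par_family T" using par_family_subset[of f g T] insert.prems(1) le x by blast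
    then obtain A \<psi> where "root_match T (- a) a (- b) b A \<psi>" using insert by blast
    then show ?case
      using root_match.extend[of T "- a" a "- b" b A \<psi> f g] insert.prems le ends[of f g] unfolding x by fast
  qed
  then obtain A \<psi> where "root_match S (- a) a (- b) b A \<psi>" using assms by blast
  then interpret root_match S "- a" a "- b" b A \<psi> .
  obtain w where w: "same_place A \<psi> z w"
  proof (cases "z \<in> A")
    case True
    then show thesis using same_place_img that by blast
  next
    case False
    have "- a \<le> z" "z \<le> a" using a by simp_all
    with False obtain u v where uv: "cell u v" "u < z" "z < v" by (rule ex_cell)
    then have "\<psi> u < \<psi> v" using mono_iff[of u v] cellD[OF uv(1)] by simp
    then obtain w where "\<psi> u < w" "w < \<psi> v" using dense by blast
    then show thesis using same_place_cell[OF uv] that by blast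
  qed
  have "- b \<le> w" "w \<le> b" using same_place_bounds[OF w] a by auto
  then have "sg (poly f z) = sg (poly g w)" if "(f, g) \<in> S" for f g
    using same_sg[OF that _ _ _ _ w] a by simp
  then show ?thesis by blast
qed

section \<open>Elimination of variables\<close>

text \<open>The degree shifted by one, so that passing from a nonzero constant to zero is a decrease
  as well.\<close>

definition poly_size :: "'a::zero poly \<Rightarrow> nat" where
  "poly_size p = (if p = 0 then 0 else Suc (degree p))"

lemma poly_size_less:
  "p \<noteq> 0 \<Longrightarrow> poly_size (p - monom (lead_coeff p) (degree p)) < poly_size (p :: 'a::idom poly)"
  "p \<noteq> 0 \<Longrightarrow> poly_size (pderiv p) < poly_size p"
  "h \<noteq> 0 \<Longrightarrow> poly_size (pseudo_mod p h) < poly_size h"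
proof -
  show "poly_size (p - monom (lead_coeff p) (degree p)) < poly_size p" if "p \<noteq> 0"
  proof (cases "degree p = 0")
    case True
    then obtain c where "p = [:c:]" by (metis degree_eq_zeroE)
    then show ?thesis using that by (simp add: poly_size_def monom_0)
  next
    case False
    have "degree (p - monom (lead_coeff p) (degree p)) \<le> degree p"
      by (intro degree_diff_le) (auto simp: degree_monom_le)
    moreover have "coeff (p - monom (lead_coeff p) (degree p)) (degree p) = 0" by simp
    ultimately have "p - monom (lead_coeff p) (degree p) = 0 \<or>
        degree (p - monom (lead_coeff p) (degree p)) < degree p"
      by (metis le_neq_implies_less leading_coeff_0_iff)
    then show ?thesis using that by (auto simp: poly_size_def)
  qed
  show "poly_size (pderiv p) < poly_size p" if "p \<noteq> 0"
  proof (cases "degree p = 0")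
    case True
    then obtain c where "p = [:c:]" by (metis degree_eq_zeroE)
    then show ?thesis using that by (simp add: poly_size_def pderiv_pCons)
  next
    case False
    have "degree (pderiv p) \<le> degree p - 1"
      by (intro degree_le) (auto simp: coeff_pderiv coeff_eq_0)
    then show ?thesis using that False by (auto simp: poly_size_def)
  qed
  show "poly_size (pseudo_mod p h) < poly_size h" if "h \<noteq> 0"
    using pseudo_mod(2)[OF that, of p] that by (auto simp: poly_size_def)
qed


text \<open>Finite, because each operation lowers \<open>poly_size\<close> below that of all its arguments.\<close>

inductive_set elim_closure :: "'a::idom poly set \<Rightarrow> 'a poly set" for X where
  base: "p \<in> X \<Longrightarrow> p \<in> elim_closure X"
| truncate: "p \<in> elim_closure X \<Longrightarrow> p \<noteq> 0 \<Longrightarrow> p - monom (lead_coeff p) (degree p) \<in> elim_closure X"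
| deriv: "p \<in> elim_closure X \<Longrightarrow> p \<noteq> 0 \<Longrightarrow> pderiv p \<in> elim_closure X"
| rem: "p \<in> elim_closure X \<Longrightarrow> h \<in> elim_closure X \<Longrightarrow> 0 < degree h \<Longrightarrow> degree h \<le> degree p \<Longrightarrow>
    pseudo_mod p h \<in> elim_closure X"

lemma finite_elim_closure:
  assumes "finite X"
  shows "finite (elim_closure X)"
proof -
  obtain N where N: "\<And>p. p \<in> X \<Longrightarrow> poly_size p \<le> N"
    using assms by (metis Max_ge finite_imageI imageI)
  have le: "poly_size p \<le> N" if "p \<in> elim_closure X" for p
    using that
  proof (induction rule: elim_closure.induct)
    case (rem p h)
    then have "h \<noteq> 0" by auto
    then show ?case using poly_size_less(3)[of h p] rem by linarith
  next
    case (truncate p)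
    then show ?case using poly_size_less(1)[of p] by linarith
  next
    case (deriv p)
    then show ?case using poly_size_less(2)[of p] by linarith
  qed (use N in auto)
  \<comment> \<open>Levels are counted from the largest size \<open>N\<close> downwards: a member of
    \<open>?C (Suc k)\<close> is in \<open>X\<close> or arises from members of strictly larger size,
    which lie in \<open>?C k\<close>.\<close>
  let ?C = "\<lambda>k. {p \<in> elim_closure X. N < poly_size p + k}"
  define out where "out p h = {pseudo_mod p h, p - monom (lead_coeff p) (degree p), pderiv p}" for p h :: "'a poly"
  have "finite (?C k)" for k
  proof (induction k)
    case 0
    have "?C 0 = {}" using le by fastforce
    then show ?case by (simp only: finite.emptyI)
  next
    case (Suc k)
    have "?C (Suc k) \<subseteq> X \<union> (\<Union>p\<in>?C k. \<Union>h\<in>?C k. out p h)"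
    proof
      fix q assume "q \<in> ?C (Suc k)"
      then have q: "q \<in> elim_closure X" "N < poly_size q + Suc k" by auto
      from q(1) show "q \<in> X \<union> (\<Union>p\<in>?C k. \<Union>h\<in>?C k. out p h)"
      proof cases
        case (truncate p)
        then have "p \<in> ?C k" using poly_size_less(1)[of p] q(2) by auto
        then show ?thesis using truncate by (auto simp: out_def)
      next
        case (deriv p)
        then have "p \<in> ?C k" using poly_size_less(2)[of p] q(2) by auto
        then show ?thesis using deriv by (auto simp: out_def)
      next
        case (rem p h)
        then have "h \<noteq> 0" by auto
        moreover have "poly_size h \<le> poly_size p" using rem by (auto simp: poly_size_def)
        ultimately have "p \<in> ?C k" "h \<in> ?C k" using rem poly_size_less(3)[of h p] q(2) by auto
        then show ?thesis using rem by (auto simp: out_def)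
      qed auto
    qed
    moreover have "finite (X \<union> (\<Union>p\<in>?C k. \<Union>h\<in>?C k. out p h))"
      using Suc assms by (auto simp: out_def)
    ultimately show ?case by (rule finite_subset)
  qed
  moreover have "?C (Suc N) = elim_closure X" by auto
  ultimately show ?thesis by metis
qed

lemma pseudo_mod_lead_power:
  fixes p h :: "'a::idom poly"
  assumes "h \<noteq> 0"
  shows "\<exists>k q. smult (lead_coeff h ^ k) p = h * q + pseudo_mod p h"
  using pseudo_divmod(1)[OF assms, of p] unfolding pseudo_mod_def by (metis prod.collapse)

definition split_var :: "nat \<Rightarrow> nat rpoly \<Rightarrow> nat rpoly poly" where
  "split_var n = subst (\<lambda>c. [:const_poly c:]) (\<lambda>i. if i = n then [:0, 1:] else [:var i:])"

text \<open>Setting the variables from \<open>n\<close> on to zero is done inside the ring, so that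
  the polynomials subject to the intermediate value property can be listed without reference to a
  point.\<close>

definition cut_vars :: "nat \<Rightarrow> nat rpoly \<Rightarrow> nat rpoly" where
  "cut_vars n = subst const_poly (\<lambda>i. if i < n then var i else 0)"

text \<open>The univariate polynomials met while the variables \<open>n - 1\<close> down to
  \<open>0\<close> are eliminated. No field enters, so the family can be prescribed before an
  ordering is chosen.\<close>

fun elim_family :: "nat \<Rightarrow> nat rpoly set \<Rightarrow> nat rpoly poly set" where
  "elim_family 0 F = {}"
| "elim_family (Suc n) F = (let T = elim_closure (split_var n ` F) in
     map_poly (cut_vars n) ` T \<union> elim_family n (\<Union>p\<in>T. set (coeffs p)))"

lemma finite_elim_family: "finite F \<Longrightarrow> finite (elim_family n F)"
  by (induction n arbitrary: F) (auto simp: Let_def finite_elim_closure)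

lemma rhom_split_var: "rhom (split_var n)" and rhom_cut_vars: "rhom (cut_vars n)"
  unfolding split_var_def cut_vars_def by (intro rhom_subst rhom_const rhom_const_poly)+

lemma subst_cut_vars:
  assumes "rhom \<iota>"
  shows "subst \<iota> x (cut_vars n u) = subst \<iota> (\<lambda>i. if i < n then x i else 0) u"
proof (rule rhom_rpoly_eq[of "\<lambda>u. subst \<iota> x (cut_vars n u)"])
  show "rhom (\<lambda>u. subst \<iota> x (cut_vars n u))"
    by (rule rhom_comp[OF rhom_subst[OF assms] rhom_cut_vars])
  show "rhom (subst \<iota> (\<lambda>i. if i < n then x i else 0))" by (rule rhom_subst[OF assms])
qed (auto simp: cut_vars_def subst_const subst_var rhom_const_poly assms rhom_0[OF rhom_subst[OF assms]])

lemma subst_split_var: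
  assumes "rhom \<iota>"
  shows "poly (map_poly (subst \<iota> x) (split_var n u)) a = subst \<iota> (x(n := a)) u"
proof (rule rhom_rpoly_eq[of "\<lambda>u. poly (map_poly (subst \<iota> x) (split_var n u)) a"])
  show "rhom (\<lambda>u. poly (map_poly (subst \<iota> x) (split_var n u)) a)"
    by (rule rhom_comp[OF rhom_poly_eval[OF rhom_subst[OF assms]] rhom_split_var])
  show "rhom (subst \<iota> (x(n := a)))" using assms by (rule rhom_subst)
qed (auto simp: split_var_def subst_const subst_var rhom_const rhom_const_poly assms
  rhom_simps[OF rhom_subst[OF assms]] map_poly_pCons)

text \<open>The purpose of truncation: a leading term whose coefficient specialises to zero is
  dropped without changing either specialisation. Once the leading coefficient survives, both
  specialisations have the degree of \<open>p'\<close>.\<close>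

lemma elim_closure_lead:
  assumes "p \<in> elim_closure X" "rhom h" "rhom h'"
    and z: "\<And>p c. p \<in> elim_closure X \<Longrightarrow> c \<in> set (coeffs p) \<Longrightarrow> h c = 0 \<longleftrightarrow> h' c = 0"
  shows "\<exists>p'\<in>elim_closure X. map_poly h p = map_poly h p' \<and> map_poly h' p = map_poly h' p' \<and>
    (p' = 0 \<or> h (lead_coeff p') \<noteq> 0 \<and> h' (lead_coeff p') \<noteq> 0)"
  using assms(1)
proof (induction "poly_size p" arbitrary: p rule: less_induct)
  case less
  show ?case
  proof (cases "p = 0 \<or> h (lead_coeff p) \<noteq> 0")
    case True
    then show ?thesis using less.prems z[OF less.prems, of "lead_coeff p"]
      by (metis coeff_in_coeffs le_refl)
  next
    case False
    let ?q = "p - monom (lead_coeff p) (degree p)"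
    have "h (lead_coeff p) = 0" "h' (lead_coeff p) = 0"
      using False z[OF less.prems, of "lead_coeff p"] by (auto simp: coeff_in_coeffs)
    then have "map_poly h ?q = map_poly h p" "map_poly h' ?q = map_poly h' p"
      using assms(2,3) by (auto intro!: poly_eqI simp: coeff_map_poly rhom_simps)
    then show ?thesis
      using less.hyps[of ?q] poly_size_less(1)[of p] False elim_closure.truncate[OF less.prems] by metis
  qed
qed

text \<open>Agreement of the coefficient signs makes the two specialisations of the closure a
  parallel family, to which \<open>same_signs_realized\<close> applies.\<close>

lemma elim_step:
  fixes h :: "'r::idom \<Rightarrow> 'a::linordered_field" and h' :: "'r \<Rightarrow> 'b::linordered_field"
  assumes "finite X" and hom: "rhom h" "rhom h'"
    and sg: "\<And>p c. p \<in> elim_closure X \<Longrightarrow> c \<in> set (coeffs p) \<Longrightarrow> sg (h c) = sg (h' c)"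
    and iv: "\<And>p. p \<in> elim_closure X \<Longrightarrow> ivt (map_poly h p)" "\<And>p. p \<in> elim_closure X \<Longrightarrow> ivt (map_poly h' p)"
  shows "\<exists>b. \<forall>p\<in>X. sg (poly (map_poly h p) a) = sg (poly (map_poly h' p) b)"
proof -
  let ?T = "elim_closure X"
  define S where "S = (\<lambda>p. (map_poly h p, map_poly h' p)) ` ?T"
  have z: "h c = 0 \<longleftrightarrow> h' c = 0" if "p \<in> ?T" "c \<in> set (coeffs p)" for p c
    using sg[OF that] by (metis sg_0_iff)
  have lead: "\<exists>p\<in>?T. f = map_poly h p \<and> g = map_poly h' p \<and>
      (p = 0 \<or> h (lead_coeff p) \<noteq> 0 \<and> h' (lead_coeff p) \<noteq> 0)" if "(f, g) \<in> S" for f g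
    using elim_closure_lead[OF _ hom z] that unfolding S_def by fast
  have deg: "degree (map_poly h p) = degree p \<and> degree (map_poly h' p) = degree p"
    if "p = 0 \<or> h (lead_coeff p) \<noteq> 0 \<and> h' (lead_coeff p) \<noteq> 0" for p
    using that by (auto simp: map_poly_degree_eq)
  have "par_family S"
  proof (rule par_familyI)
    fix f g assume fg: "(f, g) \<in> S"
    then obtain p where p: "p \<in> ?T" "f = map_poly h p" "g = map_poly h' p"
      "p = 0 \<or> h (lead_coeff p) \<noteq> 0 \<and> h' (lead_coeff p) \<noteq> 0"
      using lead by blast
    have "sg (lead_coeff f) = sg (lead_coeff g)"
    proof (cases "p = 0")
      case False
      then show ?thesis using sg[OF p(1), of "lead_coeff p"] deg[OF p(4)] hom
        by (simp add: p(2,3) coeff_map_poly rhom_0 coeff_in_coeffs)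
    qed (simp add: p)
    then show "ivt f \<and> ivt g \<and> degree f = degree g \<and> sg (lead_coeff f) = sg (lead_coeff g)"
      using deg[OF p(4)] iv p by simp
    show "(pderiv f, pderiv g) \<in> S" if "0 < degree f"
    proof -
      have "p \<noteq> 0" using that p by auto
      then have "(map_poly h (pderiv p), map_poly h' (pderiv p)) \<in> S"
        using elim_closure.deriv[OF p(1)] unfolding S_def by blast
      then show ?thesis using hom by (simp add: p map_poly_pderiv)
    qed
  next
    fix f g k k' assume fg: "(f, g) \<in> S" and kk: "(k, k') \<in> S" and d: "0 < degree k" "degree k \<le> degree f"
    obtain p where p: "p \<in> ?T" "f = map_poly h p" "g = map_poly h' p"
      "p = 0 \<or> h (lead_coeff p) \<noteq> 0 \<and> h' (lead_coeff p) \<noteq> 0"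
      using lead[OF fg] by blast
    obtain t where t: "t \<in> ?T" "k = map_poly h t" "k' = map_poly h' t"
      "t = 0 \<or> h (lead_coeff t) \<noteq> 0 \<and> h' (lead_coeff t) \<noteq> 0"
      using lead[OF kk] by blast
    have dt: "0 < degree t" "degree t \<le> degree p" using d deg[OF p(4)] deg[OF t(4)] p t by auto
    then have "t \<noteq> 0" by auto
    obtain j q where eq: "smult (lead_coeff t ^ j) p = t * q + pseudo_mod p t"
      using pseudo_mod_lead_power[OF \<open>t \<noteq> 0\<close>] by blast
    let ?c = "h (lead_coeff t) ^ j" and ?c' = "h' (lead_coeff t) ^ j"
    let ?r = "map_poly h (pseudo_mod p t)" and ?r' = "map_poly h' (pseudo_mod p t)"
    have "smult ?c f = k * map_poly h q + ?r" "smult ?c' g = k' * map_poly h' q + ?r'"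
      using arg_cong[OF eq, of "map_poly h"] arg_cong[OF eq, of "map_poly h'"] hom
      by (simp_all add: p t map_poly_hom_smult map_poly_add map_poly_mult rhom_power)
    moreover have "?c \<noteq> 0" using t(4) \<open>t \<noteq> 0\<close> by simp
    \<comment> \<open>The multiplier of pseudo-division may be negative, but its sign is the same on
      both sides.\<close>
    moreover have "sg ?c = sg ?c'"
    proof -
      have "sg (h (lead_coeff t)) = sg (h' (lead_coeff t))"
        using sg[OF t(1)] \<open>t \<noteq> 0\<close> by (simp add: coeff_in_coeffs)
      then show ?thesis by (induction j) (simp_all add: sg_mult)
    qed
    moreover have "(?r, ?r') \<in> S" using elim_closure.rem[OF p(1) t(1) dt] unfolding S_def by blast
    moreover have "degree ?r < degree k"
    proof -
      have "degree ?r \<le> degree (pseudo_mod p t)" by (rule map_poly_degree_leq)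
      also have "\<dots> < degree t" using pseudo_mod(2)[OF \<open>t \<noteq> 0\<close>, of p] dt by auto
      finally show ?thesis using deg[OF t(4)] t by simp
    qed
    ultimately show "\<exists>r r' c c' q q'. (r, r') \<in> S \<and> degree r < degree k \<and> c \<noteq> 0 \<and> sg c = sg c' \<and>
        smult c f = k * q + r \<and> smult c' g = k' * q' + r'" by blast
  qed
  moreover have "finite S" unfolding S_def using assms(1) by (intro finite_imageI finite_elim_closure)
  ultimately obtain b where "\<forall>(f, g)\<in>S. sg (poly f a) = sg (poly g b)"
    using same_signs_realized[of S a] by blast
  then show ?thesis unfolding S_def using elim_closure.base by blast
qed

text \<open>Positive reals are squares of invertible elements, so a ring homomorphism into an
  ordered field preserves their sign.\<close>

lemma sg_real_embedding:
  fixes \<iota> :: "real \<Rightarrow> 'a::linordered_field"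
  assumes "rhom \<iota>"
  shows "sg (\<iota> c) = sg c"
proof -
  have pos: "0 < \<iota> c" if "0 < c" for c
  proof -
    have "\<iota> c = \<iota> (sqrt c) * \<iota> (sqrt c)" using that by (simp add: rhom_mult[OF assms, symmetric])
    moreover have "\<iota> (sqrt c) * \<iota> (1 / sqrt c) = 1"
      using that by (simp add: rhom_mult[OF assms, symmetric] rhom_1[OF assms])
    then have "\<iota> (sqrt c) \<noteq> 0" by auto
    ultimately show ?thesis by (simp add: not_square_less_zero less_le)
  qed
  have "\<iota> c < 0" if "c < 0" using pos[of "- c"] that by (simp add: rhom_uminus[OF assms])
  moreover have "\<iota> c = 0" if "c = 0" using that rhom_0[OF assms] by simp
  ultimately show ?thesis using pos[of c] by (cases c "0 :: real" rule: linorder_cases) (auto simp: sg_def)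
qed

text \<open>The coefficients of the closure form a system in one variable less, whose signs the
  induction realises at some \<open>y\<close>; \<open>elim_step\<close> then supplies the remaining
  coordinate.\<close>

lemma sign_transfer:
  fixes \<iota> :: "real \<Rightarrow> 'a::linordered_field"
  assumes \<iota>: "rhom \<iota>" and "finite F" and "\<And>g. g \<in> elim_family n F \<Longrightarrow> ivt (map_poly (subst \<iota> x) g)"
  shows "\<exists>y :: nat \<Rightarrow> real. \<forall>u\<in>F. sg (subst \<iota> (\<lambda>i. if i < n then x i else 0) u) = sg (subst (\<lambda>c. c) y u)"
  using assms(2,3)
proof (induction n arbitrary: F)
  case 0
  have id: "rhom (\<lambda>c::real. c)" by (simp add: rhom_def)
  have "subst \<iota> (\<lambda>i. 0) u = \<iota> (subst (\<lambda>c. c) (\<lambda>i. 0) u)" for u :: "nat rpoly"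
    by (rule rhom_rpoly_eq[of _ "\<lambda>u. \<iota> (subst (\<lambda>c. c) (\<lambda>i. 0) u)"])
      (auto intro!: rhom_subst rhom_comp[OF \<iota>] simp: \<iota> id subst_const subst_var rhom_0)
  then show ?case by (auto simp: sg_real_embedding[OF \<iota>])
next
  case (Suc n)
  have id: "rhom (\<lambda>c::real. c)" by (simp add: rhom_def)
  let ?X = "split_var n ` F"
  let ?T = "elim_closure ?X"
  let ?x = "\<lambda>i. if i < n then x i else 0"
  have fin: "finite ?T" using Suc.prems(1) by (intro finite_elim_closure finite_imageI)
  have "\<exists>y :: nat \<Rightarrow> real. \<forall>u\<in>(\<Union>p\<in>?T. set (coeffs p)). sg (subst \<iota> ?x u) = sg (subst (\<lambda>c. c) y u)"
  proof (rule Suc.IH)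
    show "finite (\<Union>p\<in>?T. set (coeffs p))" using fin by simp
    show "ivt (map_poly (subst \<iota> x) g)" if "g \<in> elim_family n (\<Union>p\<in>?T. set (coeffs p))" for g
      using Suc.prems(2)[of g] that by (simp add: Let_def)
  qed
  then obtain y :: "nat \<Rightarrow> real" where y: "\<And>p c. p \<in> ?T \<Longrightarrow> c \<in> set (coeffs p) \<Longrightarrow>
      sg (subst \<iota> ?x c) = sg (subst (\<lambda>c. c) y c)" by blast
  have "\<exists>b. \<forall>p\<in>?X. sg (poly (map_poly (subst \<iota> ?x) p) (x n)) = sg (poly (map_poly (subst (\<lambda>c. c) y) p) b)"
  proof (rule elim_step[OF _ rhom_subst[OF \<iota>] rhom_subst[OF id] y])
    show "ivt (map_poly (subst \<iota> ?x) p)" if "p \<in> ?T" for p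
    proof -
      have "map_poly (subst \<iota> ?x) p = map_poly (subst \<iota> x) (map_poly (cut_vars n) p)"
        by (intro poly_eqI)
          (simp add: coeff_map_poly rhom_0 rhom_cut_vars rhom_subst \<iota> subst_cut_vars)
      then show ?thesis using Suc.prems(2)[of "map_poly (cut_vars n) p"] that by (simp add: Let_def)
    qed
  qed (use Suc.prems(1) in \<open>auto simp: ivt_real\<close>)
  then obtain b where b: "\<And>u. u \<in> F \<Longrightarrow>
      sg (subst \<iota> (?x(n := x n)) u) = sg (subst (\<lambda>c. c) (y(n := b)) u)"
    by (auto simp: subst_split_var \<iota> id)
  have "?x(n := x n) = (\<lambda>i. if i < Suc n then x i else 0)" by (auto simp: less_Suc_eq)
  then show ?case using b by metis
qed

section \<open>The real Nullstellensatz\<close>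

text \<open>All roots are collected in \<open>l\<close>, which has equal signs at the ends of a
  root-free interval. A sign change of \<open>f\<close> there passes to the rootless factor
  \<open>k\<close>, and a root adjoined to \<open>k\<close> differs from every element of the
  field.\<close>

lemma factor_out_roots:
  fixes f :: "'a::linordered_field poly"
  assumes "f \<noteq> 0"
  shows "\<exists>l k. f = l * k \<and> (\<forall>z. poly k z \<noteq> 0) \<and> (\<forall>a b. a < b \<longrightarrow> poly f a * poly f b \<noteq> 0 \<longrightarrow>
    (\<forall>c. a < c \<longrightarrow> c < b \<longrightarrow> poly f c \<noteq> 0) \<longrightarrow> 0 < poly l a * poly l b)"
  using assms
proof (induction "degree f" arbitrary: f rule: less_induct)
  case less
  show ?case
  proof (cases "\<exists>r. poly f r = 0")
    case False
    then show ?thesis by (intro exI[of _ 1] exI[of _ f]) auto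
  next
    case True
    then obtain r f' where f: "f = [:- r, 1:] * f'" by (metis dvdE poly_eq_0_iff_dvd)
    have "f' \<noteq> 0" using less.prems f by auto
    then have "degree f = Suc (degree f')" unfolding f by (subst degree_mult_eq) auto
    then obtain l k where lk: "f' = l * k" "\<forall>z. poly k z \<noteq> 0"
      "\<And>a b. a < b \<Longrightarrow> poly f' a * poly f' b \<noteq> 0 \<Longrightarrow> (\<And>c. a < c \<Longrightarrow> c < b \<Longrightarrow> poly f' c \<noteq> 0) \<Longrightarrow>
        0 < poly l a * poly l b"
      using less.hyps[of f'] \<open>f' \<noteq> 0\<close> by auto
    have "0 < poly ([:- r, 1:] * l) a * poly ([:- r, 1:] * l) b"
      if ab: "a < b" "poly f a * poly f b \<noteq> 0" "\<forall>c. a < c \<longrightarrow> c < b \<longrightarrow> poly f c \<noteq> 0" for a b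
    proof -
      have "poly f r = 0" by (simp add: f)
      then have "r < a \<or> b < r" using ab by (metis linorder_neqE mult_zero_left mult_zero_right)
      then have "0 < (a - r) * (b - r)" using ab(1) by (auto intro: mult_neg_neg)
      moreover have "0 < poly l a * poly l b" using ab by (intro lk(3)) (auto simp: f)
      ultimately have "0 < ((a - r) * (b - r)) * (poly l a * poly l b)" by simp
      then show ?thesis by (simp add: algebra_simps)
    qed
    then show ?thesis using lk(1,2)
      by (intro exI[of _ "[:- r, 1:] * l"] exI[of _ k]) (auto simp: f algebra_simps)
  qed
qed

section \<open>Orderings with the largest number of roots\<close>

text \<open>The comparison is with all orderings that have \<open>q\<close> in the support, not only
  with extensions of \<open>P\<close>: the competitor built below reinterprets a variable and need
  not contain \<open>P\<close>.\<close>

definition max_roots :: "nat rpoly \<Rightarrow> nat rpoly poly set \<Rightarrow> nat rpoly set \<Rightarrow> (nat rpoly poly \<times> nat rpoly) set \<Rightarrow> bool" where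
  "max_roots q G P E \<longleftrightarrow> is_ordering P \<and> q \<in> supp P \<and> root_set P G E \<and>
    (\<forall>P' E'. is_ordering P' \<longrightarrow> q \<in> supp P' \<longrightarrow> root_set P' G E' \<longrightarrow> card E' \<le> card E)"

lemma ex_max_roots:
  assumes "is_ordering P" "q \<in> supp P" "finite G"
  shows "\<exists>P E. max_roots q G P E"
proof -
  let ?A = "\<lambda>(P, E). is_ordering P \<and> q \<in> supp P \<and> root_set P G E"
  have "?A (P, {})" using assms by (simp add: root_set_def)
  moreover have "\<forall>y. ?A y \<longrightarrow> card (snd y) < Suc (\<Sum>g\<in>G. degree g)"
    using card_root_set[OF _ _ assms(3)] by (auto simp: less_Suc_eq_le)
  ultimately obtain x where "?A x" "\<forall>y. ?A y \<longrightarrow> card (snd y) \<le> card (snd x)"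
    using ex_has_greatest_nat[of ?A "(P, {})" "\<lambda>x. card (snd x)"] by blast
  then show ?thesis unfolding max_roots_def by (cases x) auto
qed

text \<open>If \<open>g\<close> changed sign without having a root, a fresh variable could be interpreted as a new root
  of \<open>g\<close> in an ordered extension, contradicting maximality.\<close>

lemma max_roots_ivt:
  fixes h :: "nat rpoly \<Rightarrow> 'a::linordered_field"
  assumes max: "max_roots q G P E" and "finite G" and hom: "rhom h"
    and pos: "\<And>u. 0 \<le> h u \<longleftrightarrow> u \<in> P" and "g \<in> G"
  shows "ivt (map_poly h g)"
  unfolding ivt_def
proof (intro allI impI, rule ccontr)
  define f where "f = map_poly h g"
  fix a b assume "a < b" "poly (map_poly h g) a * poly (map_poly h g) b < 0"
    "\<nexists>c. a < c \<and> c < b \<and> poly (map_poly h g) c = 0"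
  then have ab: "a < b" "poly f a * poly f b < 0" "\<And>c. a < c \<Longrightarrow> c < b \<Longrightarrow> poly f c \<noteq> 0"
    by (auto simp: f_def)
  then have f0: "f \<noteq> 0" by auto
  obtain l k where lk: "f = l * k" "\<And>z. poly k z \<noteq> 0" "0 < poly l a * poly l b"
    using factor_out_roots[OF f0] ab by (metis less_irrefl)
  have "poly k a * poly k b < 0"
  proof (rule ccontr)
    assume "\<not> poly k a * poly k b < 0"
    then have "0 \<le> (poly l a * poly l b) * (poly k a * poly k b)"
      using lk(3) by (intro mult_nonneg_nonneg[of "poly l a * poly l b"]) auto
    then show False using ab(2) by (simp add: lk(1) mult_ac)
  qed
  then obtain P' where P': "is_ordering P'" "k \<in> supp P'" "\<And>c. 0 \<le> c \<Longrightarrow> [:c:] \<in> P'"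
    using ex_ordering_root by blast
  have h0: "h u = 0 \<longleftrightarrow> u \<in> supp P" for u
    using pos[of u] pos[of "- u"] by (auto simp: supp_def rhom_uminus[OF hom])
  have c0: "[:c:] \<in> supp P' \<longleftrightarrow> c = 0" for c
  proof
    assume c: "[:c:] \<in> supp P'"
    show "c = 0"
    proof (rule ccontr)
      assume "c \<noteq> 0"
      then have "[:c:] * [:1 / c:] = 1" by (simp add: one_pCons)
      then show False using supp_mult[OF P'(1) c] supp_1[OF P'(1)] by metis
    qed
  qed (use supp_0[OF P'(1)] in simp)
  note E = max[unfolded max_roots_def]
  have rs: "finite E" "\<And>g r. (g, r) \<in> E \<Longrightarrow> g \<in> G \<and> poly g r \<in> supp P \<and> (\<exists>i. coeff g i \<notin> supp P)"
    "\<And>g r r'. (g, r) \<in> E \<Longrightarrow> (g, r') \<in> E \<Longrightarrow> r \<noteq> r' \<Longrightarrow> r - r' \<notin> supp P"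
    using E unfolding root_set_def by blast+
  \<comment> \<open>On these elements the old and the new support have to agree; a variable that
    occurs in none of them may be reinterpreted.\<close>
  define W where "W = insert q (snd ` E \<union> (\<Union>g\<in>G. set (coeffs g)))"
  have "finite (\<Union>u\<in>W. \<Union>m\<in>Poly_Mapping.keys u. Poly_Mapping.keys m)"
    using rs(1) assms(2) by (auto simp: W_def)
  then obtain v :: nat where v: "v \<notin> (\<Union>u\<in>W. \<Union>m\<in>Poly_Mapping.keys u. Poly_Mapping.keys m)"
    using ex_new_if_finite[OF infinite_UNIV_nat] by blast
  \<comment> \<open>\<open>var v\<close> gives up its value under \<open>h\<close> and becomes the
    indeterminate, a root of \<open>k\<close> modulo \<open>supp P'\<close>; the other variables
    keep their values.\<close>
  define \<psi> where "\<psi> = subst (\<lambda>c. [:h (const_poly c):]) (\<lambda>i. if i = v then [:0, 1:] else [:h (var i):])"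
  have \<iota>: "rhom (\<lambda>c. [:h (const_poly c):])"
    by (rule rhom_const[OF rhom_comp[OF hom rhom_const_poly]])
  have hom': "rhom \<psi>" unfolding \<psi>_def by (rule rhom_subst[OF \<iota>])
  have \<psi>_W: "\<psi> u = [:h u:]" if "u \<in> W" for u
  proof -
    have "\<psi> u = subst (\<lambda>c. [:h (const_poly c):]) (\<lambda>i. [:h (var i):]) u"
      unfolding \<psi>_def by (rule subst_cong) (use v that in auto)
    also have "\<dots> = [:h u:]"
      by (rule rhom_rpoly_eq[OF rhom_subst[OF \<iota>] rhom_const[OF hom]]) (simp_all add: subst_const subst_var \<iota>)
    finally show ?thesis .
  qed
  have \<psi>_coeff: "\<psi> (coeff p i) = [:h (coeff p i):]" if "p \<in> G" for p i
  proof (cases "coeff p i = 0")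
    case False
    then have "coeff p i \<in> set (coeffs p)" by (metis coeff_in_coeffs degree_0 coeff_0 le_degree)
    then show ?thesis using \<psi>_W that by (auto simp: W_def)
  qed (simp add: rhom_0 hom hom')
  have map: "map_poly \<psi> p = map_poly (\<lambda>u. [:h u:]) p" if "p \<in> G" for p
    by (intro poly_eqI) (simp add: coeff_map_poly rhom_0 hom hom' \<psi>_coeff[OF that])
  define P'' where "P'' = \<psi> -` P'"
  have P'': "is_ordering P''" unfolding P''_def by (rule is_ordering_vimage[OF P'(1) hom'])
  have supp'': "u \<in> supp P'' \<longleftrightarrow> \<psi> u \<in> supp P'" for u
    by (simp add: P''_def supp_def rhom_uminus[OF hom'])
  have W'': "u \<in> supp P'' \<longleftrightarrow> u \<in> supp P" if "u \<in> W" for u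
    by (simp add: supp'' \<psi>_W[OF that] c0 h0)
  have \<psi>_v: "\<psi> (var v) = [:0, 1:]" by (simp add: \<psi>_def subst_var \<iota>)
  have new: "(g, var v) \<notin> E"
  proof
    assume "(g, var v) \<in> E"
    then have "var v \<in> W" by (force simp: W_def)
    moreover have "v \<in> (\<Union>m\<in>Poly_Mapping.keys (var v). Poly_Mapping.keys m)" by (simp add: var_def)
    ultimately show False using v by blast
  qed
  have root_old: "poly p r \<in> supp P''" if "(p, r) \<in> E" for p r
  proof -
    have pr: "p \<in> G" "r \<in> W" "h (poly p r) = 0" using rs(2)[OF that] that h0 by (force simp: W_def)+
    have "\<psi> (poly p r) = poly (map_poly (\<lambda>u. [:h u:]) p) [:h r:]"
      using poly_map_poly[OF hom', of p r] by (simp add: map[OF pr(1)] \<psi>_W[OF pr(2)])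
    also have "\<dots> = [:h (poly p r):]" using poly_map_poly[OF rhom_const[OF hom]] by simp
    finally show ?thesis using pr(3) by (simp add: supp'' supp_0[OF P'(1)])
  qed
  have root_new: "poly g (var v) \<in> supp P''"
  proof -
    have "poly (map_poly (\<lambda>u. [:h u:]) p) [:0, 1:] = map_poly h p" for p
      by (induction p) (simp_all add: map_poly_pCons rhom_0[OF hom])
    then have "\<psi> (poly g (var v)) = k * l"
      using poly_map_poly[OF hom', of g "var v"] by (simp add: map[OF assms(5)] \<psi>_v f_def[symmetric] lk(1) mult.commute)
    then show ?thesis using supp_mult[OF P'(1,2)] by (simp add: supp'')
  qed
  have nonzero: "\<exists>i. coeff p i \<notin> supp P''" if "p \<in> G" "map_poly h p \<noteq> 0" for p
  proof -
    have "coeff (map_poly h p) (degree (map_poly h p)) \<noteq> 0" using that(2) by simp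
    then obtain i where "coeff (map_poly h p) i \<noteq> 0" by blast
    then have "h (coeff p i) \<noteq> 0" by (simp add: coeff_map_poly rhom_0[OF hom])
    then show ?thesis using \<psi>_coeff[OF that(1), of i] c0 supp'' by (intro exI[of _ i]) simp
  qed
  \<comment> \<open>If \<open>var v\<close> coincided with \<open>r\<close>, then \<open>k\<close>
    would reduce to its value at \<open>h r\<close>, a nonzero constant in the support. So the new
    root is distinct from all recorded ones.\<close>
  have diff_new: "var v - r \<notin> supp P''" if "r \<in> W" for r
  proof
    assume "var v - r \<in> supp P''"
    then have "[:- h r, 1:] \<in> supp P'" by (simp add: supp'' rhom_diff[OF hom'] \<psi>_v \<psi>_W[OF that])
    then have "[:- h r, 1:] * synthetic_div k (h r) \<in> supp P'" by (rule supp_mult[OF P'(1)])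
    then have "k - [:- h r, 1:] * synthetic_div k (h r) \<in> supp P'" by (rule supp_diff[OF P'(1) P'(2)])
    moreover have "k - [:- h r, 1:] * synthetic_div k (h r) = [:poly k (h r):]"
      using synthetic_div_correct'[of "h r" k] by (metis add_diff_cancel_left')
    ultimately show False using c0 lk(2) by metis
  qed
  have diff_new': "r - var v \<notin> supp P''" if "r \<in> W" for r
    using diff_new[OF that] supp_uminus[OF P'', of "r - var v"] by auto
  have diff_old: "r - r' \<notin> supp P''" if "(p, r) \<in> E" "(p, r') \<in> E" "r \<noteq> r'" for p r r'
  proof -
    have "r \<in> W" "r' \<in> W" using that by (force simp: W_def)+
    then have "\<psi> (r - r') = [:h (r - r'):]" by (simp add: rhom_diff hom hom' \<psi>_W)
    then show ?thesis using rs(3)[OF that] by (simp add: supp'' c0 h0)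
  qed
  have old_nz: "map_poly h p \<noteq> 0" if pr: "(p, r) \<in> E" for p r
  proof -
    obtain i where "coeff p i \<notin> supp P" using rs(2)[OF pr] by blast
    then have "coeff (map_poly h p) i \<noteq> 0" by (simp add: coeff_map_poly rhom_0[OF hom] h0)
    then show ?thesis by auto
  qed
  have EW: "r \<in> W" if "(p, r) \<in> E" for p r using that by (force simp: W_def)
  have "root_set P'' G (insert (g, var v) E)"
    unfolding root_set_def
  proof (intro conjI allI impI)
    show "finite (insert (g, var v) E)" using rs(1) by simp
    show "\<forall>(p, r)\<in>insert (g, var v) E. p \<in> G \<and> poly p r \<in> supp P'' \<and> (\<exists>i. coeff p i \<notin> supp P'')"
    proof (safe, goal_cases)
      case 1 then show ?case by (rule assms(5))
    next
      case 2 then show ?case by (rule root_new)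
    next
      case 3 then show ?case using nonzero[OF assms(5)] f0 by (auto simp: f_def)
    next
      case (4 p r) then show ?case using rs(2) by blast
    next
      case (5 p r) then show ?case by (rule root_old)
    next
      case (6 p r) then show ?case using nonzero[of p] rs(2)[of p r] old_nz[of p r] by blast
    qed
    show "r - r' \<notin> supp P''" if "(p, r) \<in> insert (g, var v) E" "(p, r') \<in> insert (g, var v) E" "r \<noteq> r'" for p r r'
      using that diff_old[of p r r'] diff_new[OF EW[of p r']] diff_new'[OF EW[of p r]] by auto
  qed
  moreover have "q \<in> supp P''" using W''[of q] E by (simp add: W_def)
  ultimately have "card (insert (g, var v) E) \<le> card E" using E P'' by blast
  then show False using new rs(1) by simp
qed

section \<open>The ordered field of a potential counterexample\<close>

text \<open>\<open>cut_vars N q = q\<close> expresses that only the first \<open>N\<close> variables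
  occur in \<open>q\<close>.\<close>

definition counterexample :: "nat rpoly \<times> nat \<Rightarrow> bool" where
  "counterexample = (\<lambda>(q, N). cut_vars N q = q \<and> (\<forall>y. subst (\<lambda>c. c) y q \<noteq> (0::real)) \<and>
    (\<exists>P. is_ordering P \<and> q \<in> supp P))"

text \<open>A type cannot depend on a variable of a proof. Therefore a potential counterexample to the
  real Nullstellensatz is fixed globally; the ordered field built from it yields a contradiction.\<close>

definition cex :: "nat rpoly \<times> nat" where
  "cex = (if \<exists>w. counterexample w then SOME w. counterexample w else (0, 0))"

definition cex_ordering :: "nat rpoly set" where
  "cex_ordering = (SOME P. \<exists>E. max_roots (fst cex) (elim_family (snd cex) {fst cex}) P E)"

text \<open>The quotient type must be available unconditionally. Without a counterexample
  \<open>cex\<close> is \<open>(0, 0)\<close>, and the nonnegative reals pulled back along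
  evaluation at the origin form an ordering, with \<open>0\<close> in its support.\<close>

lemma cex_ordering:
  "\<exists>E. max_roots (fst cex) (elim_family (snd cex) {fst cex}) cex_ordering E"
proof -
  have "\<exists>P. is_ordering P \<and> fst cex \<in> supp P"
  proof (cases "\<exists>w. counterexample w")
    case True
    then have "counterexample cex" by (simp add: cex_def someI_ex)
    then show ?thesis by (simp add: counterexample_def split_beta)
  next
    case False
    have id: "rhom (\<lambda>c::real. c)" by (simp add: rhom_def)
    have "is_preorder {c :: real. 0 \<le> c}" by (simp add: is_preorder_def)
    moreover have "c \<in> {c. 0 \<le> c} \<or> - c \<in> {c. 0 \<le> c}" for c :: real by auto
    moreover have "c \<in> supp {c :: real. 0 \<le> c} \<longleftrightarrow> c = 0" for c by (auto simp: supp_def)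
    ultimately have "is_ordering {c :: real. 0 \<le> c}" unfolding is_ordering_def by simp
    then have P: "is_ordering (subst (\<lambda>c. c) (\<lambda>_. 0 :: real) -` {c. 0 \<le> c} :: nat rpoly set)"
      by (rule is_ordering_vimage[OF _ rhom_subst[OF id]])
    show ?thesis using P supp_0[OF P] False by (auto simp: cex_def)
  qed
  then have "\<exists>P E. max_roots (fst cex) (elim_family (snd cex) {fst cex}) P E"
    using ex_max_roots finite_elim_family by (metis finite.intros)
  then show ?thesis unfolding cex_ordering_def by (rule someI_ex)
qed

lemma is_ordering_cex: "is_ordering cex_ordering"
  using cex_ordering by (auto simp: max_roots_def)

lemmas cex_supp = supp_ideal[OF is_ordering_cex]

lemma
  shows cex_add: "a \<in> cex_ordering \<Longrightarrow> b \<in> cex_ordering \<Longrightarrow> a + b \<in> cex_ordering"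
    and cex_mult: "a \<in> cex_ordering \<Longrightarrow> b \<in> cex_ordering \<Longrightarrow> a * b \<in> cex_ordering"
    and cex_total: "a \<in> cex_ordering \<or> - a \<in> cex_ordering"
    and cex_prime: "a * b \<in> supp cex_ordering \<Longrightarrow> a \<in> supp cex_ordering \<or> b \<in> supp cex_ordering"
  using is_ordering_cex unfolding is_ordering_def is_preorder_def by blast+

\<comment> \<open>Primality of the support makes this residue ring a domain, and
  \<open>cex_ordering\<close> orders it; its type \<open>fract\<close> is the ordered field in which
  \<open>q\<close> has a zero.\<close>
quotient_type cex_ring = "nat rpoly" / "\<lambda>a b. a - b \<in> supp cex_ordering"
  morphisms rep_cex to_cex
proof (rule equivpI)
  show "reflp (\<lambda>a b. a - b \<in> supp cex_ordering)" using cex_supp(1) by (auto intro: reflpI)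
  show "symp (\<lambda>a b. a - b \<in> supp cex_ordering)"
  proof (rule sympI)
    show "b - a \<in> supp cex_ordering" if "a - b \<in> supp cex_ordering" for a b
      using cex_supp(4)[OF that] by simp
  qed
  show "transp (\<lambda>a b. a - b \<in> supp cex_ordering)"
  proof (rule transpI)
    show "a - c \<in> supp cex_ordering" if "a - b \<in> supp cex_ordering" "b - c \<in> supp cex_ordering" for a b c
      using cex_supp(2)[OF that] by simp
  qed
qed

instantiation cex_ring :: comm_ring_1
begin

lift_definition zero_cex_ring :: cex_ring is 0 .
lift_definition one_cex_ring :: cex_ring is 1 .

lift_definition plus_cex_ring :: "cex_ring \<Rightarrow> cex_ring \<Rightarrow> cex_ring" is "(+)"
proof -
  fix a b c d :: "nat rpoly" assume "a - b \<in> supp cex_ordering" "c - d \<in> supp cex_ordering"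
  then have "(a - b) + (c - d) \<in> supp cex_ordering" by (rule cex_supp(2))
  then show "a + c - (b + d) \<in> supp cex_ordering" by (simp add: algebra_simps)
qed

lift_definition uminus_cex_ring :: "cex_ring \<Rightarrow> cex_ring" is uminus
proof -
  fix a b :: "nat rpoly" assume "a - b \<in> supp cex_ordering"
  then have "- (a - b) \<in> supp cex_ordering" by (rule cex_supp(4))
  then show "- a - - b \<in> supp cex_ordering" by (simp add: algebra_simps)
qed

lift_definition minus_cex_ring :: "cex_ring \<Rightarrow> cex_ring \<Rightarrow> cex_ring" is "(-)"
proof -
  fix a b c d :: "nat rpoly" assume "a - b \<in> supp cex_ordering" "c - d \<in> supp cex_ordering"
  then have "(a - b) - (c - d) \<in> supp cex_ordering" by (rule cex_supp(5))
  then show "a - c - (b - d) \<in> supp cex_ordering" by (simp add: algebra_simps)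
qed

lift_definition times_cex_ring :: "cex_ring \<Rightarrow> cex_ring \<Rightarrow> cex_ring" is "(*)"
proof -
  fix a b c d :: "nat rpoly" assume "a - b \<in> supp cex_ordering" "c - d \<in> supp cex_ordering"
  then have "(a - b) * c + (c - d) * b \<in> supp cex_ordering" by (intro cex_supp(2,3))
  then show "a * c - b * d \<in> supp cex_ordering" by (simp add: algebra_simps)
qed

instance
proof
  fix a b c :: cex_ring
  show "a * b * c = a * (b * c)" by transfer (simp add: mult.assoc cex_supp(1))
  show "a * b = b * a" by transfer (simp add: mult.commute cex_supp(1))
  show "1 * a = a" by transfer (simp add: cex_supp(1))
  show "a + b + c = a + (b + c)" by transfer (simp add: add.assoc cex_supp(1))
  show "a + b = b + a" by transfer (simp add: add.commute cex_supp(1))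
  show "0 + a = a" by transfer (simp add: cex_supp(1))
  show "- a + a = 0" by transfer (simp add: cex_supp(1))
  show "a - b = a + - b" by transfer (simp add: cex_supp(1))
  show "(a + b) * c = a * c + b * c" by transfer (simp add: distrib_right cex_supp(1))
  show "(0 :: cex_ring) \<noteq> 1"
    using cex_supp(6) cex_supp(4)[of "- 1"] by transfer auto
qed

end

instantiation cex_ring :: linordered_idom
begin

lift_definition less_eq_cex_ring :: "cex_ring \<Rightarrow> cex_ring \<Rightarrow> bool" is "\<lambda>a b. b - a \<in> cex_ordering"
proof -
  have *: "d - c \<in> cex_ordering"
    if "a - c \<in> supp cex_ordering" "b - d \<in> supp cex_ordering" "b - a \<in> cex_ordering" for a b c d
  proof -
    have "(b - a) + ((a - c) + - (b - d)) \<in> cex_ordering"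
      using that by (intro cex_add) (auto simp: supp_def)
    then show ?thesis by (simp add: algebra_simps)
  qed
  fix a b c d :: "nat rpoly" assume ac: "a - b \<in> supp cex_ordering" "c - d \<in> supp cex_ordering"
  then have "b - a \<in> supp cex_ordering" "d - c \<in> supp cex_ordering"
    using cex_supp(4)[of "a - b"] cex_supp(4)[of "c - d"] by simp_all
  then show "(c - a \<in> cex_ordering) = (d - b \<in> cex_ordering)" using * ac by blast
qed

definition less_cex_ring :: "cex_ring \<Rightarrow> cex_ring \<Rightarrow> bool" where
  "less_cex_ring a b \<longleftrightarrow> a \<le> b \<and> \<not> b \<le> a"

definition abs_cex_ring :: "cex_ring \<Rightarrow> cex_ring" where "abs_cex_ring a = (if a < 0 then - a else a)"

definition sgn_cex_ring :: "cex_ring \<Rightarrow> cex_ring" where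
  "sgn_cex_ring a = (if a = 0 then 0 else if 0 < a then 1 else - 1)"

instance
proof
  have mult_nonneg: "0 \<le> a * b" if "0 \<le> a" "0 \<le> b" for a b :: cex_ring
    using that by transfer (simp add: cex_mult)
  have antisym: "a = b" if "a \<le> b" "b \<le> a" for a b :: cex_ring
    using that by transfer (simp add: supp_def)
  have eq_0: "a = 0 \<or> b = 0" if "a * b = 0" for a b :: cex_ring
    using that by transfer (simp add: cex_prime)
  have diff: "a \<le> b \<longleftrightarrow> 0 \<le> b - a" for a b :: cex_ring by transfer simp
  fix a b c :: cex_ring
  show "a < b \<longleftrightarrow> a \<le> b \<and> \<not> b \<le> a" by (simp add: less_cex_ring_def)
  show "a \<le> a" using cex_supp(1) by transfer (simp add: supp_def)
  show "a \<le> c" if "a \<le> b" "b \<le> c" using that by transfer (drule (1) cex_add, simp)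
  show "a = b" if "a \<le> b" "b \<le> a" using that by (rule antisym)
  show "a \<le> b \<or> b \<le> a" by transfer (metis cex_total minus_diff_eq)
  show "c + a \<le> c + b" if "a \<le> b" using that by transfer simp
  show "\<bar>a\<bar> = (if a < 0 then - a else a)" by (rule abs_cex_ring_def)
  show "sgn a = (if a = 0 then 0 else if 0 < a then 1 else - 1)" by (rule sgn_cex_ring_def)
  show "c * a < c * b" if "a < b" "0 < c"
  proof -
    have "c * a \<le> c * b"
      using that diff[of a b] diff[of "c * a" "c * b"] mult_nonneg[of c "b - a"]
      by (simp add: less_cex_ring_def right_diff_distrib)
    moreover have "c * a \<noteq> c * b"
    proof
      assume "c * a = c * b"
      then have "c * (b - a) = 0" by (simp add: right_diff_distrib)
      then have "c = 0 \<or> b = a" using eq_0 by fastforce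
      then show False using that by (auto simp: less_cex_ring_def)
    qed
    ultimately show ?thesis using antisym by (auto simp: less_cex_ring_def)
  qed
qed

end

definition cex_hom :: "nat rpoly \<Rightarrow> cex_ring fract" where
  "cex_hom u = Fract (to_cex u) 1"

lemma rhom_cex_hom: "rhom cex_hom"
  unfolding cex_hom_def
  by (intro rhomI) (simp_all add: plus_cex_ring.abs_eq[symmetric] times_cex_ring.abs_eq[symmetric]
    one_cex_ring.abs_eq[symmetric] One_fract_def)

lemma cex_hom_nonneg: "0 \<le> cex_hom u \<longleftrightarrow> u \<in> cex_ordering"
proof -
  have "0 \<le> cex_hom u \<longleftrightarrow> 0 \<le> to_cex u"
    by (simp add: cex_hom_def zero_le_Fract_iff)
  also have "\<dots> \<longleftrightarrow> u \<in> cex_ordering"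
    by (simp add: zero_cex_ring_def less_eq_cex_ring.abs_eq)
  finally show ?thesis .
qed

text \<open>The images of the variables form a zero of \<open>q\<close> in the ordered field.
  Maximality of the roots gives the intermediate value property that \<open>sign_transfer\<close>
  requires, and the sign \<open>0\<close> arrives at a real point.\<close>

lemma no_counterexample: "\<not> counterexample w"
proof
  assume "counterexample w"
  then have "counterexample cex" unfolding cex_def by (metis someI_ex)
  then obtain q N where cex: "cex = (q, N)" and q: "cut_vars N q = q" "\<And>y. subst (\<lambda>c. c) y q \<noteq> (0::real)"
    unfolding counterexample_def by (cases cex) auto
  define \<iota> where "\<iota> c = cex_hom (const_poly c)" for c
  define x where "x i = cex_hom (var i)" for i
  have \<iota>: "rhom \<iota>" unfolding \<iota>_def by (rule rhom_comp[OF rhom_cex_hom rhom_const_poly])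
  have hom: "subst \<iota> x u = cex_hom u" for u
    by (rule rhom_rpoly_eq[OF rhom_subst[OF \<iota>] rhom_cex_hom])
      (simp_all add: subst_const[OF \<iota>] subst_var[OF \<iota>] \<iota>_def x_def)
  then have hom': "subst \<iota> x = cex_hom" by blast
  obtain E where E: "max_roots q (elim_family N {q}) cex_ordering E"
    using cex_ordering by (auto simp: cex)
  have "\<exists>y :: nat \<Rightarrow> real. \<forall>u\<in>{q}. sg (subst \<iota> (\<lambda>i. if i < N then x i else 0) u) = sg (subst (\<lambda>c. c) y u)"
  proof (rule sign_transfer[OF \<iota>])
    show "ivt (map_poly (subst \<iota> x) g)" if "g \<in> elim_family N {q}" for g
      unfolding hom' using max_roots_ivt[OF E _ rhom_cex_hom cex_hom_nonneg that] finite_elim_family by blast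
  qed simp
  then obtain y where "sg (subst \<iota> (\<lambda>i. if i < N then x i else 0) q) = sg (subst (\<lambda>c. c) y q)" by auto
  moreover have "subst \<iota> (\<lambda>i. if i < N then x i else 0) q = cex_hom q"
    by (metis \<iota> hom q(1) subst_cut_vars)
  moreover have "q \<in> cex_ordering" "- q \<in> cex_ordering" using E by (auto simp: max_roots_def supp_def)
  then have "cex_hom q = 0"
    using cex_hom_nonneg[of q] cex_hom_nonneg[of "- q"] by (simp add: rhom_uminus[OF rhom_cex_hom])
  ultimately have "subst (\<lambda>c. c) y q = 0" by (metis sg_0_iff)
  then show False using q(2) by blast
qed

section \<open>Sums of squares and the certificate for \<open>- 1\<close>\<close>

lemma sums_of_squares_0: "0 \<in> sums_of_squares"
  unfolding sums_of_squares_def by (auto intro!: exI[of _ "0::nat"])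

lemma sums_of_squares_add_square:
  assumes "s \<in> sums_of_squares"
  shows "s + a\<^sup>2 \<in> sums_of_squares"
proof -
  obtain m g where "s = (\<Sum>k<(m::nat). (g k)\<^sup>2)" using assms unfolding sums_of_squares_def by blast
  then have "s + a\<^sup>2 = (\<Sum>k<Suc m. ((g(m := a)) k)\<^sup>2)" by simp
  then show ?thesis unfolding sums_of_squares_def by blast
qed

lemma sums_of_squares_induct [consumes 1, case_names zero step]:
  assumes "s \<in> sums_of_squares" "P 0"
    "\<And>s a. s \<in> sums_of_squares \<Longrightarrow> P s \<Longrightarrow> P (s + a\<^sup>2)"
  shows "P s"
proof -
  obtain m g where "s = (\<Sum>k<(m::nat). (g k)\<^sup>2)" using assms(1) unfolding sums_of_squares_def by blast
  moreover have "(\<Sum>k<j. (g k)\<^sup>2) \<in> sums_of_squares \<and> P (\<Sum>k<j. (g k)\<^sup>2)" for j :: nat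
    by (induction j) (auto intro: assms sums_of_squares_0 sums_of_squares_add_square)
  ultimately show ?thesis by blast
qed

lemma sums_of_squares_add:
  assumes "s \<in> sums_of_squares" "t \<in> sums_of_squares"
  shows "s + t \<in> sums_of_squares"
  using assms(2)
  by (induction t rule: sums_of_squares_induct)
    (use assms(1) in \<open>auto simp: add.assoc[symmetric] intro: sums_of_squares_add_square\<close>)

lemma sums_of_squares_square: "a\<^sup>2 \<in> sums_of_squares"
  using sums_of_squares_add_square[OF sums_of_squares_0] by simp

lemma sums_of_squares_sum: "(\<And>a. a \<in> A \<Longrightarrow> F a \<in> sums_of_squares) \<Longrightarrow> sum F A \<in> sums_of_squares"
  by (induction A rule: infinite_finite_induct) (auto intro: sums_of_squares_0 sums_of_squares_add)

lemma sums_of_squares_mult: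
  assumes "s \<in> sums_of_squares" "t \<in> sums_of_squares"
  shows "s * t \<in> sums_of_squares"
  using assms(2)
proof (induction t rule: sums_of_squares_induct)
  case (step t a)
  have "s * a\<^sup>2 \<in> sums_of_squares"
    using assms(1)
  proof (induction s rule: sums_of_squares_induct)
    case (step s b)
    have "(s + b\<^sup>2) * a\<^sup>2 = s * a\<^sup>2 + (b * a)\<^sup>2" by (simp add: distrib_right power_mult_distrib)
    then show ?case using step by (metis sums_of_squares_add_square)
  qed (simp add: sums_of_squares_0)
  then show ?case using step by (simp add: distrib_left sums_of_squares_add)
qed (simp add: sums_of_squares_0)

lemma rhom_sums_of_squares:
  assumes "rhom h" "s \<in> sums_of_squares"
  shows "h s \<in> sums_of_squares"
  using assms(2)
  by (induction s rule: sums_of_squares_induct)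
    (simp_all add: rhom_simps rhom_power assms(1) sums_of_squares_0 sums_of_squares_add_square)

lemma eval_eq_subst: "eval p x = subst (\<lambda>c. c) (\<lambda>i. x $ i) p"
proof -
  have "monom_value (\<lambda>i. x $ i) m = (\<Prod>i\<in>UNIV. (x $ i) ^ Poly_Mapping.lookup m i)" for m
    by (rule monom_value_superset) auto
  then show ?thesis by (simp add: eval_def subst_def)
qed

lemma rhom_eval: "rhom (\<lambda>p. eval p x)" and eval_var: "eval (var i) x = x $ i"
proof -
  have id: "rhom (\<lambda>c::real. c)" by (simp add: rhom_def)
  show "rhom (\<lambda>p. eval p x)" unfolding eval_eq_subst by (rule rhom_subst[OF id])
  show "eval (var i) x = x $ i" unfolding eval_eq_subst by (rule subst_var[OF id])
qed

lemmas eval_simps = rhom_simps[OF rhom_eval] rhom_power[OF rhom_eval] eval_var eval_const_poly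

text \<open>Without a certificate the sums of squares plus multiples of \<open>q\<close> form a
  preordering; an ordering above it has \<open>q\<close> in its support and makes \<open>q\<close> a
  counterexample.\<close>

lemma real_nullstellensatz:
  fixes q :: "('n::finite) rpoly"
  assumes "\<And>x. eval q x \<noteq> 0"
  shows "\<exists>s\<in>sums_of_squares. \<exists>k. - 1 = s + q * k"
proof -
  define N where "N = CARD('n)"
  obtain e :: "'n \<Rightarrow> nat" where e: "bij_betw e UNIV {0..<N}"
    using ex_bij_betw_finite_nat[OF finite[of UNIV]] unfolding N_def by blast
  have eN: "e i < N" for i using e by (auto simp: bij_betw_def)
  have inj: "inj e" using e by (simp add: bij_betw_def)
  \<comment> \<open>The variables are renamed to the numbers below \<open>N\<close>. Values of
    \<open>inv e\<close> outside the range of \<open>e\<close> are harmless, as only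
    \<open>\<pi>\<close> after \<open>\<rho>\<close> has to be the identity.\<close>
  define \<rho> where "\<rho> = subst const_poly (\<lambda>i. var (e i))"
  define \<pi> where "\<pi> = (subst const_poly (\<lambda>j. var (inv e j)) :: nat rpoly \<Rightarrow> 'n rpoly)"
  have hom: "rhom \<rho>" "rhom \<pi>" unfolding \<rho>_def \<pi>_def by (rule rhom_subst[OF rhom_const_poly])+
  have id: "rhom (\<lambda>c::real. c)" by (simp add: rhom_def)
  have id': "rhom (\<lambda>p :: 'n rpoly. p)" by (simp add: rhom_def)
  have "\<pi> (\<rho> p) = p" for p
    by (rule rhom_rpoly_eq[OF rhom_comp[OF hom(2,1)] id'])
      (simp_all add: \<rho>_def \<pi>_def subst_const subst_var rhom_const_poly inj)
  note \<pi>_\<rho> = this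
  have "cut_vars N (\<rho> q) = \<rho> q"
    by (rule rhom_rpoly_eq[OF rhom_comp[OF rhom_cut_vars hom(1)] hom(1)])
      (simp_all add: cut_vars_def \<rho>_def subst_const subst_var rhom_const_poly eN)
  moreover have "subst (\<lambda>c. c) y (\<rho> q) \<noteq> (0::real)" for y
  proof -
    have "subst (\<lambda>c. c) y (\<rho> q) = eval q (\<chi> i. y (e i))"
      by (rule rhom_rpoly_eq[OF rhom_comp[OF rhom_subst[OF id] hom(1)] rhom_eval])
        (simp_all add: \<rho>_def subst_const subst_var rhom_const_poly id eval_simps)
    then show ?thesis using assms by simp
  qed
  ultimately have no: "\<not> (\<exists>P. is_ordering P \<and> \<rho> q \<in> supp P)"
    using no_counterexample[of "(\<rho> q, N)"] by (simp add: counterexample_def)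
  define T where "T = {s + \<rho> q * k | s k. s \<in> sums_of_squares}"
  have sub: "s \<in> T" if "s \<in> sums_of_squares" for s
  proof -
    have "s = s + \<rho> q * 0" by simp
    then show ?thesis using that unfolding T_def by blast
  qed
  have "- 1 \<in> T"
  proof (rule ccontr)
    assume "- 1 \<notin> T"
    have "is_preorder T"
      unfolding is_preorder_def
    proof (intro conjI ballI allI)
      fix x y assume "x \<in> T" "y \<in> T"
      then obtain s k t l where xy: "x = s + \<rho> q * k" "y = t + \<rho> q * l"
        and st: "s \<in> sums_of_squares" "t \<in> sums_of_squares"
        unfolding T_def by blast
      have "x + y = (s + t) + \<rho> q * (k + l)" "x * y = s * t + \<rho> q * (s * l + k * t + \<rho> q * k * l)"
        by (simp_all add: xy algebra_simps)
      then show "x + y \<in> T" "x * y \<in> T"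
        unfolding T_def using sums_of_squares_add[OF st] sums_of_squares_mult[OF st] by blast+
    next
      show "x * x \<in> T" for x using sub[OF sums_of_squares_square[of x]] by (simp add: power2_eq_square)
      show "- 1 \<notin> T" by fact
    qed
    then obtain P where P: "is_ordering P" "T \<subseteq> P" using ex_ordering by blast
    have "\<rho> q = 0 + \<rho> q * 1" "- \<rho> q = 0 + \<rho> q * (- 1)" by simp_all
    then have "\<rho> q \<in> T" "- \<rho> q \<in> T" unfolding T_def using sums_of_squares_0 by blast+
    then show False using P no by (auto simp: supp_def)
  qed
  then obtain s k where sk: "s \<in> sums_of_squares" "- 1 = s + \<rho> q * k" unfolding T_def by blast
  have "\<pi> (- 1) = \<pi> s + q * \<pi> k"
    using arg_cong[OF sk(2), of \<pi>] by (simp add: rhom_simps[OF hom(2)] \<pi>_\<rho>)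
  then have "- 1 = \<pi> s + q * \<pi> k" by (simp add: rhom_simps[OF hom(2)])
  then show ?thesis using rhom_sums_of_squares[OF hom(2) sk(1)] by blast
qed

section \<open>Critical points of Morse polynomials\<close>

text \<open>The coefficients may vary with \<open>p\<close>, but all members lie in one
  finite-dimensional space; this will bound the number of critical points.\<close>

definition bounded_keys :: "('p \<Rightarrow> 'n rpoly) \<Rightarrow> bool" where
  "bounded_keys F \<longleftrightarrow> finite (\<Union>p. Poly_Mapping.keys (F p))"

lemma bounded_keys_subset: "finite M \<Longrightarrow> (\<And>p. Poly_Mapping.keys (F p) \<subseteq> M) \<Longrightarrow> bounded_keys F"
  unfolding bounded_keys_def by (rule finite_subset[of _ M]) auto

lemma bounded_keys_fixed: "bounded_keys (\<lambda>_. h)"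
  by (rule bounded_keys_subset[of "Poly_Mapping.keys h"]) auto

lemma bounded_keys_const_poly: "bounded_keys (\<lambda>p. const_poly (c p))"
  by (rule bounded_keys_subset[of "{0}"]) (auto simp: const_poly_def)

lemma bounded_keys_add:
  assumes "bounded_keys F" "bounded_keys G"
  shows "bounded_keys (\<lambda>p. F p + G p)"
  by (rule bounded_keys_subset[of "(\<Union>p. Poly_Mapping.keys (F p)) \<union> (\<Union>p. Poly_Mapping.keys (G p))"])
    (use assms keys_add in \<open>fastforce simp: bounded_keys_def\<close>)+

lemma bounded_keys_mult:
  assumes "bounded_keys F" "bounded_keys G"
  shows "bounded_keys (\<lambda>p. F p * G p)"
proof (rule bounded_keys_subset)
  let ?M = "(\<lambda>(a, b). a + b) ` ((\<Union>p. Poly_Mapping.keys (F p)) \<times> (\<Union>p. Poly_Mapping.keys (G p)))"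
  show "finite ?M" using assms by (simp add: bounded_keys_def)
  show "Poly_Mapping.keys (F p * G p) \<subseteq> ?M" for p
    using keys_mult[of "F p" "G p"] by force
qed

lemma bounded_keys_sum: "(\<And>a. a \<in> A \<Longrightarrow> bounded_keys (F a)) \<Longrightarrow> bounded_keys (\<lambda>p. \<Sum>a\<in>A. F a p)"
  by (induction A rule: infinite_finite_induct) (simp_all add: bounded_keys_add bounded_keys_fixed)

lemma bounded_keys_prod: "(\<And>a. a \<in> A \<Longrightarrow> bounded_keys (F a)) \<Longrightarrow> bounded_keys (\<lambda>p. \<Prod>a\<in>A. F a p)"
  by (induction A rule: infinite_finite_induct) (simp_all add: bounded_keys_mult bounded_keys_fixed)

text \<open>Hadamard's lemma. The coefficients \<open>D p i\<close> are chosen as a function of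
  \<open>p\<close> whose monomials are bounded uniformly in \<open>p\<close>.\<close>

lemma taylor_bounded:
  fixes h :: "('n::finite) rpoly"
  shows "\<exists>D :: real ^ 'n \<Rightarrow> 'n \<Rightarrow> 'n rpoly. (\<forall>i. bounded_keys (\<lambda>p. D p i)) \<and>
    (\<forall>p. h - const_poly (eval h p) = (\<Sum>i\<in>UNIV. D p i * (var i - const_poly (p $ i))))"
proof (induction h rule: rpoly_induct)
  case (const c)
  show ?case by (intro exI[of _ "\<lambda>_ _. 0"]) (simp add: eval_simps bounded_keys_fixed)
next
  case (var v)
  show ?case
    by (intro exI[of _ "\<lambda>_ i. if i = v then 1 else 0"])
      (simp add: eval_var bounded_keys_fixed mult_delta_left)
next
  case (add h h')
  obtain D where D: "\<And>i. bounded_keys (\<lambda>p. D p i)"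
    "\<And>p. h - const_poly (eval h p) = (\<Sum>i\<in>UNIV. D p i * (var i - const_poly (p $ i)))"
    using add.IH(1) by blast
  obtain D' where D': "\<And>i. bounded_keys (\<lambda>p. D' p i)"
    "\<And>p. h' - const_poly (eval h' p) = (\<Sum>i\<in>UNIV. D' p i * (var i - const_poly (p $ i)))"
    using add.IH(2) by blast
  have "h + h' - const_poly (eval (h + h') p) = (\<Sum>i\<in>UNIV. (D p i + D' p i) * (var i - const_poly (p $ i)))" for p
  proof -
    have "h + h' - const_poly (eval (h + h') p) = (h - const_poly (eval h p)) + (h' - const_poly (eval h' p))"
      by (simp add: eval_simps rhom_add[OF rhom_const_poly])
    then show ?thesis unfolding D(2) D'(2) by (simp add: distrib_right sum.distrib)
  qed
  then show ?case using D(1) D'(1) by (intro exI[of _ "\<lambda>p i. D p i + D' p i"]) (simp add: bounded_keys_add)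
next
  case (mult h h')
  obtain D where D: "\<And>i. bounded_keys (\<lambda>p. D p i)"
    "\<And>p. h - const_poly (eval h p) = (\<Sum>i\<in>UNIV. D p i * (var i - const_poly (p $ i)))"
    using mult.IH(1) by blast
  obtain D' where D': "\<And>i. bounded_keys (\<lambda>p. D' p i)"
    "\<And>p. h' - const_poly (eval h' p) = (\<Sum>i\<in>UNIV. D' p i * (var i - const_poly (p $ i)))"
    using mult.IH(2) by blast
  \<comment> \<open>As in the product rule, the increment of \<open>h * h'\<close> is
    \<open>h\<close> times the increment of \<open>h'\<close> plus the value of \<open>h'\<close>
    times the increment of \<open>h\<close>.\<close>
  let ?D = "\<lambda>p i. h * D' p i + const_poly (eval h' p) * D p i"
  have "bounded_keys (\<lambda>p. ?D p i)" for i
    by (intro bounded_keys_add bounded_keys_mult bounded_keys_fixed bounded_keys_const_poly D(1) D'(1))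
  moreover have "h * h' - const_poly (eval (h * h') p) = (\<Sum>i\<in>UNIV. ?D p i * (var i - const_poly (p $ i)))" for p
  proof -
    have "h * h' - const_poly (eval (h * h') p) =
        h * (h' - const_poly (eval h' p)) + const_poly (eval h' p) * (h - const_poly (eval h p))"
      by (simp add: eval_simps rhom_mult[OF rhom_const_poly] algebra_simps)
    also have "\<dots> = (\<Sum>i\<in>UNIV. ?D p i * (var i - const_poly (p $ i)))"
      unfolding D(2) D'(2) by (simp add: sum_distrib_left sum.distrib distrib_right mult.assoc)
    finally show ?thesis .
  qed
  ultimately show ?case by (intro exI[of _ ?D]) simp
qed

text \<open>Differentiating the expansion at \<open>p\<close> leaves only the values of
  \<open>D\<close>: terms with derivatives of \<open>D\<close> carry a factor that vanishes at
  \<open>p\<close>.\<close>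

lemma taylor_coeff_eval:
  fixes h :: "('n::finite) rpoly"
  assumes "h - const_poly (eval h p) = (\<Sum>i\<in>UNIV. D i * (var i - const_poly (p $ i)))"
  shows "eval (D i) p = eval (partial i h) p"
proof -
  have h: "eval h = (\<lambda>x. eval h p + (\<Sum>i\<in>UNIV. eval (D i) x * (x $ i - p $ i)))"
  proof
    fix x
    have "eval (h - const_poly (eval h p)) x = (\<Sum>i\<in>UNIV. eval (D i) x * (x $ i - p $ i))"
      unfolding assms by (simp add: eval_sum eval_simps)
    then show "eval h x = eval h p + (\<Sum>i\<in>UNIV. eval (D i) x * (x $ i - p $ i))" by (simp add: eval_simps)
  qed
  have comp: "((\<lambda>x. x $ j - p $ j) has_derivative (\<lambda>v. v $ j)) (at p)" for j
    by (rule derivative_eq_intros bounded_linear.has_derivative[OF bounded_linear_vec_nth] refl)+ simp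
  have "((\<lambda>x. eval h p + (\<Sum>j\<in>UNIV. eval (D j) x * (x $ j - p $ j))) has_derivative
      (\<lambda>v. 0 + (\<Sum>j\<in>UNIV. eval (D j) p * v $ j + (\<Sum>k\<in>UNIV. v $ k * eval (partial k (D j)) p) * (p $ j - p $ j)))) (at p)"
    by (intro has_derivative_add has_derivative_const has_derivative_sum has_derivative_mult has_derivative_eval comp)
  then have "(eval h has_derivative (\<lambda>v. \<Sum>j\<in>UNIV. eval (D j) p * v $ j)) (at p)"
    unfolding h[symmetric] by simp
  then have "(\<lambda>v. \<Sum>j\<in>UNIV. eval (D j) p * v $ j) = (\<lambda>v. \<Sum>j\<in>UNIV. v $ j * eval (partial j h) p)"
    using has_derivative_eval by (rule has_derivative_unique)
  from fun_cong[OF this, of "axis i 1"] show ?thesis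
    by (simp add: axis_def mult_delta_left mult_delta_right)
qed

text \<open>Cramer's rule without division. It puts \<open>x k * det A\<close> into every ideal that
  contains the entries of the row combination.\<close>

lemma cramer_row:
  fixes A :: "'a::comm_ring_1 ^ 'n ^ 'n"
  shows "det (\<chi> i. if i = k then (\<Sum>j\<in>UNIV. x j *s A $ j) else A $ i) = x k * det A"
proof -
  have "det (\<chi> i. if i = k then A $ j else A $ i) = (if j = k then det A else 0)" for j
  proof (cases "j = k")
    case True
    then have "(\<chi> i. if i = k then A $ j else A $ i) = A" by (simp add: vec_eq_iff)
    then show ?thesis using True by simp
  next
    case False
    then show ?thesis
      by (simp, intro det_identical_rows[of k j]) (auto simp: row_def vec_eq_iff)
  qed
  then show ?thesis
    by (subst det_linear_row_sum) (simp_all add: det_row_mul[where b = "\<lambda>i. A $ i"] if_distrib[where f = "\<lambda>y. _ * y"] cong: if_cong)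
qed

lemma
  fixes f :: "('n::finite) rpoly"
  shows gradient_ideal_add: "a \<in> gradient_ideal f \<Longrightarrow> b \<in> gradient_ideal f \<Longrightarrow> a + b \<in> gradient_ideal f"
    and gradient_ideal_diff: "a \<in> gradient_ideal f \<Longrightarrow> b \<in> gradient_ideal f \<Longrightarrow> a - b \<in> gradient_ideal f"
    and gradient_ideal_mult: "a \<in> gradient_ideal f \<Longrightarrow> c * a \<in> gradient_ideal f"
    and gradient_ideal_sum: "(\<And>x. x \<in> X \<Longrightarrow> F x \<in> gradient_ideal f) \<Longrightarrow> sum F X \<in> gradient_ideal f"
    and gradient_ideal_partial: "partial i f \<in> gradient_ideal f"
    and gradient_ideal_0: "0 \<in> gradient_ideal f"
proof -
  interpret M: module "(*) :: 'n rpoly \<Rightarrow> 'n rpoly \<Rightarrow> 'n rpoly" by (rule module_mult)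
  show "a \<in> gradient_ideal f \<Longrightarrow> b \<in> gradient_ideal f \<Longrightarrow> a + b \<in> gradient_ideal f"
    "a \<in> gradient_ideal f \<Longrightarrow> b \<in> gradient_ideal f \<Longrightarrow> a - b \<in> gradient_ideal f"
    "a \<in> gradient_ideal f \<Longrightarrow> c * a \<in> gradient_ideal f"
    "(\<And>x. x \<in> X \<Longrightarrow> F x \<in> gradient_ideal f) \<Longrightarrow> sum F X \<in> gradient_ideal f"
    "partial i f \<in> gradient_ideal f" "0 \<in> gradient_ideal f"
    unfolding gradient_ideal_def
    by (auto intro: M.span_add M.span_diff M.span_scale M.span_sum M.span_base M.span_zero)
qed

lemma gradient_ideal_eval:
  assumes "a \<in> gradient_ideal f" "critical_point f p"
  shows "eval a p = 0"
  using assms unfolding gradient_ideal_explicit critical_point_def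
  by (auto simp: eval_sum eval_simps)

lemma det_row_in_ideal:
  fixes A :: "('n::finite) rpoly ^ 'n ^ 'n"
  assumes "\<And>j. A $ k $ j \<in> gradient_ideal f"
  shows "det A \<in> gradient_ideal f"
  unfolding det_def
proof (intro gradient_ideal_sum gradient_ideal_mult)
  fix \<sigma>
  have "(\<Prod>i\<in>UNIV. A $ i $ \<sigma> i) = (\<Prod>i\<in>UNIV - {k}. A $ i $ \<sigma> i) * A $ k $ \<sigma> k"
    by (subst prod.remove[of _ k]) (simp_all add: mult.commute)
  then show "(\<Prod>i\<in>UNIV. A $ i $ \<sigma> i) \<in> gradient_ideal f"
    using assms by (simp add: gradient_ideal_mult)
qed

lemma eval_det: "eval (det A) x = det (\<chi> i j. eval (A $ i $ j) x)"
proof -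
  have "eval (of_int z) x = of_int z" for z :: int
    by (cases z) (simp_all add: eval_simps rhom_of_nat[OF rhom_eval] del: of_nat_Suc)
  moreover have "eval (prod F X) x = (\<Prod>a\<in>X. eval (F a) x)" for F :: "'b \<Rightarrow> 'a rpoly" and X
    by (induction X rule: infinite_finite_induct) (simp_all add: eval_simps)
  ultimately show ?thesis by (simp add: det_def eval_sum eval_simps)
qed

text \<open>Near a nondegenerate critical point \<open>p\<close> the ring modulo the gradient ideal is just \<open>\<real>\<close>:
  the determinant of the divided differences of the gradient is, up to scaling, the corresponding idempotent.\<close>

lemma critical_idempotents:
  fixes f :: "('n::finite) rpoly"
  assumes "morse f"
  shows "\<exists>c. bounded_keys c \<and> (\<forall>p. critical_point f p \<longrightarrow> eval (c p) p = 1 \<and>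
    (\<forall>h. c p * h - const_poly (eval h p) * c p \<in> gradient_ideal f))"
proof -
  have "\<forall>j. \<exists>D :: real ^ 'n \<Rightarrow> 'n \<Rightarrow> 'n rpoly. (\<forall>i. bounded_keys (\<lambda>p. D p i)) \<and>
    (\<forall>p. partial j f - const_poly (eval (partial j f) p) = (\<Sum>i\<in>UNIV. D p i * (var i - const_poly (p $ i))))"
    by (intro allI taylor_bounded)
  from choice[OF this] obtain D :: "'n \<Rightarrow> real ^ 'n \<Rightarrow> 'n \<Rightarrow> 'n rpoly"
    where b: "\<And>j i. bounded_keys (\<lambda>p. D j p i)"
    and D: "\<And>j p. partial j f - const_poly (eval (partial j f) p) =
      (\<Sum>i\<in>UNIV. D j p i * (var i - const_poly (p $ i)))" by auto
  define A where "A p = (\<chi> i j. D j p i)" for p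
  \<comment> \<open>The scaling gives the value 1 at a critical point. Elsewhere the determinant may
    vanish at \<open>p\<close>, and then \<open>1 / 0 = 0\<close> makes \<open>c p\<close> zero,
    which does no harm to the bound on the monomials.\<close>
  define c where "c p = const_poly (1 / eval (det (A p)) p) * det (A p)" for p
  have "bounded_keys (\<lambda>p. det (A p))"
    unfolding det_def A_def by (simp, intro bounded_keys_sum bounded_keys_mult bounded_keys_prod bounded_keys_fixed b)
  then have "bounded_keys c"
    unfolding c_def by (intro bounded_keys_mult bounded_keys_const_poly)
  moreover have "eval (c p) p = 1 \<and> (\<forall>h. c p * h - const_poly (eval h p) * c p \<in> gradient_ideal f)"
    if p: "critical_point f p" for p
  proof
    \<comment> \<open>Divided differences of the gradient, evaluated at \<open>p\<close> itself, are
      the second derivatives.\<close>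
    have "eval (det (A p)) p = det (hessian f p)"
      unfolding eval_det A_def hessian_def using taylor_coeff_eval[OF D] by simp
    moreover have "det (hessian f p) \<noteq> 0" using assms p by (simp add: morse_def invertible_det_nz)
    ultimately show "eval (c p) p = 1" by (simp add: c_def eval_simps)
    have cv: "c p * (var k - const_poly (p $ k)) \<in> gradient_ideal f" for k
    proof -
      let ?x = "\<lambda>k. var k - const_poly (p $ k) :: 'n rpoly"
      \<comment> \<open>This combination of the rows is the expansion of the gradient around
        \<open>p\<close>, where the gradient vanishes; so its entries are the generators of the
        ideal.\<close>
      have "(\<Sum>j\<in>UNIV. ?x j *s A p $ j) $ l \<in> gradient_ideal f" for l
      proof -
        have "(\<Sum>j\<in>UNIV. ?x j *s A p $ j) $ l = partial l f - const_poly (eval (partial l f) p)"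
          unfolding D by (simp add: A_def algebra_simps)
        also have "\<dots> = partial l f"
          using p by (simp add: critical_point_def rhom_0[OF rhom_const_poly])
        finally show ?thesis by (simp add: gradient_ideal_partial)
      qed
      then have "det (\<chi> i. if i = k then (\<Sum>j\<in>UNIV. ?x j *s A p $ j) else A p $ i) \<in> gradient_ideal f"
        by (intro det_row_in_ideal[of _ k]) simp
      then have "const_poly (1 / eval (det (A p)) p) * (?x k * det (A p)) \<in> gradient_ideal f"
        unfolding cramer_row by (rule gradient_ideal_mult)
      then show ?thesis by (simp add: c_def mult_ac)
    qed
    show "\<forall>h. c p * h - const_poly (eval h p) * c p \<in> gradient_ideal f"
    proof
      fix h :: "'n rpoly"
      obtain E' where "\<forall>p. h - const_poly (eval h p) = (\<Sum>i\<in>UNIV. E' p i * (var i - const_poly (p $ i)))"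
        using taylor_bounded[of h] by blast
      then obtain E where E: "h - const_poly (eval h p) = (\<Sum>i\<in>UNIV. E i * (var i - const_poly (p $ i)))"
        by blast
      have "c p * h - const_poly (eval h p) * c p = (\<Sum>i\<in>UNIV. E i * (c p * (var i - const_poly (p $ i))))"
        using arg_cong[OF E, of "\<lambda>u. c p * u"]
        by (simp add: right_diff_distrib sum_distrib_left mult.commute mult.left_commute)
      also have "\<dots> \<in> gradient_ideal f" by (intro gradient_ideal_sum gradient_ideal_mult cv)
      finally show "c p * h - const_poly (eval h p) * c p \<in> gradient_ideal f" .
    qed
  qed
  ultimately show ?thesis by blast
qed

text \<open>The polynomials \<open>c p\<close> are dual to evaluation at the points of
  \<open>Z\<close>, hence linearly independent, while their bounded monomials confine them to a
  finite-dimensional space.\<close>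

lemma finite_separated_points:
  fixes c :: "real ^ 'n \<Rightarrow> ('n::finite) rpoly"
  assumes "bounded_keys c" and one: "\<And>p. p \<in> Z \<Longrightarrow> eval (c p) p = 1"
    and zero: "\<And>p p'. p \<in> Z \<Longrightarrow> p' \<in> Z \<Longrightarrow> p \<noteq> p' \<Longrightarrow> eval (c p) p' = 0"
  shows "finite Z"
proof -
  interpret V: vector_space "\<lambda>a (u :: 'n rpoly). const_poly a * u"
    by unfold_locales (simp_all add: algebra_simps rhom_simps[OF rhom_const_poly])
  define M where "M = (\<Union>p. Poly_Mapping.keys (c p))"
  have fin: "finite M" using assms(1) by (simp add: bounded_keys_def M_def)
  have "c p \<in> V.span ((\<lambda>m. Poly_Mapping.single m 1) ` M)" for p
  proof -
    have M: "Poly_Mapping.lookup (c p) m = 0" if "m \<notin> M" for m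
      using that by (auto simp: M_def in_keys_iff)
    have "c p = (\<Sum>m\<in>M. const_poly (Poly_Mapping.lookup (c p) m) * Poly_Mapping.single m 1)"
      by (intro poly_mapping_eqI)
        (auto simp: const_poly_def mult_single lookup_sum lookup_single when_def fin M)
    also have "\<dots> \<in> V.span ((\<lambda>m. Poly_Mapping.single m 1) ` M)"
      by (intro V.span_sum V.span_scale V.span_base) auto
    finally show ?thesis .
  qed
  then have sub: "c ` Z \<subseteq> V.span ((\<lambda>m. Poly_Mapping.single m 1) ` M)" by blast
  have inj: "inj_on c Z"
    by (rule inj_onI) (metis one zero zero_neq_one)
  have "V.independent (c ` Z)"
    unfolding V.dependent_explicit
  proof clarsimp
    fix T u v assume T: "finite T" "T \<subseteq> c ` Z" "(\<Sum>v\<in>T. const_poly (u v) * v) = 0" and v: "v \<in> T"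
    then obtain p where p: "p \<in> Z" "v = c p" by blast
    have "eval w p = (if w = v then 1 else 0)" if w: "w \<in> T" for w
    proof -
      obtain p' where "p' \<in> Z" "w = c p'" using w T(2) by blast
      then show ?thesis using p one[of p] zero[of p' p] by (cases "p' = p"; cases "w = v") auto
    qed
    then have "(\<Sum>w\<in>T. u w * eval w p) = u v"
      using T(1) v by (simp add: if_distrib[where f = "\<lambda>x. _ * x"] cong: if_cong sum.cong)
    moreover have "(\<Sum>w\<in>T. u w * eval w p) = 0"
      using arg_cong[OF T(3), of "\<lambda>h. eval h p"] by (simp add: eval_sum eval_simps)
    ultimately show "u v = 0" by simp
  qed
  then have "finite (c ` Z)"
    using V.independent_span_bound[OF _ _ sub] fin by blast
  then show ?thesis using inj by (rule finite_imageD)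
qed

theorem proposition4p1:
  fixes f :: "('n::finite) rpoly" and fmin :: real
  assumes "morse f"
    and "has_minimum_value (eval f) fmin"
  shows "f - const_poly fmin \<in> sums_of_squares + gradient_ideal f"
proof -
  let ?I = "gradient_ideal f"
  define Z where "Z = {p. critical_point f p}"
  obtain c where c: "bounded_keys c" "\<And>p. p \<in> Z \<Longrightarrow> eval (c p) p = 1"
    and cI: "\<And>p h. p \<in> Z \<Longrightarrow> c p * h - const_poly (eval h p) * c p \<in> ?I"
    using critical_idempotents[OF assms(1)] unfolding Z_def by blast
  have c0: "eval (c p) p' = 0" if pp: "p \<in> Z" "p' \<in> Z" "p \<noteq> p'" for p p'
  proof -
    \<comment> \<open>In a coordinate that separates the points, the ideal element
      \<open>c p * (var k - const_poly (p $ k))\<close> vanishes at \<open>p'\<close> although its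
      second factor does not.\<close>
    obtain k where k: "p $ k \<noteq> p' $ k" using pp(3) by (auto simp: vec_eq_iff)
    have "eval (c p * var k - const_poly (eval (var k) p) * c p) p' = 0"
      using gradient_ideal_eval[OF cI[OF pp(1)]] pp(2) by (simp add: Z_def)
    then have "eval (c p) p' * (p' $ k - p $ k) = 0" by (simp add: eval_simps algebra_simps)
    then show ?thesis using k by simp
  qed
  have fin: "finite Z" by (rule finite_separated_points[OF c c0])
  \<comment> \<open>The gradient terms vanish only on \<open>Z\<close>, and at \<open>x\<close> in
    \<open>Z\<close> the term from \<open>c x\<close> equals 1. All terms are killed by
    \<open>e\<close> modulo the ideal.\<close>
  define q where "q = (\<Sum>i\<in>UNIV. (partial i f)\<^sup>2) + (\<Sum>p\<in>Z. (c p)\<^sup>2)"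
  have "eval q x \<noteq> 0" for x
  proof
    assume "eval q x = 0"
    then have "(\<Sum>i\<in>UNIV. (eval (partial i f) x)\<^sup>2) + (\<Sum>p\<in>Z. (eval (c p) x)\<^sup>2) = 0"
      by (simp add: q_def eval_sum eval_simps)
    moreover have "0 \<le> (\<Sum>i\<in>UNIV. (eval (partial i f) x)\<^sup>2)" "0 \<le> (\<Sum>p\<in>Z. (eval (c p) x)\<^sup>2)"
      by (intro sum_nonneg; simp)+
    ultimately have "(\<Sum>i\<in>UNIV. (eval (partial i f) x)\<^sup>2) = 0" "(\<Sum>p\<in>Z. (eval (c p) x)\<^sup>2) = 0"
      by linarith+
    then have "\<And>i. eval (partial i f) x = 0" "\<And>p. p \<in> Z \<Longrightarrow> eval (c p) x = 0"
      using fin by (simp_all add: sum_nonneg_eq_0_iff)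
    then show False using c(2)[of x] by (simp add: Z_def critical_point_def)
  qed
  then obtain s k where s: "s \<in> sums_of_squares" "- 1 = s + q * k" using real_nullstellensatz by blast
  define e where "e = 1 - (\<Sum>p\<in>Z. c p)"
  have ec: "e * c p \<in> ?I" if "p \<in> Z" for p
  proof -
    have "(\<Sum>p'\<in>Z. eval (c p') p) = (\<Sum>p'\<in>Z. if p' = p then 1 else 0)"
      using c(2) c0 that by (intro sum.cong) auto
    \<comment> \<open>Only \<open>c p\<close> contributes at \<open>p\<close>, so \<open>e\<close>
      vanishes there and \<open>e * c p\<close> is congruent to zero.\<close>
    then have "eval e p = 0" using that fin by (simp add: e_def eval_sum eval_simps)
    then show ?thesis using cI[OF that, of e] by (simp add: rhom_0[OF rhom_const_poly] mult.commute)
  qed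
  have eq: "e * q \<in> ?I"
  proof -
    have "e * q = (\<Sum>i\<in>UNIV. (e * partial i f) * partial i f) + (\<Sum>p\<in>Z. c p * (e * c p))"
      by (simp add: q_def distrib_left sum_distrib_left power2_eq_square mult_ac)
    then show ?thesis
      by (simp add: gradient_ideal_add gradient_ideal_sum gradient_ideal_mult gradient_ideal_partial ec)
  qed
  have ee: "e * e - e \<in> ?I"
  proof -
    have "e * e - e = 0 - (\<Sum>p\<in>Z. e * c p)"
      by (subst (2) e_def) (simp add: right_diff_distrib sum_distrib_left)
    then show ?thesis by (metis ec gradient_ideal_0 gradient_ideal_diff gradient_ideal_sum)
  qed
  define g where "g = f - const_poly fmin"
  have g0: "0 \<le> eval g p" for p
    using assms(2) by (simp add: g_def has_minimum_value_def eval_simps)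
  \<comment> \<open>These satisfy \<open>g = a\<^sup>2 - b\<^sup>2\<close>; on the part of
    \<open>e\<close> the factor \<open>- 1\<close> of the second square is replaced by
    \<open>s\<close>.\<close>
  define a b where "a = const_poly (1 / 2) * (g + 1)" and "b = const_poly (1 / 2) * (g - 1)"
  have half: "const_poly (1 / 2) + const_poly (1 / 2) = (1 :: 'n rpoly)"
    by (simp add: rhom_1[OF rhom_const_poly] flip: rhom_add[OF rhom_const_poly])
  have "a + b = (const_poly (1 / 2) + const_poly (1 / 2)) * g" "a - b = const_poly (1 / 2) + const_poly (1 / 2)"
    by (simp_all add: a_def b_def algebra_simps)
  then have g: "g = (a + b) * (a - b)" by (simp add: half)
  define r where "r p = const_poly (sqrt (eval g p)) * c p" for p
  define \<sigma> where "\<sigma> = (\<Sum>p\<in>Z. (r p)\<^sup>2) + (e * a)\<^sup>2 + s * (e * b)\<^sup>2"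
  have "\<sigma> \<in> sums_of_squares"
    unfolding \<sigma>_def
    by (intro sums_of_squares_add sums_of_squares_sum sums_of_squares_mult sums_of_squares_square s(1))
  moreover have "g - \<sigma> \<in> ?I"
  proof -
    have "c p * g - (r p)\<^sup>2 \<in> ?I" if p: "p \<in> Z" for p
    proof -
      have "const_poly (sqrt (eval g p)) * const_poly (sqrt (eval g p)) = (const_poly (eval g p) :: 'n rpoly)"
        by (subst rhom_mult[OF rhom_const_poly, symmetric]) (simp add: g0)
      moreover have "(r p)\<^sup>2 = const_poly (sqrt (eval g p)) * const_poly (sqrt (eval g p)) * (c p * c p)"
        unfolding r_def power2_eq_square by (simp only: mult.assoc mult.commute mult.left_commute)
      ultimately have "(r p)\<^sup>2 = const_poly (eval g p) * (c p * c p)" by (simp only:)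
      then have "c p * g - (r p)\<^sup>2 = (c p * g - const_poly (eval g p) * c p) -
          const_poly (eval g p) * (c p * c p - const_poly (eval (c p) p) * c p)"
        using c(2)[OF p] by (simp add: rhom_1[OF rhom_const_poly] algebra_simps)
      then show ?thesis by (simp only: gradient_ideal_diff gradient_ideal_mult cI[OF p])
    qed
    then have Zpart: "(\<Sum>p\<in>Z. c p * g - (r p)\<^sup>2) \<in> ?I" by (rule gradient_ideal_sum)
    have cert: "e * (1 + s) \<in> ?I"
    proof -
      have "1 + s = - (q * k)" using arg_cong[OF s(2), of "\<lambda>x. x + (1 - q * k)"] by simp
      then have "e * (1 + s) = (- k) * (e * q)" by (simp add: mult_ac)
      then show ?thesis using eq by (metis gradient_ideal_mult)
    qed
    have "g = (\<Sum>p\<in>Z. c p) * g + e * g" by (simp add: e_def algebra_simps)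
    then have "g - \<sigma> = (\<Sum>p\<in>Z. c p * g - (r p)\<^sup>2) + (e * g - (e * a)\<^sup>2 - s * (e * b)\<^sup>2)"
      by (simp add: \<sigma>_def sum_subtractf sum_distrib_right)
    \<comment> \<open>Replacing \<open>e * e\<close> by \<open>e\<close> costs a multiple of
      \<open>e * e - e\<close>, and replacing \<open>- 1\<close> by \<open>s\<close> costs a
      multiple of \<open>e * (1 + s)\<close>; both lie in the ideal.\<close>
    moreover have "e * g - (e * a)\<^sup>2 - s * (e * b)\<^sup>2 =
        (- (a * a) - s * (b * b)) * (e * e - e) - (b * b) * (e * (1 + s))"
      by (subst g) (simp add: power2_eq_square algebra_simps)
    ultimately show ?thesis
      by (simp only: Zpart ee cert gradient_ideal_add gradient_ideal_diff gradient_ideal_mult)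
  qed
  ultimately have "\<sigma> + (g - \<sigma>) \<in> sums_of_squares + ?I" by (rule set_plus_intro)
  then show ?thesis by (simp add: g_def)
qed

end
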